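(* Let $q\in(-1,1)$ and $n\geq 1$ satisfy $q^2n<1$, let $C\in M_n(\mathbb{R})$ be symmetric positive definite, and let $X=(x(e_1),\dots,x(e_n))$ be the tuple of $q$-semicircular operators associated with vectors $e_1,\dots,e_n\in\mathcal{H}_{\mathbb{R}}=\mathbb{R}^n$ satisfying $\langle e_i,e_j\rangle=C_{i,j}$. Then the free Stein discrepancy of $X$ relative to $V_C$ satisfies $$\Sigma^*(X|V_C)\le\frac{|q|\,n}{\sqrt{1-q^2n}}.$$
   Context: $\mathcal{H}_{\mathbb{R}}=\mathbb{R}^n$ with complexification $\mathcal{H}_{\mathbb{C}}$. The $q$-Fock space $\mathcal{F}_q(\mathcal{H}_{\mathbb{C}})$ is the completion of $\mathbb{C}\Omega\oplus\bigoplus_{k\ge1}\mathcal{H}_{\mathbb{C}}^{\otimes k}$ for $\langle g_1\otimes\cdots\otimes g_k,h_1\otimes\cdots\otimes h_m\rangle_q=\delta_{k,m}\sum_{\sigma\in S_k}q^{inv(\sigma)}\langle g_1,h_{\sigma(1)}\rangle\cdots\langle g_k,h_{\sigma(k)}\rangle$, where $inv(\sigma)$ is the number of inversions. $l(h)$ is the left creation operator $g_1\otimes\cdots\otimes g_k\mapsto h\otimes g_1\otimes\cdots\otimes g_k$, $l^*(h)$ its adjoint, and $x(h)=l(h)+l^*(h)$ for $h\in\mathcal{H}_{\mathbb{R}}$, an element of the von Neumann algebra $\Gamma_q(\mathcal{H}_{\mathbb{R}})$ generated by all such $x(h)$, with tracial state $\tau(Y)=\langle Y\Omega,\Omega\rangle$.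 On $\mathbb{C}\langle t_1,\dots,t_n\rangle$: $\partial_jm=\sum_{m=at_jb}a\otimes b^{op}$, $D_jm=\sum_{m=at_jb}ba$ on monomials; $\mathcal{J}P=(\partial_jp_i)_{i,j}$. $V_C=\frac12\sum_{i,j}(C^{-1})_{i,j}t_it_j$, so $[DV_C](X)=C^{-1}X$. With $\mathcal{M}=W^*(X)$, a free Stein kernel of $X$ with respect to $V$ is an $A\in L^2(M_n(\mathcal{M}\bar\otimes\mathcal{M}^{op}),(\tau\otimes\tau^{op})\circ Tr)$ with $\langle[DV](X),P(X)\rangle_2=\langle A,[\mathcal{J}P](X)\rangle_{HS}$ for all $P\in\mathbb{C}\langle t_1,\dots,t_n\rangle^n$, where $\langle X,Y\rangle_2=\sum_i\tau(X_i^*Y_i)$ and $\langle A,B\rangle_{HS}=\sum_{i,j}\langle A_{i,j},B_{i,j}\rangle_{\tau\otimes\tau^{op}}$ (unnormalized trace). The free Stein discrepancy is $\Sigma^*(X|V)=\inf_A\|A-(1\otimes1^{op})\otimes I_n\|_{HS}$ over all free Stein kernels $A$ of $X$ with respect to $V$. *)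

theory Defs
  imports
    "HOL-Analysis.Analysis"
    "HOL-Combinatorics.Permutations"
    "HOL-Library.Poly_Mapping"
begin

section \<open>Graded Hilbert spaces of coefficient functions\<close>

text \<open>
  A graded basis consists of an index set (the type \<open>'w\<close>), the Gram matrix of the basis
  vectors and a degree function with finite fibres, different degrees being understood as
  orthogonal. If every homogeneous block of the Gram matrix is positive definite, the completion of
  the span of the basis is the Hilbert direct sum of the finite-dimensional homogeneous
  components. Its elements are coefficient functions \<open>'w \<Rightarrow> complex\<close>, with pointwise
  linear structure. Inner products are linear in the first argument.
\<close>

record ('w, 'd) gbasis =
  gram :: "'w \<Rightarrow> 'w \<Rightarrow> complex"
  deg :: "'w \<Rightarrow> 'd"

definition block_ip ::
  "('w, 'd) gbasis \<Rightarrow> 'd \<Rightarrow> ('w \<Rightarrow> complex) \<Rightarrow> ('w \<Rightarrow> complex) \<Rightarrow> complex" where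
  "block_ip H k \<xi> \<eta> =
     (\<Sum>u | deg H u = k. \<Sum>v | deg H v = k. \<xi> u * cnj (\<eta> v) * gram H u v)"

definition hcarrier :: "('w, 'd) gbasis \<Rightarrow> ('w \<Rightarrow> complex) set" where
  "hcarrier H = {\<xi>. (\<lambda>k. Re (block_ip H k \<xi> \<xi>)) summable_on UNIV}"

definition hip ::
  "('w, 'd) gbasis \<Rightarrow> ('w \<Rightarrow> complex) \<Rightarrow> ('w \<Rightarrow> complex) \<Rightarrow> complex" where
  "hip H \<xi> \<eta> = (\<Sum>\<^sub>\<infinity>k. block_ip H k \<xi> \<eta>)"

definition hnorm :: "('w, 'd) gbasis \<Rightarrow> ('w \<Rightarrow> complex) \<Rightarrow> real" where
  "hnorm H \<xi> = sqrt (Re (hip H \<xi> \<xi>))"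

definition hconj :: "('w, 'd) gbasis \<Rightarrow> ('w, 'd) gbasis" where
  "hconj H = \<lparr>gram = (\<lambda>u v. cnj (gram H u v)), deg = deg H\<rparr>"

definition conj_vec :: "('w \<Rightarrow> complex) \<Rightarrow> 'w \<Rightarrow> complex" where
  "conj_vec \<xi> = (\<lambda>w. cnj (\<xi> w))"

definition htensor ::
  "('w, 'd) gbasis \<Rightarrow> ('v, 'e) gbasis \<Rightarrow> ('w \<times> 'v, 'd \<times> 'e) gbasis" where
  "htensor H K =
     \<lparr>gram = (\<lambda>(u, u') (v, v'). gram H u v * gram K u' v'),
      deg = (\<lambda>(u, u'). (deg H u, deg K u'))\<rparr>"

definition tensor_vec ::
  "('w \<Rightarrow> complex) \<Rightarrow> ('v \<Rightarrow> complex) \<Rightarrow> 'w \<times> 'v \<Rightarrow> complex" where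
  "tensor_vec \<xi> \<eta> = (\<lambda>(u, v). \<xi> u * \<eta> v)"


section \<open>Bounded operators and von Neumann algebras\<close>

type_synonym 'w oper = "('w \<Rightarrow> complex) \<Rightarrow> ('w \<Rightarrow> complex)"

text \<open>
  Operators vanish outside the carrier, so that equality of operators is equality of functions.
\<close>

definition restrict_op :: "('w, 'd) gbasis \<Rightarrow> 'w oper \<Rightarrow> 'w oper" where
  "restrict_op H T = (\<lambda>\<xi>. if \<xi> \<in> hcarrier H then T \<xi> else (\<lambda>_. 0))"

definition bounded_ops :: "('w, 'd) gbasis \<Rightarrow> 'w oper set" where
  "bounded_ops H =
     {T. restrict_op H T = T \<and> T ` hcarrier H \<subseteq> hcarrier H \<and>
         (\<forall>\<xi>\<in>hcarrier H. \<forall>\<eta>\<in>hcarrier H. \<forall>c.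
            T (\<lambda>w. c * \<xi> w + \<eta> w) = (\<lambda>w. c * T \<xi> w + T \<eta> w)) \<and>
         (\<exists>B. \<forall>\<xi>\<in>hcarrier H. hnorm H (T \<xi>) \<le> B * hnorm H \<xi>)}"

definition one_op :: "('w, 'd) gbasis \<Rightarrow> 'w oper" where
  "one_op H = restrict_op H (\<lambda>\<xi>. \<xi>)"

definition adj_op :: "('w, 'd) gbasis \<Rightarrow> 'w oper \<Rightarrow> 'w oper" where
  "adj_op H T =
     (THE S. S \<in> bounded_ops H \<and>
        (\<forall>\<xi>\<in>hcarrier H. \<forall>\<eta>\<in>hcarrier H. hip H (T \<xi>) \<eta> = hip H \<xi> (S \<eta>)))"

definition commutant :: "('w, 'd) gbasis \<Rightarrow> 'w oper set \<Rightarrow> 'w oper set" where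
  "commutant H S = {T \<in> bounded_ops H. \<forall>s\<in>S. T \<circ> s = s \<circ> T}"

definition vN_generated :: "('w, 'd) gbasis \<Rightarrow> 'w oper set \<Rightarrow> 'w oper set" where
  "vN_generated H S = commutant H (commutant H (S \<union> adj_op H ` S))"

definition tensor_op ::
  "('w, 'd) gbasis \<Rightarrow> ('v, 'e) gbasis \<Rightarrow> 'w oper \<Rightarrow> 'v oper \<Rightarrow> ('w \<times> 'v) oper" where
  "tensor_op H K a b =
     (THE T. T \<in> bounded_ops (htensor H K) \<and>
        (\<forall>\<xi>\<in>hcarrier H. \<forall>\<eta>\<in>hcarrier K.
           T (tensor_vec \<xi> \<eta>) = tensor_vec (a \<xi>) (b \<eta>)))"

definition vN_tensor ::
  "('w, 'd) gbasis \<Rightarrow> ('v, 'e) gbasis \<Rightarrow> 'w oper set \<Rightarrow> 'v oper set \<Rightarrow> ('w \<times> 'v) oper set" where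
  "vN_tensor H K M N = vN_generated (htensor H K) {tensor_op H K a b | a b. a \<in> M \<and> b \<in> N}"

text \<open>
  The opposite algebra of \<open>M \<subseteq> B(H)\<close> is realised on the conjugate Hilbert space: \<open>b\<^sup>o\<^sup>p\<close> acts by
  \<open>conj_vec \<eta> \<mapsto> conj_vec (b\<^sup>* \<eta>)\<close>, which is linear in \<open>b\<close>, compatible with the involution and
  reverses products. The vector state of \<open>conj_vec \<Omega>\<close> takes the value \<open>\<langle>b \<Omega>, \<Omega>\<rangle>\<close> at \<open>b\<^sup>o\<^sup>p\<close>.
\<close>

definition op_of :: "('w, 'd) gbasis \<Rightarrow> 'w oper \<Rightarrow> 'w oper" where
  "op_of H b = (\<lambda>\<eta>. conj_vec (adj_op H b (conj_vec \<eta>)))"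

text \<open>
  For a vector state \<open>\<phi>(T) = \<langle>T \<omega>, \<omega>\<rangle>\<close> on \<open>N\<close> we have \<open>\<phi>(S\<^sup>* T) = \<langle>T \<omega>, S \<omega>\<rangle>\<close>, so the completion
  \<open>L\<^sup>2(N, \<phi>)\<close> is the closure of \<open>N \<omega>\<close>, with \<open>T\<close> embedded as \<open>T \<omega>\<close>.
\<close>

definition L2_space ::
  "('w, 'd) gbasis \<Rightarrow> 'w oper set \<Rightarrow> ('w \<Rightarrow> complex) \<Rightarrow> ('w \<Rightarrow> complex) set" where
  "L2_space H N \<omega> =
     {\<zeta> \<in> hcarrier H. \<forall>\<epsilon>>0. \<exists>T\<in>N. hnorm H (\<lambda>w. \<zeta> w - T \<omega> w) < \<epsilon>}"


section \<open>Noncommutative polynomials\<close>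

text \<open>
  \<open>'i ncpoly\<close> is the space of complex polynomials in noncommuting variables indexed by \<open>'i\<close>, the
  monomials being words; \<open>'i ncpoly2\<close> is its tensor product with the opposite algebra, the
  pair \<open>(a, b)\<close> standing for \<open>a \<otimes> b\<^sup>o\<^sup>p\<close>.
\<close>

type_synonym 'i ncpoly = "'i list \<Rightarrow>\<^sub>0 complex"
type_synonym 'i ncpoly2 = "('i list \<times> 'i list) \<Rightarrow>\<^sub>0 complex"

definition free_diff :: "'i \<Rightarrow> 'i ncpoly \<Rightarrow> 'i ncpoly2" where
  "free_diff j P =
     (\<Sum>m\<in>Poly_Mapping.keys P. \<Sum>s | s < length m \<and> m ! s = j.
        Poly_Mapping.single (take s m, drop (Suc s) m) (Poly_Mapping.lookup P m))"

definition cyc_grad :: "'i \<Rightarrow> 'i ncpoly \<Rightarrow> 'i ncpoly" where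
  "cyc_grad j P =
     (\<Sum>m\<in>Poly_Mapping.keys P. \<Sum>s | s < length m \<and> m ! s = j.
        Poly_Mapping.single (drop (Suc s) m @ take s m) (Poly_Mapping.lookup P m))"

definition eval_word :: "('w, 'd) gbasis \<Rightarrow> ('i \<Rightarrow> 'w oper) \<Rightarrow> 'i list \<Rightarrow> 'w oper" where
  "eval_word H X m = foldr (\<lambda>i T. X i \<circ> T) m (one_op H)"

definition eval_poly :: "('w, 'd) gbasis \<Rightarrow> ('i \<Rightarrow> 'w oper) \<Rightarrow> 'i ncpoly \<Rightarrow> 'w oper" where
  "eval_poly H X P =
     (\<lambda>\<xi> w. \<Sum>m\<in>Poly_Mapping.keys P. Poly_Mapping.lookup P m * eval_word H X m \<xi> w)"

definition eval_poly2 ::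
  "('w, 'd) gbasis \<Rightarrow> ('i \<Rightarrow> 'w oper) \<Rightarrow> 'i ncpoly2 \<Rightarrow> ('w \<times> 'w) oper" where
  "eval_poly2 H X Q =
     (\<lambda>\<zeta> w. \<Sum>(a, b)\<in>Poly_Mapping.keys Q. Poly_Mapping.lookup Q (a, b) *
        tensor_op H (hconj H) (eval_word H X a) (op_of H (eval_word H X b)) \<zeta> w)"


section \<open>Free Stein kernels and the free Stein discrepancy\<close>

text \<open>
  Throughout, \<open>X\<close> is a tuple of operators on \<open>H\<close> and the trace is the vector state of \<open>\<Omega>\<close>.
\<close>

definition trace_state ::
  "('w, 'd) gbasis \<Rightarrow> ('w \<Rightarrow> complex) \<Rightarrow> 'w oper \<Rightarrow> complex" where
  "trace_state H \<Omega> Y = hip H (Y \<Omega>) \<Omega>"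

definition bip_space :: "('w, 'd) gbasis \<Rightarrow> ('w \<times> 'w, 'd \<times> 'd) gbasis" where
  "bip_space H = htensor H (hconj H)"

definition bip_vec :: "('w \<Rightarrow> complex) \<Rightarrow> 'w \<times> 'w \<Rightarrow> complex" where
  "bip_vec \<Omega> = tensor_vec \<Omega> (conj_vec \<Omega>)"

definition L2_bip ::
  "('w, 'd) gbasis \<Rightarrow> ('w \<Rightarrow> complex) \<Rightarrow> 'w oper set \<Rightarrow> ('w \<times> 'w \<Rightarrow> complex) set" where
  "L2_bip H \<Omega> M =
     L2_space (bip_space H) (vN_tensor H (hconj H) M (op_of H ` M)) (bip_vec \<Omega>)"

text \<open>
  An element of \<open>L\<^sup>2(M\<^sub>n(N), \<phi> \<circ> Tr)\<close> is a matrix of elements of \<open>L\<^sup>2(N, \<phi>)\<close>. The form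
  \<open>\<langle>A, B\<rangle> = \<Sum> \<phi>(A\<^sub>i\<^sub>j\<^sup>* B\<^sub>i\<^sub>j)\<close> is linear in \<open>B\<close>, whence the order of the arguments of \<open>hip\<close>.
\<close>

definition hs_ip ::
  "('w, 'd) gbasis \<Rightarrow> ('i::finite \<Rightarrow> 'i \<Rightarrow> 'w \<times> 'w \<Rightarrow> complex) \<Rightarrow>
     ('i \<Rightarrow> 'i \<Rightarrow> 'w \<times> 'w \<Rightarrow> complex) \<Rightarrow> complex" where
  "hs_ip H A B = (\<Sum>i\<in>UNIV. \<Sum>j\<in>UNIV. hip (bip_space H) (B i j) (A i j))"

definition hs_norm ::
  "('w, 'd) gbasis \<Rightarrow> ('i::finite \<Rightarrow> 'i \<Rightarrow> 'w \<times> 'w \<Rightarrow> complex) \<Rightarrow> real" where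
  "hs_norm H A = sqrt (Re (hs_ip H A A))"

definition jacobian_at ::
  "('w, 'd) gbasis \<Rightarrow> ('w \<Rightarrow> complex) \<Rightarrow> ('i \<Rightarrow> 'w oper) \<Rightarrow> ('i \<Rightarrow> 'i ncpoly) \<Rightarrow>
     'i \<Rightarrow> 'i \<Rightarrow> 'w \<times> 'w \<Rightarrow> complex" where
  "jacobian_at H \<Omega> X P = (\<lambda>i j. eval_poly2 H X (free_diff j (P i)) (bip_vec \<Omega>))"

definition is_free_stein_kernel ::
  "('w, 'd) gbasis \<Rightarrow> ('w \<Rightarrow> complex) \<Rightarrow> ('i::finite \<Rightarrow> 'w oper) \<Rightarrow> 'i ncpoly \<Rightarrow>
     ('i \<Rightarrow> 'i \<Rightarrow> 'w \<times> 'w \<Rightarrow> complex) \<Rightarrow> bool" where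
  "is_free_stein_kernel H \<Omega> X V A \<longleftrightarrow>
     (\<forall>i j. A i j \<in> L2_bip H \<Omega> (vN_generated H (range X))) \<and>
     (\<forall>P :: 'i \<Rightarrow> 'i ncpoly.
        (\<Sum>i\<in>UNIV. trace_state H \<Omega>
           (adj_op H (eval_poly H X (cyc_grad i V)) \<circ> eval_poly H X (P i)))
        = hs_ip H A (jacobian_at H \<Omega> X P))"

definition identity_kernel ::
  "('w, 'd) gbasis \<Rightarrow> ('w \<Rightarrow> complex) \<Rightarrow> 'i \<Rightarrow> 'i \<Rightarrow> 'w \<times> 'w \<Rightarrow> complex" where
  "identity_kernel H \<Omega> =
     (\<lambda>i j. if i = j
        then tensor_op H (hconj H) (one_op H) (op_of H (one_op H)) (bip_vec \<Omega>)
        else (\<lambda>_. 0))"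

text \<open>The infimum is taken in \<open>ereal\<close>: it is \<open>\<infinity>\<close> if there is no free Stein kernel.\<close>

definition free_stein_discrepancy ::
  "('w, 'd) gbasis \<Rightarrow> ('w \<Rightarrow> complex) \<Rightarrow> ('i::finite \<Rightarrow> 'w oper) \<Rightarrow> 'i ncpoly \<Rightarrow> ereal" where
  "free_stein_discrepancy H \<Omega> X V =
     (INF A\<in>{A. is_free_stein_kernel H \<Omega> X V A}.
        ereal (hs_norm H (\<lambda>i j w. A i j w - identity_kernel H \<Omega> i j w)))"

definition quad_potential :: "real^'n^'n \<Rightarrow> ('n::finite) ncpoly" where
  "quad_potential C =
     (\<Sum>i\<in>UNIV. \<Sum>j\<in>UNIV.
        Poly_Mapping.single [i, j] (complex_of_real (1 / 2 * matrix_inv C $ i $ j)))"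


section \<open>The q-Fock space and q-semicircular operators\<close>

definition inversions :: "nat \<Rightarrow> (nat \<Rightarrow> nat) \<Rightarrow> nat" where
  "inversions k \<sigma> = card {(i, j). i < j \<and> j < k \<and> \<sigma> i > \<sigma> j}"

text \<open>
  The word \<open>u\<close> of length \<open>k\<close> indexes the tensor product of the standard basis vectors
  \<open>axis (u ! 0) 1, \<dots>, axis (u ! (k - 1)) 1\<close> of \<open>complex^'n\<close>. Lemma \<open>hip_q_fock_elem_tensor\<close>
  below gives the inner product of arbitrary elementary tensors.
\<close>

definition q_fock :: "real \<Rightarrow> ('n::finite list, nat) gbasis" where
  "q_fock q =
     \<lparr>gram = (\<lambda>u v. if length u = length v
        then \<Sum>\<sigma> | \<sigma> permutes {..<length u}. complex_of_real (q ^ inversions (length u) \<sigma>) *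
               (\<Prod>i<length u. if u ! i = v ! \<sigma> i then 1 else 0)
        else 0),
      deg = length\<rparr>"

definition vacuum :: "'n list \<Rightarrow> complex" where
  "vacuum = (\<lambda>w. if w = [] then 1 else 0)"

definition elem_tensor :: "(complex^'n) list \<Rightarrow> 'n list \<Rightarrow> complex" where
  "elem_tensor gs =
     (\<lambda>w. if length w = length gs then \<Prod>i<length gs. gs ! i $ (w ! i) else 0)"

definition creation :: "real \<Rightarrow> complex^'n \<Rightarrow> ('n::finite list) oper" where
  "creation q h =
     restrict_op (q_fock q) (\<lambda>\<xi> w. case w of [] \<Rightarrow> 0 | i # w' \<Rightarrow> h $ i * \<xi> w')"

definition complexify :: "real^'n \<Rightarrow> complex^'n" where
  "complexify h = (\<chi> i. complex_of_real (h $ i))"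

definition q_semicircular :: "real \<Rightarrow> real^'n \<Rightarrow> ('n::finite list) oper" where
  "q_semicircular q h =
     (\<lambda>\<xi> w. creation q (complexify h) \<xi> w + adj_op (q_fock q) (creation q (complexify h)) \<xi> w)"

lemma sum_words_prod:
  fixes f :: "nat \<Rightarrow> 'n::finite \<Rightarrow> complex"
  shows "(\<Sum>u | length u = k. \<Prod>i<k. f i (u ! i)) = (\<Prod>i<k. \<Sum>a\<in>UNIV. f i a)"
proof (induction k arbitrary: f)
  case 0
  then show ?case by simp
next
  case (Suc k)
  have inj: "inj_on (\<lambda>(a, w). a # w) (UNIV \<times> {u :: 'n list. length u = k})"
    by (auto simp: inj_on_def)
  have im: "{u :: 'n list. length u = Suc k} = (\<lambda>(a, w). a # w) ` (UNIV \<times> {u. length u = k})"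
    by (auto simp: length_Suc_conv)
  have "(\<Sum>u | length u = Suc k. \<Prod>i<Suc k. f i (u ! i)) =
      (\<Sum>(a, w) \<in> UNIV \<times> {u. length u = k}. f 0 a * (\<Prod>i<k. f (Suc i) (w ! i)))"
    unfolding im sum.reindex[OF inj] prod.lessThan_Suc_shift by (simp add: case_prod_beta)
  also have "\<dots> = (\<Sum>a\<in>UNIV. f 0 a) * (\<Sum>w | length w = k. \<Prod>i<k. f (Suc i) (w ! i))"
    by (simp add: sum.cartesian_product[symmetric] sum_product)
  also have "\<dots> = (\<Prod>i<Suc k. \<Sum>a\<in>UNIV. f i a)"
    using Suc.IH[of "\<lambda>i. f (Suc i)"] unfolding prod.lessThan_Suc_shift by simp
  finally show ?case .
qed

lemma block_ip_elem_tensor: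
  fixes gs hs :: "(complex^'n) list"
  assumes "length gs = k" "length hs = k"
  shows "block_ip (q_fock q) k (elem_tensor gs) (elem_tensor hs) =
    (\<Sum>\<sigma> | \<sigma> permutes {..<k}. complex_of_real (q ^ inversions k \<sigma>) *
       (\<Prod>i<k. \<Sum>a\<in>UNIV. gs ! i $ a * cnj (hs ! \<sigma> i $ a)))"
proof -
  let ?W = "{u :: 'n list. length u = k}" and ?S = "{\<sigma>. \<sigma> permutes {..<k}}"
  have main: "(\<Sum>u\<in>?W. \<Sum>v\<in>?W. (\<Prod>i<k. gs ! i $ (u ! i)) * cnj (\<Prod>i<k. hs ! i $ (v ! i)) *
        (\<Prod>i<k. if u ! i = v ! \<sigma> i then 1 else 0)) =
      (\<Prod>i<k. \<Sum>a\<in>UNIV. gs ! i $ a * cnj (hs ! \<sigma> i $ a))" (is "?L = ?R")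
    if \<sigma>: "\<sigma> permutes {..<k}" for \<sigma>
  proof -
    let ?t = "inv \<sigma>"
    have t: "?t permutes {..<k}" by (rule permutes_inv[OF \<sigma>])
    have "?L = (\<Sum>v\<in>?W. \<Sum>u\<in>?W. \<Prod>i<k. gs ! i $ (u ! i) * cnj (hs ! \<sigma> i $ (v ! \<sigma> i)) *
        (if u ! i = v ! \<sigma> i then 1 else 0))"
      by (subst sum.swap)
        (simp add: prod.distrib prod.permute[OF \<sigma>, of "\<lambda>i. cnj (hs ! i $ (_ ! i))"] o_def)
    also have "\<dots> = (\<Sum>v\<in>?W. \<Prod>i<k. gs ! i $ (v ! \<sigma> i) * cnj (hs ! \<sigma> i $ (v ! \<sigma> i)))"
    proof (rule sum.cong[OF refl])
      fix v :: "'n list"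
      show "(\<Sum>u\<in>?W. \<Prod>i<k. gs ! i $ (u ! i) * cnj (hs ! \<sigma> i $ (v ! \<sigma> i)) *
          (if u ! i = v ! \<sigma> i then 1 else 0)) =
        (\<Prod>i<k. gs ! i $ (v ! \<sigma> i) * cnj (hs ! \<sigma> i $ (v ! \<sigma> i)))"
        using sum_words_prod[where k = k and f = "\<lambda>i a. gs ! i $ a * cnj (hs ! \<sigma> i $ (v ! \<sigma> i)) *
          (if a = v ! \<sigma> i then 1 else 0)"]
        by (simp add: if_distrib[of "\<lambda>x. _ * x"] cong: if_cong)
    qed
    also have "\<dots> = (\<Sum>v\<in>?W. \<Prod>i<k. gs ! ?t i $ (v ! i) * cnj (hs ! i $ (v ! i)))"
      by (rule sum.cong[OF refl], subst prod.permute[OF \<sigma>, of "\<lambda>i. gs ! ?t i $ (_ ! i) * _ i"])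
        (simp add: o_def permutes_inverses(2)[OF \<sigma>])
    also have "\<dots> = (\<Prod>i<k. \<Sum>a\<in>UNIV. gs ! ?t i $ a * cnj (hs ! i $ a))"
      by (rule sum_words_prod)
    also have "\<dots> = ?R"
      by (subst prod.permute[OF \<sigma>]) (simp add: o_def permutes_inverses(2)[OF \<sigma>])
    finally show ?thesis .
  qed
  have "block_ip (q_fock q) k (elem_tensor gs) (elem_tensor hs) =
      (\<Sum>u\<in>?W. \<Sum>v\<in>?W. \<Sum>\<sigma>\<in>?S. complex_of_real (q ^ inversions k \<sigma>) *
        ((\<Prod>i<k. gs ! i $ (u ! i)) * cnj (\<Prod>i<k. hs ! i $ (v ! i)) *
        (\<Prod>i<k. if u ! i = v ! \<sigma> i then 1 else 0)))"
    using assms by (simp add: block_ip_def q_fock_def elem_tensor_def sum_distrib_left mult_ac)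
  also have "\<dots> = (\<Sum>\<sigma>\<in>?S. complex_of_real (q ^ inversions k \<sigma>) * (\<Sum>u\<in>?W. \<Sum>v\<in>?W.
        ((\<Prod>i<k. gs ! i $ (u ! i)) * cnj (\<Prod>i<k. hs ! i $ (v ! i)) *
        (\<Prod>i<k. if u ! i = v ! \<sigma> i then 1 else 0))))"
    unfolding sum_distrib_left
    by (subst sum.swap[of _ ?S ?W, symmetric], subst sum.swap[of _ ?S ?W, symmetric]) simp
  also have "\<dots> = (\<Sum>\<sigma>\<in>?S. complex_of_real (q ^ inversions k \<sigma>) *
       (\<Prod>i<k. \<Sum>a\<in>UNIV. gs ! i $ a * cnj (hs ! \<sigma> i $ a)))"
    by (rule sum.cong[OF refl], subst main) simp_all
  finally show ?thesis .
qed

lemma block_ip_elem_tensor_neq: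
  assumes "length gs \<noteq> k \<or> length hs \<noteq> k"
  shows "block_ip (q_fock q) k (elem_tensor gs) (elem_tensor hs) = 0"
  using assms by (auto simp: block_ip_def q_fock_def elem_tensor_def intro!: sum.neutral)

lemma elem_tensor_in_q_fock: "elem_tensor gs \<in> hcarrier (q_fock q)"
proof -
  have "(\<lambda>k. Re (block_ip (q_fock q) k (elem_tensor gs) (elem_tensor gs))) summable_on {length gs}"
    by simp
  then show ?thesis
    unfolding hcarrier_def mem_Collect_eq
    by (rule summable_on_cong_neutral[THEN iffD1, rotated 3])
      (auto simp: block_ip_elem_tensor_neq)
qed

lemma hip_q_fock_elem_tensor:
  fixes gs hs :: "(complex^'n) list"
  shows "hip (q_fock q) (elem_tensor gs) (elem_tensor hs) =
    (if length gs = length hs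
     then \<Sum>\<sigma> | \<sigma> permutes {..<length gs}. complex_of_real (q ^ inversions (length gs) \<sigma>) *
       (\<Prod>i<length gs. \<Sum>a\<in>UNIV. gs ! i $ a * cnj (hs ! \<sigma> i $ a))
     else 0)"
proof -
  have "hip (q_fock q) (elem_tensor gs) (elem_tensor hs) =
      (\<Sum>\<^sub>\<infinity>k\<in>{length gs}. block_ip (q_fock q) k (elem_tensor gs) (elem_tensor hs))"
    unfolding hip_def by (rule infsum_cong_neutral) (auto simp: block_ip_elem_tensor_neq)
  then show ?thesis
    by (simp add: block_ip_elem_tensor block_ip_elem_tensor_neq)
qed

lemma vacuum_eq_elem_tensor: "vacuum = elem_tensor []"
  by (auto simp: vacuum_def elem_tensor_def)

lemma creation_elem_tensor: "creation q h (elem_tensor gs) = elem_tensor (h # gs)"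
  by (rule ext) (auto simp: creation_def restrict_op_def elem_tensor_in_q_fock[of gs, unfolded elem_tensor_def] elem_tensor_def
      prod.lessThan_Suc_shift simp del: prod.lessThan_Suc split: list.split)

end

theory Submission
  imports Defs
begin

text \<open>
  Suppose first that the vectors \<open>e\<close> are orthonormal. The right annihilation operator \<open>r\<^sub>i\<close> commutes
  with the q-semicircular operators \<open>X\<^sub>j = l\<^sub>j + l\<^sub>j\<^sup>*\<close> up to \<open>q\<^sup>N\<close>, where \<open>N\<close> is the degree: \<open>r\<^sub>i X\<^sub>j - X\<^sub>j r\<^sub>i\<close>
  is \<open>q\<^sup>N\<close> if \<open>i = j\<close> and vanishes otherwise. Moving \<open>r\<^sub>i\<close> through a word in the \<open>X\<^sub>j\<close> up to the vacuum,
  which it annihilates, expresses \<open>\<tau>(X\<^sub>i P(X))\<close> as the sum of the numbers \<open>\<langle>a q\<^sup>N b \<Omega>, \<Omega>\<rangle>\<close> over the terms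
  \<open>a \<otimes> b\<close> of the free difference quotient of \<open>P\<close> at \<open>i\<close>. That is the pairing of the free difference
  quotient with the vector of \<open>F \<otimes> conj F\<close> that corresponds to the operator \<open>q\<^sup>N\<close>, namely
  \<open>\<zeta> = \<Sum>\<alpha>. q ^ deg \<alpha> * (f\<^sub>\<alpha> \<otimes> conj f\<^sub>\<alpha>)\<close> for an orthonormal basis \<open>f\<close> of homogeneous vectors. So the
  diagonal matrix with entries \<open>\<zeta>\<close> is a free Stein kernel. For general \<open>e\<close> the vectors
  \<open>\<Sum>b. C\<^sup>-\<^sup>1\<^sub>i\<^sub>b e\<^sub>b\<close> form the dual basis, and the same matrix is a kernel for \<open>V\<^sub>C\<close>. Degree \<open>k\<close> has dimension
  \<open>n ^ k\<close> and the part of degree \<open>0\<close> of \<open>\<zeta>\<close> is \<open>\<Omega> \<otimes> conj \<Omega>\<close>, whence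
  \<open>\<parallel>\<zeta> - \<Omega> \<otimes> conj \<Omega>\<parallel>\<^sup>2 = \<Sum>k\<ge>1. (q\<^sup>2 n) ^ k = q\<^sup>2 n / (1 - q\<^sup>2 n)\<close>. The \<open>n\<close> diagonal entries
  together give the square of the asserted bound.

  The argument below mirrors this one, letting the left annihilation operator pass through words in the
  right operators \<open>r\<^sub>j + r\<^sub>j\<^sup>*\<close>. These commute with the left ones and have the same values on the vacuum, so
  a word in the left operators and the reversed word in the right operators agree there
  (\<open>word_vec_eq_rword\<close>). This makes the order of the factors fit the pairing on \<open>F \<otimes> conj F\<close>
  (\<open>hip_word_vec_degree_one\<close>, \<open>hip_tensor_q_kernel\<close>), and it stands in for the trace property.

  The analytic facts behind this are the strict positivity of the q-inner product
  (\<open>q_fock_graded_hilbert\<close>), which is deduced from that of the kernel \<open>q ^ card (sym_diff A B)\<close> on finite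
  sets; the boundedness of the creation operators (\<open>block_create_le\<close>), which follows from the q-commutation
  relation by induction on the degree; and the existence of tensor products of bounded operators
  (\<open>tensor_op_bounded\<close>), obtained by splitting \<open>H \<otimes> K\<close> into copies of \<open>H\<close> along an orthonormal basis of
  \<open>K\<close>. That \<open>\<zeta>\<close> lies in the \<open>L\<^sup>2\<close>-space of the von Neumann algebra holds because the polynomials applied to the
  vacuum reach every vector of finite degree (\<open>in_word_span\<close>, \<open>L2_bip_eq_hcarrier\<close>).
\<close>


section \<open>Graded Hilbert spaces\<close>

text \<open>
  The complex form of the discriminant condition; it yields the Cauchy--Schwarz inequality both for a
  single block and for the whole space.
\<close>

lemma cmod_sq_le_of_quadratic_nonneg:
  fixes z :: complex
  assumes nn: "\<And>c. 0 \<le> a + 2 * Re (c * z) + (cmod c)\<^sup>2 * b" and b: "0 \<le> b"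
  shows "(cmod z)\<^sup>2 \<le> a * b"
proof -
  have real_case: "0 \<le> a - 2 * t * (cmod z)\<^sup>2 + t\<^sup>2 * (cmod z)\<^sup>2 * b" for t
  proof -
    have "Re (- of_real t * cnj z * z) = - t * (cmod z)\<^sup>2"
      unfolding cmod_power2 by (simp add: power2_eq_square algebra_simps)
    then show ?thesis
      using nn[of "- of_real t * cnj z"] by (simp add: norm_mult power_mult_distrib)
  qed
  show ?thesis
  proof (cases "b = 0")
    case True
    have "z = 0"
    proof (rule ccontr)
      assume "z \<noteq> 0"
      then show False
        using real_case[of "(a + 1) / (2 * (cmod z)\<^sup>2)"] True by simp
    qed
    then show ?thesis by (simp add: True)
  next
    case False
    then have "0 < b" using b by simp
    then show ?thesis
      using real_case[of "1 / b"] by (simp add: field_simps power2_eq_square)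
  qed
qed

lemma block_ip_add_left:
  "block_ip H k (\<lambda>w. c * x w + y w) \<theta> = c * block_ip H k x \<theta> + block_ip H k y \<theta>"
  by (simp add: block_ip_def algebra_simps sum.distrib sum_distrib_left)

lemma block_ip_add_right:
  "block_ip H k \<theta> (\<lambda>w. c * x w + y w) = cnj c * block_ip H k \<theta> x + block_ip H k \<theta> y"
  by (simp add: block_ip_def algebra_simps sum.distrib sum_distrib_left)

lemma block_ip_cong:
  assumes "\<And>w. deg H w = k \<Longrightarrow> x w = x' w" "\<And>w. deg H w = k \<Longrightarrow> y w = y' w"
  shows "block_ip H k x y = block_ip H k x' y'"
  using assms by (auto simp: block_ip_def intro!: sum.cong)

lemma block_ip_zero_left [simp]: "block_ip H k (\<lambda>_. 0) y = 0"
  and block_ip_zero_right [simp]: "block_ip H k y (\<lambda>_. 0) = 0"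
  by (simp_all add: block_ip_def)

lemma block_ip_scale_left: "block_ip H k (\<lambda>w. c * x w) \<theta> = c * block_ip H k x \<theta>"
  using block_ip_add_left[of H k c x "\<lambda>_. 0"] by simp

lemma block_ip_scale_right: "block_ip H k \<theta> (\<lambda>w. c * x w) = cnj c * block_ip H k \<theta> x"
  using block_ip_add_right[of H k \<theta> c x "\<lambda>_. 0"] by simp

lemma block_ip_sum_left:
  "block_ip H k (\<lambda>w. \<Sum>a\<in>A. c a * f a w) \<theta> = (\<Sum>a\<in>A. c a * block_ip H k (f a) \<theta>)"
  by (induction A rule: infinite_finite_induct) (simp_all add: block_ip_add_left)

lemma block_ip_sum_right:
  "block_ip H k \<theta> (\<lambda>w. \<Sum>a\<in>A. c a * f a w) = (\<Sum>a\<in>A. cnj (c a) * block_ip H k \<theta> (f a))"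
  by (induction A rule: infinite_finite_induct) (simp_all add: block_ip_add_right)

lemma hip_zero_left [simp]: "hip H (\<lambda>_. 0) y = 0"
  and hip_zero_right [simp]: "hip H y (\<lambda>_. 0) = 0"
  by (simp_all add: hip_def)

lemma zero_in_hcarrier [simp]: "(\<lambda>_. 0) \<in> hcarrier H"
  by (simp add: hcarrier_def)

definition point :: "'w \<Rightarrow> 'w \<Rightarrow> complex" where
  "point u = (\<lambda>w. if w = u then 1 else 0)"

lemma point_expansion:
  assumes "finite A" "\<And>w. w \<notin> A \<Longrightarrow> x w = 0"
  shows "x = (\<lambda>w. \<Sum>u\<in>A. x u * point u w)"
proof
  fix w
  have "(\<Sum>u\<in>A. x u * point u w) = (\<Sum>u\<in>A. if w = u then x u else 0)"
    by (intro sum.cong) (auto simp: point_def)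
  then show "x w = (\<Sum>u\<in>A. x u * point u w)"
    using assms by auto
qed

text \<open>
  Positivity of the blocks is what makes a graded basis describe a Hilbert space.
\<close>

locale graded_hilbert =
  fixes H :: "('w, 'd) gbasis"
  assumes finite_fibre: "finite {w. deg H w = k}"
    and gram_hermitian: "gram H v u = cnj (gram H u v)"
    and block_pos: "deg H w = k \<Longrightarrow> x w \<noteq> 0 \<Longrightarrow> 0 < Re (block_ip H k x x)"
begin

lemma block_hermitian: "block_ip H k y x = cnj (block_ip H k x y)"
proof -
  have "cnj (block_ip H k x y) =
      (\<Sum>u | deg H u = k. \<Sum>v | deg H v = k. y v * cnj (x u) * gram H v u)"
    by (simp add: block_ip_def gram_hermitian[symmetric] mult.commute)
  also have "\<dots> = block_ip H k y x"
    unfolding block_ip_def by (rule sum.swap)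
  finally show ?thesis by simp
qed

abbreviation sq_norm :: "'d \<Rightarrow> ('w \<Rightarrow> complex) \<Rightarrow> real" where
  "sq_norm k x \<equiv> Re (block_ip H k x x)"

lemma block_nonneg: "0 \<le> sq_norm k x"
proof (cases "\<exists>w. deg H w = k \<and> x w \<noteq> 0")
  case True
  then show ?thesis using block_pos by (metis less_imp_le)
next
  case False
  then have "block_ip H k x x = block_ip H k (\<lambda>_. 0) (\<lambda>_. 0)"
    by (intro block_ip_cong) auto
  then show ?thesis by simp
qed

lemma block_self_real: "block_ip H k x x = of_real (sq_norm k x)"
proof -
  have "Im (block_ip H k x x) = - Im (block_ip H k x x)"
    using arg_cong[OF block_hermitian[of k x x], of Im] by simp
  then show ?thesis by (simp add: complex_eq_iff)
qed

lemma block_expand: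
  "sq_norm k (\<lambda>w. c * y w + x w) =
   sq_norm k x + 2 * Re (c * block_ip H k y x) + (cmod c)\<^sup>2 * sq_norm k y"
proof -
  have "Re (cnj c * block_ip H k x y) = Re (c * block_ip H k y x)"
    unfolding block_hermitian[of k x y] complex_cnj_mult[symmetric] by simp
  moreover have "Re (c * cnj c * block_ip H k y y) = (cmod c)\<^sup>2 * sq_norm k y"
    by (simp add: complex_norm_square[symmetric] del: of_real_power)
  ultimately show ?thesis
    by (simp only: block_ip_add_left block_ip_add_right distrib_left mult.assoc[symmetric]
        plus_complex.sel)
qed

lemma block_cauchy_schwarz:
  "(cmod (block_ip H k x y))\<^sup>2 \<le> sq_norm k x * sq_norm k y"
proof -
  have "0 \<le> sq_norm k y + 2 * Re (c * block_ip H k x y)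
      + (cmod c)\<^sup>2 * sq_norm k x" for c
    unfolding block_expand[symmetric] by (rule block_nonneg)
  from cmod_sq_le_of_quadratic_nonneg[OF this block_nonneg] show ?thesis
    by (simp add: mult.commute)
qed

lemma block_abs_le:
  "cmod (block_ip H k x y) \<le> sq_norm k x + sq_norm k y"
proof (rule power2_le_imp_le)
  let ?a = "sq_norm k x" and ?b = "sq_norm k y"
  have "0 \<le> ?a * ?b" "0 \<le> ?a\<^sup>2" "0 \<le> ?b\<^sup>2" using block_nonneg by simp_all
  then have "?a * ?b \<le> (?a + ?b)\<^sup>2" unfolding power2_sum by linarith
  with block_cauchy_schwarz show "(cmod (block_ip H k x y))\<^sup>2 \<le> (?a + ?b)\<^sup>2"
    by (rule order_trans)
qed (use block_nonneg[of k x] block_nonneg[of k y] in simp)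

lemma block_summable:
  assumes "x \<in> hcarrier H" "y \<in> hcarrier H"
  shows "(\<lambda>k. block_ip H k x y) summable_on UNIV"
proof (rule abs_summable_summable, rule summable_on_comparison_test)
  show "(\<lambda>k. sq_norm k x + sq_norm k y) summable_on UNIV"
    using assms by (auto simp: hcarrier_def intro: summable_on_add)
qed (use block_abs_le in auto)

lemma hcarrier_lincomb:
  assumes "x \<in> hcarrier H" "y \<in> hcarrier H"
  shows "(\<lambda>w. c * x w + y w) \<in> hcarrier H"
proof -
  have "sq_norm k (\<lambda>w. c * x w + y w) \<le>
      2 * (cmod c)\<^sup>2 * sq_norm k x + 2 * sq_norm k y" for k
    using block_nonneg[of k "\<lambda>w. (- c) * x w + y w"] unfolding block_expand
    by (simp add: mult.commute)
  then show ?thesis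
    unfolding hcarrier_def mem_Collect_eq
    using assms
    by (rule_tac summable_on_comparison_test[of
          "\<lambda>k. 2 * (cmod c)\<^sup>2 * sq_norm k x + 2 * sq_norm k y"])
      (auto simp: hcarrier_def block_nonneg intro!: summable_on_add summable_on_cmult_right)
qed

lemma hcarrier_scale: "x \<in> hcarrier H \<Longrightarrow> (\<lambda>w. c * x w) \<in> hcarrier H"
  using hcarrier_lincomb[of x "\<lambda>_. 0"] by simp

lemma hcarrier_diff:
  assumes "x \<in> hcarrier H" "y \<in> hcarrier H"
  shows "(\<lambda>w. x w - y w) \<in> hcarrier H"
  using hcarrier_lincomb[OF assms(2,1), of "-1"] by simp

lemma hcarrier_sum:
  "(\<And>a. a \<in> A \<Longrightarrow> f a \<in> hcarrier H) \<Longrightarrow> (\<lambda>w. \<Sum>a\<in>A. c a * f a w) \<in> hcarrier H"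
  by (induction A rule: infinite_finite_induct) (simp_all add: hcarrier_lincomb)

lemma hip_lincomb_left:
  assumes "x \<in> hcarrier H" "y \<in> hcarrier H" "\<theta> \<in> hcarrier H"
  shows "hip H (\<lambda>w. c * x w + y w) \<theta> = c * hip H x \<theta> + hip H y \<theta>"
  unfolding hip_def block_ip_add_left
  using assms by (simp add: infsum_add infsum_cmult_right block_summable summable_on_cmult_right)

lemma hip_hermitian: "hip H y x = cnj (hip H x y)"
  unfolding hip_def by (subst block_hermitian) (simp add: infsum_cnj)

lemma hip_lincomb_right:
  assumes "x \<in> hcarrier H" "y \<in> hcarrier H" "\<theta> \<in> hcarrier H"
  shows "hip H \<theta> (\<lambda>w. c * x w + y w) = cnj c * hip H \<theta> x + hip H \<theta> y"
  by (subst (1 2 3) hip_hermitian) (simp add: hip_lincomb_left assms)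

lemma hip_sum_left:
  assumes "\<And>a. a \<in> A \<Longrightarrow> f a \<in> hcarrier H" "\<theta> \<in> hcarrier H"
  shows "hip H (\<lambda>w. \<Sum>a\<in>A. c a * f a w) \<theta> = (\<Sum>a\<in>A. c a * hip H (f a) \<theta>)"
  using assms
  by (induction A rule: infinite_finite_induct) (simp_all add: hip_lincomb_left hcarrier_sum)

lemma hip_self:
  assumes "x \<in> hcarrier H"
  shows "hip H x x = of_real (\<Sum>\<^sub>\<infinity>k. sq_norm k x)"
proof -
  have "((\<lambda>k. complex_of_real (sq_norm k x)) has_sum
      of_real (\<Sum>\<^sub>\<infinity>k. sq_norm k x)) UNIV"
    using assms unfolding hcarrier_def by (intro has_sum_of_real has_sum_infsum) simp
  then show ?thesis
    unfolding hip_def block_self_real[symmetric] by (rule infsumI)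
qed

lemma hip_self_nonneg: "0 \<le> Re (hip H x x)"
proof (cases "x \<in> hcarrier H")
  case True
  then show ?thesis by (simp add: hip_self infsum_nonneg block_nonneg)
next
  case False
  then have "\<not> (\<lambda>k. block_ip H k x x) summable_on UNIV"
    using summable_on_Re unfolding hcarrier_def by blast
  then show ?thesis by (simp add: hip_def infsum_not_exists)
qed

lemma block_le_hip:
  assumes "x \<in> hcarrier H"
  shows "sq_norm k x \<le> Re (hip H x x)"
proof -
  have "(\<Sum>k\<in>{k}. sq_norm k x) \<le> (\<Sum>\<^sub>\<infinity>k. sq_norm k x)"
    using assms by (intro finite_sum_le_infsum) (auto simp: hcarrier_def block_nonneg)
  then show ?thesis using assms by (simp add: hip_self)
qed

lemma hip_self_eq_0:
  assumes "x \<in> hcarrier H" "Re (hip H x x) \<le> 0"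
  shows "x = (\<lambda>_. 0)"
proof
  fix w
  show "x w = 0"
    using block_le_hip[OF assms(1), of "deg H w"] block_pos[of w "deg H w" x] assms(2) by fastforce
qed

lemma hip_expand:
  assumes "x \<in> hcarrier H" "y \<in> hcarrier H"
  shows "Re (hip H (\<lambda>w. c * y w + x w) (\<lambda>w. c * y w + x w)) =
   Re (hip H x x) + 2 * Re (c * hip H y x) + (cmod c)\<^sup>2 * Re (hip H y y)"
proof -
  have "Re (cnj c * hip H x y) = Re (c * hip H y x)"
    unfolding hip_hermitian[of x y] complex_cnj_mult[symmetric] by simp
  moreover have "Re (c * cnj c * hip H y y) = (cmod c)\<^sup>2 * Re (hip H y y)"
    by (simp add: complex_norm_square[symmetric] del: of_real_power)
  ultimately show ?thesis
    by (simp only: hip_lincomb_left hip_lincomb_right hcarrier_lincomb assms distrib_left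
        mult.assoc[symmetric] plus_complex.sel)
qed

lemma hnorm_nonneg [simp]: "0 \<le> hnorm H x"
  by (simp add: hnorm_def hip_self_nonneg)

lemma hnorm_square: "(hnorm H x)\<^sup>2 = Re (hip H x x)"
  by (simp add: hnorm_def hip_self_nonneg)

lemma hnorm_eq_0: "x \<in> hcarrier H \<Longrightarrow> hnorm H x \<le> 0 \<Longrightarrow> x = (\<lambda>_. 0)"
  using hnorm_square[of x] hnorm_nonneg[of x] hip_self_eq_0[of x] by simp

lemma hip_cauchy_schwarz:
  assumes "x \<in> hcarrier H" "y \<in> hcarrier H"
  shows "cmod (hip H x y) \<le> hnorm H x * hnorm H y"
proof (rule power2_le_imp_le)
  have "0 \<le> Re (hip H y y) + 2 * Re (c * hip H x y) + (cmod c)\<^sup>2 * Re (hip H x x)" for c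
    unfolding hip_expand[OF assms(2,1), symmetric] by (rule hip_self_nonneg)
  from cmod_sq_le_of_quadratic_nonneg[OF this hip_self_nonneg]
  show "(cmod (hip H x y))\<^sup>2 \<le> (hnorm H x * hnorm H y)\<^sup>2"
    by (simp add: power_mult_distrib hnorm_square mult.commute)
qed simp

lemma hnorm_scale:
  assumes "x \<in> hcarrier H"
  shows "hnorm H (\<lambda>w. c * x w) = cmod c * hnorm H x"
proof -
  have "(hnorm H (\<lambda>w. c * x w))\<^sup>2 = (cmod c * hnorm H x)\<^sup>2"
    using hip_expand[of "\<lambda>_. 0" x c] assms by (simp add: hnorm_square power_mult_distrib)
  then show ?thesis by (simp add: power2_eq_iff_nonneg)
qed

lemma hnorm_triangle:
  assumes "x \<in> hcarrier H" "y \<in> hcarrier H"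
  shows "hnorm H (\<lambda>w. x w + y w) \<le> hnorm H x + hnorm H y"
proof (rule power2_le_imp_le)
  have "(hnorm H (\<lambda>w. x w + y w))\<^sup>2 = (hnorm H y)\<^sup>2 + 2 * Re (hip H x y) + (hnorm H x)\<^sup>2"
    using hip_expand[OF assms(2,1), of 1] by (simp add: hnorm_square)
  moreover have "Re (hip H x y) \<le> hnorm H x * hnorm H y"
    using hip_cauchy_schwarz[OF assms] complex_Re_le_cmod order_trans by blast
  ultimately show "(hnorm H (\<lambda>w. x w + y w))\<^sup>2 \<le> (hnorm H x + hnorm H y)\<^sup>2"
    unfolding power2_sum by linarith
qed simp

lemma finite_support_hcarrier:
  assumes "finite (deg H ` {w. x w \<noteq> 0})"
  shows "x \<in> hcarrier H"
proof -
  have 0: "block_ip H k x x = 0" if "k \<notin> deg H ` {w. x w \<noteq> 0}" for k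
    using block_ip_cong[of H k x "\<lambda>_. 0" x "\<lambda>_. 0"] that by force
  have "(\<lambda>k. sq_norm k x) summable_on deg H ` {w. x w \<noteq> 0}"
    using assms by simp
  then show ?thesis
    unfolding hcarrier_def mem_Collect_eq
    by (rule summable_on_cong_neutral[THEN iffD1, rotated 3]) (auto simp: 0)
qed

lemma point_hcarrier [simp]: "point u \<in> hcarrier H"
  by (rule finite_support_hcarrier, rule finite_subset[of _ "{deg H u}"])
    (auto simp: point_def split: if_splits)

text \<open>
  Coefficient functions supported on finitely many degrees are dense: the squared distance of
  a vector to its truncation is the tail of the convergent series of its squared norm.
\<close>

lemma truncation_approx:
  assumes x: "x \<in> hcarrier H" and \<epsilon>: "0 < \<epsilon>"
  obtains F where "finite F" "hnorm H (\<lambda>w. x w - (if deg H w \<in> F then x w else 0)) < \<epsilon>"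
    "(\<lambda>w. if deg H w \<in> F then x w else 0) \<in> hcarrier H"
proof -
  let ?g = "\<lambda>k. sq_norm k x"
  have sm: "?g summable_on UNIV" using x by (simp add: hcarrier_def)
  from infsum_finite_approximation[OF sm, of "\<epsilon>\<^sup>2 / 2"] \<epsilon>
  obtain F where F: "finite F" "dist (sum ?g F) (infsum ?g UNIV) \<le> \<epsilon>\<^sup>2 / 2" by auto
  let ?xF = "\<lambda>w. if deg H w \<in> F then x w else 0" and ?d = "\<lambda>w. x w - (if deg H w \<in> F then x w else 0)"
  have cF: "?xF \<in> hcarrier H"
    by (rule finite_support_hcarrier, rule finite_subset[OF _ F(1)]) auto
  have cd: "?d \<in> hcarrier H" by (rule hcarrier_diff[OF x cF])
  have bd: "sq_norm k ?d = (if k \<in> F then 0 else ?g k)" for k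
  proof (cases "k \<in> F")
    case True
    then have "block_ip H k ?d ?d = block_ip H k (\<lambda>_. 0) (\<lambda>_. 0)" by (intro block_ip_cong) auto
    with True show ?thesis by simp
  next
    case False
    then have "block_ip H k ?d ?d = block_ip H k x x" by (intro block_ip_cong) auto
    with False show ?thesis by simp
  qed
  have "(hnorm H ?d)\<^sup>2 = (\<Sum>\<^sub>\<infinity>k. if k \<in> F then 0 else ?g k)"
    using cd by (simp add: hnorm_square hip_self bd)
  also have "\<dots> = infsum ?g (UNIV - F)"
    by (intro infsum_cong_neutral) auto
  also have "\<dots> = infsum ?g UNIV - sum ?g F"
    using F(1) sm by (subst infsum_Diff) auto
  also have "\<dots> \<le> \<epsilon>\<^sup>2 / 2" using F(2) unfolding dist_real_def by linarith
  also have "\<dots> < \<epsilon>\<^sup>2" using \<epsilon> by simp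
  finally have "hnorm H ?d < \<epsilon>" using \<epsilon> by (rule power2_less_imp_less[OF _ less_imp_le])
  then show thesis using that F(1) cF by blast
qed

lemma subspace_dense:
  assumes zero: "(\<lambda>_. 0) \<in> W"
    and lin: "\<And>c x y. x \<in> W \<Longrightarrow> y \<in> W \<Longrightarrow> (\<lambda>w. c * x w + y w) \<in> W"
    and points: "\<And>u. point u \<in> W"
    and x: "x \<in> hcarrier H" and \<epsilon>: "0 < \<epsilon>"
  shows "\<exists>y\<in>W. y \<in> hcarrier H \<and> hnorm H (\<lambda>w. x w - y w) < \<epsilon>"
proof -
  have sums: "(\<lambda>w. \<Sum>a\<in>A. c a * point a w) \<in> W" for A c
    by (induction A rule: infinite_finite_induct) (simp_all add: zero lin points)
  from truncation_approx[OF x \<epsilon>] obtain F where F: "finite F"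
    "hnorm H (\<lambda>w. x w - (if deg H w \<in> F then x w else 0)) < \<epsilon>"
    "(\<lambda>w. if deg H w \<in> F then x w else 0) \<in> hcarrier H" (is "?xF \<in> _") .
  have "finite {w. deg H w \<in> F}"
  proof -
    have "{w. deg H w \<in> F} = (\<Union>k\<in>F. {w. deg H w = k})" by auto
    then show ?thesis using F(1) finite_fibre by auto
  qed
  then have "?xF = (\<lambda>w. \<Sum>u\<in>{w. deg H w \<in> F}. ?xF u * point u w)"
    by (rule point_expansion) auto
  then have "?xF \<in> W" by (rule ssubst[of _ _ "\<lambda>x. x \<in> W"]) (rule sums)
  with F show ?thesis by blast
qed


subsection \<open>Bounded operators\<close>

lemma bounded_opsD:
  assumes "T \<in> bounded_ops H"
  shows "x \<in> hcarrier H \<Longrightarrow> T x \<in> hcarrier H"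
    and "x \<notin> hcarrier H \<Longrightarrow> T x = (\<lambda>_. 0)"
    and "x \<in> hcarrier H \<Longrightarrow> y \<in> hcarrier H \<Longrightarrow>
      T (\<lambda>w. c * x w + y w) = (\<lambda>w. c * T x w + T y w)"
    and "T (\<lambda>_. 0) = (\<lambda>_. 0)"
proof -
  have *: "restrict_op H T = T" "T ` hcarrier H \<subseteq> hcarrier H"
    "\<And>x y c. x \<in> hcarrier H \<Longrightarrow> y \<in> hcarrier H \<Longrightarrow>
      T (\<lambda>w. c * x w + y w) = (\<lambda>w. c * T x w + T y w)"
    using assms by (auto simp: bounded_ops_def)
  show "x \<in> hcarrier H \<Longrightarrow> T x \<in> hcarrier H" using *(2) by blast
  show "x \<notin> hcarrier H \<Longrightarrow> T x = (\<lambda>_. 0)"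
    using fun_cong[OF *(1), of x] by (simp add: restrict_op_def)
  show "x \<in> hcarrier H \<Longrightarrow> y \<in> hcarrier H \<Longrightarrow>
      T (\<lambda>w. c * x w + y w) = (\<lambda>w. c * T x w + T y w)" by (rule *(3))
  show "T (\<lambda>_. 0) = (\<lambda>_. 0)"
    using *(3)[of "\<lambda>_. 0" "\<lambda>_. 0" "-1"] by simp
qed

lemma bounded_ops_sum:
  assumes "T \<in> bounded_ops H" "\<And>a. a \<in> A \<Longrightarrow> f a \<in> hcarrier H"
  shows "T (\<lambda>w. \<Sum>a\<in>A. c a * f a w) = (\<lambda>w. \<Sum>a\<in>A. c a * T (f a) w)"
  using assms(2)
  by (induction A rule: infinite_finite_induct)
    (simp_all add: bounded_opsD[OF assms(1)] hcarrier_sum)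

lemma bounded_ops_bound:
  assumes "T \<in> bounded_ops H"
  obtains B where "0 \<le> B" "\<And>x. x \<in> hcarrier H \<Longrightarrow> hnorm H (T x) \<le> B * hnorm H x"
proof -
  obtain B where B: "\<forall>x\<in>hcarrier H. hnorm H (T x) \<le> B * hnorm H x"
    using assms by (auto simp: bounded_ops_def)
  have "hnorm H (T x) \<le> \<bar>B\<bar> * hnorm H x" if "x \<in> hcarrier H" for x
    using B that by (metis abs_ge_self hnorm_nonneg mult_right_mono order_trans)
  then show thesis using that[of "\<bar>B\<bar>"] by simp
qed

lemma bounded_opsI:
  assumes "\<And>x. x \<notin> hcarrier H \<Longrightarrow> T x = (\<lambda>_. 0)"
    and "\<And>x. x \<in> hcarrier H \<Longrightarrow> T x \<in> hcarrier H"
    and "\<And>x y c. x \<in> hcarrier H \<Longrightarrow> y \<in> hcarrier H \<Longrightarrow>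
      T (\<lambda>w. c * x w + y w) = (\<lambda>w. c * T x w + T y w)"
    and "\<And>x. x \<in> hcarrier H \<Longrightarrow> hnorm H (T x) \<le> B * hnorm H x"
  shows "T \<in> bounded_ops H"
  using assms unfolding bounded_ops_def restrict_op_def by fastforce

lemma bounded_ops_zero: "(\<lambda>_ _. 0) \<in> bounded_ops H"
  by (rule bounded_opsI[where B = 0]) (auto simp: hnorm_def)

lemma bounded_ops_one: "one_op H \<in> bounded_ops H"
  by (rule bounded_opsI[where B = 1]) (auto simp: one_op_def restrict_op_def hcarrier_lincomb)

lemma bounded_ops_comp:
  assumes S: "S \<in> bounded_ops H" and T: "T \<in> bounded_ops H"
  shows "S \<circ> T \<in> bounded_ops H"
proof -
  obtain A where A: "0 \<le> A" "\<And>x. x \<in> hcarrier H \<Longrightarrow> hnorm H (S x) \<le> A * hnorm H x"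
    using bounded_ops_bound[OF S] by blast
  obtain B where B: "0 \<le> B" "\<And>x. x \<in> hcarrier H \<Longrightarrow> hnorm H (T x) \<le> B * hnorm H x"
    using bounded_ops_bound[OF T] by blast
  show ?thesis
  proof (rule bounded_opsI[where B = "A * B"])
    fix x assume x: "x \<in> hcarrier H"
    have "hnorm H (S (T x)) \<le> A * hnorm H (T x)"
      using A(2) bounded_opsD(1)[OF T x] .
    also have "\<dots> \<le> A * (B * hnorm H x)" using A(1) B(2)[OF x] by (rule mult_left_mono[rotated])
    finally show "hnorm H ((S \<circ> T) x) \<le> A * B * hnorm H x" by (simp add: mult.assoc)
  qed (simp_all add: bounded_opsD[OF S] bounded_opsD[OF T])
qed

lemma bounded_ops_lincomb:
  assumes S: "S \<in> bounded_ops H" and T: "T \<in> bounded_ops H"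
  shows "(\<lambda>x w. c * S x w + T x w) \<in> bounded_ops H"
proof -
  obtain A where A: "0 \<le> A" "\<And>x. x \<in> hcarrier H \<Longrightarrow> hnorm H (S x) \<le> A * hnorm H x"
    using bounded_ops_bound[OF S] by blast
  obtain B where B: "0 \<le> B" "\<And>x. x \<in> hcarrier H \<Longrightarrow> hnorm H (T x) \<le> B * hnorm H x"
    using bounded_ops_bound[OF T] by blast
  show ?thesis
  proof (rule bounded_opsI[where B = "cmod c * A + B"])
    fix x assume x: "x \<in> hcarrier H"
    have "hnorm H (\<lambda>w. c * S x w + T x w) \<le> hnorm H (\<lambda>w. c * S x w) + hnorm H (T x)"
      using x by (intro hnorm_triangle hcarrier_scale bounded_opsD(1)[OF S] bounded_opsD(1)[OF T])
    also have "\<dots> = cmod c * hnorm H (S x) + hnorm H (T x)"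
      using x by (simp add: hnorm_scale bounded_opsD(1)[OF S])
    also have "\<dots> \<le> cmod c * (A * hnorm H x) + B * hnorm H x"
      using A B x by (intro add_mono mult_left_mono) auto
    finally show "hnorm H (\<lambda>w. c * S x w + T x w) \<le> (cmod c * A + B) * hnorm H x"
      by (simp add: algebra_simps)
  qed (simp_all add: bounded_opsD[OF S] bounded_opsD[OF T] hcarrier_lincomb distrib_left
      mult.left_commute add.assoc add.left_commute)
qed

text \<open>
  Uniqueness holds because the inner product is definite on the carrier and bounded operators vanish
  outside of it.
\<close>

lemma adj_opI:
  assumes S: "S \<in> bounded_ops H"
    and adj: "\<And>x y. x \<in> hcarrier H \<Longrightarrow> y \<in> hcarrier H \<Longrightarrow> hip H (T x) y = hip H x (S y)"
  shows "adj_op H T = S"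
  unfolding adj_op_def
proof (rule the_equality)
  fix S' assume S': "S' \<in> bounded_ops H \<and>
    (\<forall>x\<in>hcarrier H. \<forall>y\<in>hcarrier H. hip H (T x) y = hip H x (S' y))"
  show "S' = S"
  proof
    fix y
    show "S' y = S y"
    proof (cases "y \<in> hcarrier H")
      case True
      let ?d = "\<lambda>w. (-1) * S y w + S' y w"
      have c: "S y \<in> hcarrier H" "S' y \<in> hcarrier H"
        using bounded_opsD(1)[OF S True] bounded_opsD(1)[of S' y] S' True by blast+
      then have d: "?d \<in> hcarrier H" by (intro hcarrier_lincomb)
      have "hip H ?d ?d = - hip H ?d (S y) + hip H ?d (S' y)"
        using hip_lincomb_right[OF c d, of "-1"] by simp
      also have "\<dots> = 0" using adj[OF d True] S' d True by simp
      finally have "?d = (\<lambda>_. 0)" using hip_self_eq_0[OF d] by simp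
      then show ?thesis by (simp add: fun_eq_iff)
    next
      case False
      then show ?thesis using bounded_opsD(2) S S' by metis
    qed
  qed
qed (use assms in auto)

text \<open>
  The kernel of the difference is a closed subspace, and the basis vectors span a dense one.
\<close>

lemma bounded_ops_eqI:
  assumes S: "S \<in> bounded_ops H" and T: "T \<in> bounded_ops H"
    and eq: "\<And>u. S (point u) = T (point u)"
  shows "S = T"
proof
  fix x
  show "S x = T x"
  proof (cases "x \<in> hcarrier H")
    case True
    define D where "D = (\<lambda>x w. (-1) * S x w + T x w)"
    have D: "D \<in> bounded_ops H" unfolding D_def by (rule bounded_ops_lincomb[OF S T])
    obtain B where B: "0 \<le> B" "\<And>x. x \<in> hcarrier H \<Longrightarrow> hnorm H (D x) \<le> B * hnorm H x"
      using bounded_ops_bound[OF D] by blast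
    let ?W = "{y \<in> hcarrier H. D y = (\<lambda>_. 0)}"
    have "hnorm H (D x) \<le> \<epsilon>" if \<epsilon>: "0 < \<epsilon>" for \<epsilon>
    proof -
      have "0 < \<epsilon> / (B + 1)" using \<epsilon> B(1) by simp
      have "\<exists>y\<in>?W. y \<in> hcarrier H \<and> hnorm H (\<lambda>w. x w - y w) < \<epsilon> / (B + 1)"
      proof (rule subspace_dense)
        show "point u \<in> ?W" for u by (simp add: D_def eq)
        show "(\<lambda>w. c * x w + y w) \<in> ?W" if "x \<in> ?W" "y \<in> ?W" for c x y
          using that by (simp add: hcarrier_lincomb bounded_opsD(3)[OF D])
        show "(\<lambda>_. 0) \<in> ?W" by (simp add: bounded_opsD(4)[OF D])
      qed (use True \<open>0 < \<epsilon> / (B + 1)\<close> in simp_all)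
      then obtain y where y: "y \<in> ?W" "hnorm H (\<lambda>w. x w - y w) < \<epsilon> / (B + 1)"
        by (elim bexE conjE)
      have "D (\<lambda>w. x w - y w) = D x"
        using bounded_opsD(3)[OF D, of y x "-1"] y(1) True by simp
      then have "hnorm H (D x) \<le> B * hnorm H (\<lambda>w. x w - y w)"
        using B(2)[OF hcarrier_diff[OF True, of y]] y(1) by simp
      also have "\<dots> \<le> (B + 1) * (\<epsilon> / (B + 1))"
        using y(2) B(1) by (intro mult_mono) auto
      also have "\<dots> = \<epsilon>" using B(1) by simp
      finally show ?thesis .
    qed
    then have "hnorm H (D x) \<le> 0" by (rule field_le_epsilon[of _ 0, simplified])
    then have "D x = (\<lambda>_. 0)" by (rule hnorm_eq_0[OF bounded_opsD(1)[OF D True]])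
    then show ?thesis by (simp add: D_def fun_eq_iff)
  next
    case False
    then show ?thesis using bounded_opsD(2) S T by metis
  qed
qed


subsection \<open>Commutants\<close>

lemma commutant_bounded: "commutant H S \<subseteq> bounded_ops H"
  by (auto simp: commutant_def)

lemma commutant_zero:
  assumes "S \<subseteq> bounded_ops H"
  shows "(\<lambda>_ _. 0) \<in> commutant H S"
  using assms bounded_opsD(4) by (fastforce simp: commutant_def bounded_ops_zero fun_eq_iff)

lemma commutant_one:
  assumes "S \<subseteq> bounded_ops H"
  shows "one_op H \<in> commutant H S"
proof -
  have "one_op H \<circ> s = s \<circ> one_op H" if "s \<in> bounded_ops H" for s
    using bounded_opsD[OF that] by (auto simp: one_op_def restrict_op_def)
  then show ?thesis using assms by (auto simp: commutant_def bounded_ops_one)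
qed

lemma commutant_comp:
  "T \<in> commutant H S \<Longrightarrow> T' \<in> commutant H S \<Longrightarrow> T \<circ> T' \<in> commutant H S"
proof -
  assume T: "T \<in> commutant H S" and T': "T' \<in> commutant H S"
  have "(T \<circ> T') \<circ> s = s \<circ> (T \<circ> T')" if "s \<in> S" for s
  proof -
    have "T \<circ> s = s \<circ> T" "T' \<circ> s = s \<circ> T'"
      using T T' that by (simp_all add: commutant_def)
    then show ?thesis by (metis comp_assoc)
  qed
  then show ?thesis
    using T T' by (simp add: commutant_def bounded_ops_comp)
qed

lemma commutant_lincomb:
  assumes "S \<subseteq> bounded_ops H" "T \<in> commutant H S" "T' \<in> commutant H S"
  shows "(\<lambda>x w. c * T x w + T' x w) \<in> commutant H S"
proof -
  have "(\<lambda>x w. c * T x w + T' x w) \<circ> s = s \<circ> (\<lambda>x w. c * T x w + T' x w)" if s: "s \<in> S" for s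
  proof
    fix x
    have b: "s \<in> bounded_ops H" "T \<in> bounded_ops H" "T' \<in> bounded_ops H"
      using assms s by (auto simp: commutant_def)
    have c: "T (s x) = s (T x)" "T' (s x) = s (T' x)"
      using assms(2,3) s by (auto simp: commutant_def fun_eq_iff)
    show "((\<lambda>x w. c * T x w + T' x w) \<circ> s) x = (s \<circ> (\<lambda>x w. c * T x w + T' x w)) x"
    proof (cases "x \<in> hcarrier H")
      case True
      then show ?thesis
        using bounded_opsD(3)[OF b(1), of "T x" "T' x"] bounded_opsD(1)[OF b(2)]
          bounded_opsD(1)[OF b(3)] c by simp
    next
      case False
      then show ?thesis
        using c by (simp add: bounded_opsD(2)[OF b(2)] bounded_opsD(2)[OF b(3)] bounded_opsD(4)[OF b(1)])
    qed
  qed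
  then show ?thesis
    using assms by (auto simp: commutant_def intro!: bounded_ops_lincomb)
qed

lemma generator_in_vN:
  assumes "T \<in> S" "T \<in> bounded_ops H"
  shows "T \<in> vN_generated H S"
  using assms by (auto simp: vN_generated_def commutant_def)

end


section \<open>Orthonormal bases and tensor products\<close>

lemma has_sum_sum:
  fixes f :: "'i \<Rightarrow> 'a \<Rightarrow> 'b::topological_comm_monoid_add"
  assumes "\<And>i. i \<in> I \<Longrightarrow> (f i has_sum s i) A"
  shows "((\<lambda>x. \<Sum>i\<in>I. f i x) has_sum (\<Sum>i\<in>I. s i)) A"
  using assms by (induction I rule: infinite_finite_induct) (auto intro: has_sum_add)

definition orthonormal_basis :: "('w, 'd) gbasis \<Rightarrow> ('w \<Rightarrow> 'w \<Rightarrow> complex) \<Rightarrow> bool" where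
  "orthonormal_basis H f \<longleftrightarrow>
     (\<forall>\<alpha> w. deg H w \<noteq> deg H \<alpha> \<longrightarrow> f \<alpha> w = 0) \<and>
     (\<forall>\<alpha> \<beta>. deg H \<alpha> = deg H \<beta> \<longrightarrow>
        block_ip H (deg H \<alpha>) (f \<alpha>) (f \<beta>) = (if \<alpha> = \<beta> then 1 else 0)) \<and>
     (\<forall>x w. x w = (\<Sum>\<alpha> | deg H \<alpha> = deg H w. block_ip H (deg H w) x (f \<alpha>) * f \<alpha> w))"

context graded_hilbert
begin

text \<open>
  Gram--Schmidt within a fibre, adding one basis vector at a time; the orthonormal vectors keep the
  indices of the vectors they come from, so that every fibre has as many of them as its dimension.
\<close>

lemma gram_schmidt:
  assumes "finite A" "A \<subseteq> {w. deg H w = k}"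
  shows "\<exists>f. (\<forall>\<alpha>\<in>A. \<forall>w. w \<notin> A \<longrightarrow> f \<alpha> w = 0) \<and>
    (\<forall>\<alpha>\<in>A. \<forall>\<beta>\<in>A. block_ip H k (f \<alpha>) (f \<beta>) = (if \<alpha> = \<beta> then 1 else 0)) \<and>
    (\<forall>u\<in>A. point u = (\<lambda>w. \<Sum>\<alpha>\<in>A. block_ip H k (point u) (f \<alpha>) * f \<alpha> w))"
  using assms
proof (induction A rule: finite_induct)
  case empty
  then show ?case by auto
next
  case (insert a A)
  then have "A \<subseteq> {w. deg H w = k}" by simp
  from insert.IH[OF this] obtain f where IH: "\<forall>\<alpha>\<in>A. \<forall>w. w \<notin> A \<longrightarrow> f \<alpha> w = 0"
    "\<forall>\<alpha>\<in>A. \<forall>\<beta>\<in>A. block_ip H k (f \<alpha>) (f \<beta>) = (if \<alpha> = \<beta> then 1 else 0)"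
    "\<forall>u\<in>A. point u = (\<lambda>w. \<Sum>\<alpha>\<in>A. block_ip H k (point u) (f \<alpha>) * f \<alpha> w)"
    by (elim exE conjE)
  then have supp: "\<And>\<alpha> w. \<alpha> \<in> A \<Longrightarrow> w \<notin> A \<Longrightarrow> f \<alpha> w = 0"
    and on: "\<And>\<alpha> \<beta>. \<alpha> \<in> A \<Longrightarrow> \<beta> \<in> A \<Longrightarrow> block_ip H k (f \<alpha>) (f \<beta>) = (if \<alpha> = \<beta> then 1 else 0)"
    and ex: "\<And>u. u \<in> A \<Longrightarrow> point u = (\<lambda>w. \<Sum>\<alpha>\<in>A. block_ip H k (point u) (f \<alpha>) * f \<alpha> w)"
    by blast+
  define p where "p = (\<lambda>w. \<Sum>\<alpha>\<in>A. block_ip H k (point a) (f \<alpha>) * f \<alpha> w)"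
  define g where "g = (\<lambda>w. (-1) * p w + point a w)"
  define N where "N = sq_norm k g"
  define h where "h = (\<lambda>w. of_real (1 / sqrt N) * g w)"
  have pa: "p a = 0" unfolding p_def using supp insert.hyps by (intro sum.neutral) auto
  have "0 < N" unfolding N_def
    by (rule block_pos[of a]) (use insert.prems pa in \<open>auto simp: g_def point_def\<close>)
  have pf: "block_ip H k p (f \<beta>) = block_ip H k (point a) (f \<beta>)" if "\<beta> \<in> A" for \<beta>
  proof -
    have "block_ip H k p (f \<beta>) =
        (\<Sum>\<alpha>\<in>A. block_ip H k (point a) (f \<alpha>) * block_ip H k (f \<alpha>) (f \<beta>))"
      unfolding p_def by (rule block_ip_sum_left)
    also have "\<dots> = (\<Sum>\<alpha>\<in>A. if \<alpha> = \<beta> then block_ip H k (point a) (f \<alpha>) else 0)"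
      using that by (intro sum.cong) (auto simp: on)
    also have "\<dots> = block_ip H k (point a) (f \<beta>)" using that insert.hyps by simp
    finally show ?thesis .
  qed
  have gf: "block_ip H k g (f \<beta>) = 0" if "\<beta> \<in> A" for \<beta>
    unfolding g_def block_ip_add_left using pf[OF that] by simp
  then have fg: "block_ip H k (f \<beta>) g = 0" if "\<beta> \<in> A" for \<beta>
    using block_hermitian[of k "f \<beta>" g] that by simp
  have span_g: "block_ip H k (\<lambda>w. \<Sum>\<alpha>\<in>A. c \<alpha> * f \<alpha> w) g = 0" for c
    unfolding block_ip_sum_left by (simp add: fg)
  have gg: "block_ip H k g g = of_real N"
    unfolding N_def by (rule block_self_real)
  have ag: "block_ip H k (point a) g = of_real N"
  proof -
    have "block_ip H k g g = (-1) * block_ip H k p g + block_ip H k (point a) g"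
      by (subst (1) g_def) (rule block_ip_add_left)
    then show ?thesis using span_g gg unfolding p_def by simp
  qed
  have hsq: "complex_of_real (1 / sqrt N) * of_real (1 / sqrt N) * of_real N = 1"
    using \<open>0 < N\<close> by (simp flip: of_real_mult)
  let ?f = "f(a := h)"
  have hh: "block_ip H k h h = 1"
    using hsq by (simp add: h_def block_ip_scale_left block_ip_scale_right gg mult.assoc
        del: of_real_divide)
  have hf: "block_ip H k h (f \<beta>) = 0" "block_ip H k (f \<beta>) h = 0" if "\<beta> \<in> A" for \<beta>
    using that unfolding h_def block_ip_scale_left block_ip_scale_right by (simp_all add: gf fg)
  have uh: "block_ip H k (point u) h = 0" if "u \<in> A" for u
    unfolding h_def block_ip_scale_right by (subst ex[OF that]) (simp add: span_g)
  have ah: "block_ip H k (point a) h * h w = g w" for w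
  proof -
    have "block_ip H k (point a) h = of_real (1 / sqrt N) * of_real N"
      unfolding h_def block_ip_scale_right ag by (simp only: complex_cnj_complex_of_real)
    then have "block_ip H k (point a) h * h w =
        (of_real (1 / sqrt N) * of_real (1 / sqrt N) * of_real N) * g w"
      by (simp only: h_def mult_ac)
    then show ?thesis by (simp only: hsq mult_1)
  qed
  show ?case
  proof (intro exI[of _ ?f] conjI ballI allI impI)
    fix \<alpha> w assume "\<alpha> \<in> insert a A" "w \<notin> insert a A"
    then show "?f \<alpha> w = 0"
      using supp by (auto simp: h_def g_def p_def point_def)
  next
    fix \<alpha> \<beta> assume "\<alpha> \<in> insert a A" "\<beta> \<in> insert a A"
    then show "block_ip H k (?f \<alpha>) (?f \<beta>) = (if \<alpha> = \<beta> then 1 else 0)"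
      using insert.hyps by (auto simp: on hh hf)
  next
    fix u assume u: "u \<in> insert a A"
    have *: "(\<Sum>\<alpha>\<in>A. block_ip H k (point u) (?f \<alpha>) * ?f \<alpha> w) =
        (\<Sum>\<alpha>\<in>A. block_ip H k (point u) (f \<alpha>) * f \<alpha> w)" for w
      using insert.hyps by (intro sum.cong) auto
    show "point u = (\<lambda>w. \<Sum>\<alpha>\<in>insert a A. block_ip H k (point u) (?f \<alpha>) * ?f \<alpha> w)"
    proof (cases "u = a")
      case True
      have "(\<Sum>\<alpha>\<in>insert a A. block_ip H k (point u) (?f \<alpha>) * ?f \<alpha> w) = point u w" for w
        unfolding sum.insert[OF insert.hyps] * unfolding True
        by (simp add: ah) (simp add: g_def p_def)
      then show ?thesis by simp
    next
      case False
      then have u: "u \<in> A" using u by simp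
      have "(\<Sum>\<alpha>\<in>insert a A. block_ip H k (point u) (?f \<alpha>) * ?f \<alpha> w) = point u w" for w
        unfolding sum.insert[OF insert.hyps] * using fun_cong[OF ex[OF u], of w]
        by (simp add: uh[OF u])
      then show ?thesis by simp
    qed
  qed
qed

lemma orthonormal_basis_exists: "\<exists>f. orthonormal_basis H f"
proof -
  let ?A = "\<lambda>k. {w. deg H w = k}"
  define P where "P k f \<longleftrightarrow> (\<forall>\<alpha>\<in>?A k. \<forall>w. w \<notin> ?A k \<longrightarrow> f \<alpha> w = 0) \<and>
    (\<forall>\<alpha>\<in>?A k. \<forall>\<beta>\<in>?A k. block_ip H k (f \<alpha>) (f \<beta>) = (if \<alpha> = \<beta> then 1 else 0)) \<and>
    (\<forall>u\<in>?A k. point u = (\<lambda>w. \<Sum>\<alpha>\<in>?A k. block_ip H k (point u) (f \<alpha>) * f \<alpha> w))" for k f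
  have "\<exists>f. P k f" for k
    unfolding P_def by (rule gram_schmidt[OF finite_fibre order_refl])
  then obtain F where "\<And>k. P k (F k)" by metis
  note F = this[unfolded P_def]
  define f where "f = (\<lambda>\<alpha>. F (deg H \<alpha>) \<alpha>)"
  have supp: "f \<alpha> w = 0" if "deg H w \<noteq> deg H \<alpha>" for \<alpha> w
    using F[of "deg H \<alpha>"] that by (simp add: f_def)
  have on: "block_ip H (deg H \<alpha>) (f \<alpha>) (f \<beta>) = (if \<alpha> = \<beta> then 1 else 0)"
    if "deg H \<alpha> = deg H \<beta>" for \<alpha> \<beta>
    using F[of "deg H \<beta>"] that by (simp add: f_def)
  have ex: "x w = (\<Sum>\<alpha>\<in>?A (deg H w). block_ip H (deg H w) x (f \<alpha>) * f \<alpha> w)" for x w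
  proof -
    let ?k = "deg H w"
    have pt: "point u w = (\<Sum>\<alpha>\<in>?A ?k. block_ip H ?k (point u) (f \<alpha>) * f \<alpha> w)"
      if "deg H u = ?k" for u
    proof -
      have "point u w = (\<Sum>\<alpha>\<in>?A ?k. block_ip H ?k (point u) (F ?k \<alpha>) * F ?k \<alpha> w)"
        using F[of ?k] that by (auto dest: fun_cong)
      then show ?thesis by (simp add: f_def)
    qed
    have "block_ip H ?k x y = (\<Sum>u\<in>?A ?k. x u * block_ip H ?k (point u) y)" for y
    proof -
      have "block_ip H ?k x y = block_ip H ?k (\<lambda>w. if deg H w = ?k then x w else 0) y"
        by (rule block_ip_cong) auto
      also have "(\<lambda>w. if deg H w = ?k then x w else 0) =
          (\<lambda>w. \<Sum>u\<in>?A ?k. (if deg H u = ?k then x u else 0) * point u w)"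
        by (rule point_expansion[OF finite_fibre]) auto
      also have "block_ip H ?k \<dots> y = (\<Sum>u\<in>?A ?k. x u * block_ip H ?k (point u) y)"
        unfolding block_ip_sum_left by (rule sum.cong) auto
      finally show ?thesis .
    qed
    then have "(\<Sum>\<alpha>\<in>?A ?k. block_ip H ?k x (f \<alpha>) * f \<alpha> w) =
        (\<Sum>\<alpha>\<in>?A ?k. \<Sum>u\<in>?A ?k. x u * (block_ip H ?k (point u) (f \<alpha>) * f \<alpha> w))"
      by (simp add: sum_distrib_right mult.assoc)
    also have "\<dots> = (\<Sum>u\<in>?A ?k. x u * point u w)"
      by (subst sum.swap) (simp add: pt sum_distrib_left)
    also have "\<dots> = (\<Sum>u\<in>?A ?k. if u = w then x u else 0)"
      by (rule sum.cong) (auto simp: point_def)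
    also have "\<dots> = x w" using finite_fibre by simp
    finally show ?thesis by simp
  qed
  show ?thesis
    unfolding orthonormal_basis_def using supp on ex by blast
qed

lemma parseval:
  assumes f: "orthonormal_basis H f"
  shows "block_ip H k x y =
    (\<Sum>\<alpha> | deg H \<alpha> = k. block_ip H k x (f \<alpha>) * cnj (block_ip H k y (f \<alpha>)))"
proof -
  have "block_ip H k x y =
      block_ip H k (\<lambda>w. \<Sum>\<alpha> | deg H \<alpha> = k. block_ip H k x (f \<alpha>) * f \<alpha> w) y"
    by (rule block_ip_cong) (use f in \<open>auto simp: orthonormal_basis_def\<close>)
  then show ?thesis
    by (simp add: block_ip_sum_left flip: block_hermitian[where x = y])
qed

lemma hcarrierI_bound:
  assumes "\<And>F. finite F \<Longrightarrow> (\<Sum>k\<in>F. sq_norm k x) \<le> b"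
  shows "x \<in> hcarrier H" "Re (hip H x x) \<le> b"
proof -
  show c: "x \<in> hcarrier H"
    unfolding hcarrier_def mem_Collect_eq
    by (rule nonneg_bounded_partial_sums_imp_summable_on[of UNIV _ b])
      (auto simp: block_nonneg assms intro!: eventually_finite_subsets_at_top_weakI)
  then show "Re (hip H x x) \<le> b"
    unfolding hip_self[OF c] Re_complex_of_real
    by (intro infsum_le_finite_sums) (auto simp: assms hcarrier_def)
qed

lemma sum_block_le_hip:
  assumes "x \<in> hcarrier H" "finite F"
  shows "(\<Sum>k\<in>F. sq_norm k x) \<le> Re (hip H x x)"
  unfolding hip_self[OF assms(1)] Re_complex_of_real
  using assms by (intro finite_sum_le_infsum) (auto simp: hcarrier_def block_nonneg)

end

lemma htensor_fibre:
  "{w. deg (htensor H K) w = (k, l)} = {u. deg H u = k} \<times> {v. deg K v = l}"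
  by (auto simp: htensor_def)

lemma gram_htensor: "gram (htensor H K) (u, u') (v, v') = gram H u v * gram K u' v'"
  by (simp add: htensor_def)

text \<open>
  Expanding the second tensor factor in an orthonormal basis of \<open>K\<close> identifies
  \<open>H \<otimes> K\<close> with an orthogonal sum of copies of \<open>H\<close>, one for each basis vector; \<open>slice K f z \<alpha>\<close> is
  the component of \<open>z\<close> in the copy with index \<open>\<alpha>\<close>. Positivity of the tensor product and the
  boundedness of \<open>T \<otimes> 1\<close> are both read off from this identification.
\<close>

definition slice ::
  "('v, 'e) gbasis \<Rightarrow> ('v \<Rightarrow> 'v \<Rightarrow> complex) \<Rightarrow> ('w \<times> 'v \<Rightarrow> complex) \<Rightarrow> 'v \<Rightarrow> 'w \<Rightarrow> complex" where
  "slice K f z \<alpha> =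
     (\<lambda>u. \<Sum>v | deg K v = deg K \<alpha>. block_ip K (deg K \<alpha>) (point v) (f \<alpha>) * z (u, v))"

lemma block_ip_htensor:
  "block_ip (htensor H K) (k, l) z \<theta> =
    (\<Sum>u' | deg K u' = l. \<Sum>v' | deg K v' = l.
      block_ip H k (\<lambda>u. z (u, u')) (\<lambda>v. \<theta> (v, v')) * gram K u' v')"
proof -
  let ?A = "{u. deg H u = k}" and ?B = "{v. deg K v = l}"
  let ?t = "\<lambda>u u' v v'. z (u, u') * cnj (\<theta> (v, v')) * gram H u v * gram K u' v'"
  have "block_ip (htensor H K) (k, l) z \<theta> =
      (\<Sum>(u, u')\<in>?A \<times> ?B. \<Sum>(v, v')\<in>?A \<times> ?B. ?t u u' v v')"
    unfolding block_ip_def htensor_fibre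
    by (simp add: case_prod_beta htensor_def mult.assoc)
  also have "\<dots> = (\<Sum>u\<in>?A. \<Sum>u'\<in>?B. \<Sum>v\<in>?A. \<Sum>v'\<in>?B. ?t u u' v v')"
    by (simp flip: sum.cartesian_product)
  also have "\<dots> = (\<Sum>u'\<in>?B. \<Sum>u\<in>?A. \<Sum>v\<in>?A. \<Sum>v'\<in>?B. ?t u u' v v')"
    by (rule sum.swap)
  also have "\<dots> = (\<Sum>u'\<in>?B. \<Sum>u\<in>?A. \<Sum>v'\<in>?B. \<Sum>v\<in>?A. ?t u u' v v')"
    by (intro sum.cong refl) (rule sum.swap)
  also have "\<dots> = (\<Sum>u'\<in>?B. \<Sum>v'\<in>?B. \<Sum>u\<in>?A. \<Sum>v\<in>?A. ?t u u' v v')"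
    by (intro sum.cong refl) (rule sum.swap)
  finally show ?thesis
    by (simp add: block_ip_def sum_distrib_right)
qed

lemma block_ip_tensor_vec:
  "block_ip (htensor H K) (k, l) (tensor_vec x y) (tensor_vec x' y') =
    block_ip H k x x' * block_ip K l y y'"
proof -
  have "block_ip H k (\<lambda>u. x u * y u') (\<lambda>v. x' v * y' v') =
      y u' * cnj (y' v') * block_ip H k x x'" for u' v'
    using block_ip_scale_left[of H k "y u'" x] block_ip_scale_right[of H k _ "y' v'" x']
    by (simp add: mult.commute mult.left_commute)
  then show ?thesis
    unfolding block_ip_htensor tensor_vec_def
    by (simp add: block_ip_def[of K] sum_distrib_left mult_ac)
qed

locale graded_hilbert_pair = H: graded_hilbert H + K: graded_hilbert K
  for H :: "('w, 'd) gbasis" and K :: "('v, 'e) gbasis"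
begin

abbreviation HK :: "('w \<times> 'v, 'd \<times> 'e) gbasis" where
  "HK \<equiv> htensor H K"

lemma block_ip_slices:
  assumes f: "orthonormal_basis K f"
  shows "block_ip HK (k, l) z \<theta> =
    (\<Sum>\<alpha> | deg K \<alpha> = l. block_ip H k (slice K f z \<alpha>) (slice K f \<theta> \<alpha>))"
proof -
  let ?B = "{v. deg K v = l}" and ?c = "\<lambda>v \<alpha>. block_ip K l (point v) (f \<alpha>)"
  let ?b = "\<lambda>u' v'. block_ip H k (\<lambda>u. z (u, u')) (\<lambda>v. \<theta> (v, v'))"
  have gr: "gram K u v = (\<Sum>\<alpha>\<in>?B. ?c u \<alpha> * cnj (?c v \<alpha>))" if "u \<in> ?B" "v \<in> ?B" for u v
  proof -
    have "block_ip K l (point u) (point v) =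
        (\<Sum>u'\<in>?B. \<Sum>v'\<in>?B. if v' = v then (if u' = u then gram K u v else 0) else 0)"
      unfolding block_ip_def by (intro sum.cong) (auto simp: point_def)
    also have "\<dots> = gram K u v"
      using that K.finite_fibre[of l] by simp
    finally show ?thesis using K.parseval[OF f] by metis
  qed
  have "block_ip HK (k, l) z \<theta> =
      (\<Sum>u'\<in>?B. \<Sum>v'\<in>?B. \<Sum>\<alpha>\<in>?B. ?c u' \<alpha> * cnj (?c v' \<alpha>) * ?b u' v')"
    unfolding block_ip_htensor
    by (intro sum.cong refl) (simp add: gr sum_distrib_left mult.commute)
  also have "\<dots> = (\<Sum>u'\<in>?B. \<Sum>\<alpha>\<in>?B. \<Sum>v'\<in>?B. ?c u' \<alpha> * cnj (?c v' \<alpha>) * ?b u' v')"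
    by (rule sum.cong[OF refl], rule sum.swap)
  also have "\<dots> = (\<Sum>\<alpha>\<in>?B. \<Sum>u'\<in>?B. \<Sum>v'\<in>?B. ?c u' \<alpha> * cnj (?c v' \<alpha>) * ?b u' v')"
    by (rule sum.swap)
  also have "\<dots> = (\<Sum>\<alpha>\<in>?B. block_ip H k (slice K f z \<alpha>) (slice K f \<theta> \<alpha>))"
  proof (rule sum.cong[OF refl])
    fix \<alpha> assume "\<alpha> \<in> ?B"
    then show "(\<Sum>u'\<in>?B. \<Sum>v'\<in>?B. ?c u' \<alpha> * cnj (?c v' \<alpha>) * ?b u' v') =
        block_ip H k (slice K f z \<alpha>) (slice K f \<theta> \<alpha>)"
      by (simp add: slice_def block_ip_sum_left block_ip_sum_right sum_distrib_left mult.assoc)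
  qed
  finally show ?thesis .
qed

lemma slice_reconstruct:
  assumes f: "orthonormal_basis K f"
  shows "z (u, v) = (\<Sum>\<alpha> | deg K \<alpha> = deg K v. f \<alpha> v * slice K f z \<alpha> u)"
proof -
  let ?B = "{w. deg K w = deg K v}" and ?c = "\<lambda>v' \<alpha>. block_ip K (deg K v) (point v') (f \<alpha>)"
  have pt: "point v' v = (\<Sum>\<alpha>\<in>?B. ?c v' \<alpha> * f \<alpha> v)" for v'
    using f unfolding orthonormal_basis_def by blast
  have "(\<Sum>\<alpha>\<in>?B. f \<alpha> v * slice K f z \<alpha> u) = (\<Sum>\<alpha>\<in>?B. \<Sum>v'\<in>?B. ?c v' \<alpha> * f \<alpha> v * z (u, v'))"
    by (intro sum.cong refl) (simp add: slice_def sum_distrib_left mult_ac)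
  also have "\<dots> = (\<Sum>v'\<in>?B. point v' v * z (u, v'))"
    by (subst sum.swap) (simp add: pt sum_distrib_right)
  also have "\<dots> = (\<Sum>v'\<in>?B. if v' = v then z (u, v') else 0)"
    by (intro sum.cong) (auto simp: point_def)
  also have "\<dots> = z (u, v)" using K.finite_fibre by simp
  finally show ?thesis by simp
qed

sublocale HK: graded_hilbert HK
proof
  fix k :: "'d \<times> 'e"
  show "finite {w. deg HK w = k}"
    by (cases k) (simp add: htensor_fibre H.finite_fibre K.finite_fibre)
next
  fix u v
  show "gram HK v u = cnj (gram HK u v)"
    by (cases u, cases v) (simp add: gram_htensor H.gram_hermitian[symmetric] K.gram_hermitian[symmetric])
next
  fix w k and z :: "'w \<times> 'v \<Rightarrow> complex"
  assume w: "deg HK w = k" "z w \<noteq> 0"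
  obtain f where f: "orthonormal_basis K f" using K.orthonormal_basis_exists by blast
  obtain u v where uv: "w = (u, v)" by (cases w)
  have k: "k = (deg H u, deg K v)" using w uv by (simp add: htensor_def)
  have "\<exists>\<alpha>. deg K \<alpha> = deg K v \<and> slice K f z \<alpha> u \<noteq> 0"
  proof (rule ccontr)
    assume "\<nexists>\<alpha>. deg K \<alpha> = deg K v \<and> slice K f z \<alpha> u \<noteq> 0"
    then have "z (u, v) = 0" unfolding slice_reconstruct[OF f] by (intro sum.neutral) auto
    then show False using w uv by simp
  qed
  then obtain \<alpha> where \<alpha>: "deg K \<alpha> = deg K v" "slice K f z \<alpha> u \<noteq> 0" by blast
  have "0 < H.sq_norm (deg H u) (slice K f z \<alpha>)"
    by (rule H.block_pos[of u]) (simp_all add: \<alpha>(2))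
  also have "\<dots> \<le> (\<Sum>\<alpha> | deg K \<alpha> = deg K v.
      H.sq_norm (deg H u) (slice K f z \<alpha>))"
    using \<alpha> by (intro member_le_sum) (auto simp: H.block_nonneg K.finite_fibre)
  finally show "0 < Re (block_ip HK k z z)"
    by (simp add: k block_ip_slices[OF f])
qed

lemma block_slice_le:
  assumes f: "orthonormal_basis K f"
  shows "H.sq_norm k (slice K f z \<alpha>) \<le>
    HK.sq_norm (k, deg K \<alpha>) z"
  unfolding block_ip_slices[OF f] Re_sum
  by (rule member_le_sum) (auto simp: H.block_nonneg K.finite_fibre)

lemma slice_in_hcarrier:
  assumes f: "orthonormal_basis K f" and z: "z \<in> hcarrier HK"
  shows "slice K f z \<alpha> \<in> hcarrier H"
proof (rule H.hcarrierI_bound)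
  fix F :: "'d set" assume F: "finite F"
  have "(\<Sum>k\<in>F. H.sq_norm k (slice K f z \<alpha>)) \<le>
      (\<Sum>k\<in>F. HK.sq_norm (k, deg K \<alpha>) z)"
    by (intro sum_mono block_slice_le f)
  also have "\<dots> = (\<Sum>m\<in>(\<lambda>k. (k, deg K \<alpha>)) ` F. HK.sq_norm m z)"
    by (subst sum.reindex) (auto simp: inj_on_def)
  also have "\<dots> \<le> Re (hip HK z z)"
    using F by (intro HK.sum_block_le_hip z) simp
  finally show "(\<Sum>k\<in>F. H.sq_norm k (slice K f z \<alpha>)) \<le>
      Re (hip HK z z)" .
qed

text \<open>
  In fact equality holds in the limit, but a bound for finitely many copies suffices to sum the
  estimates for \<open>T\<close> on the individual copies of \<open>H\<close>.
\<close>

lemma sum_slices_le_hip: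
  assumes f: "orthonormal_basis K f" and z: "z \<in> hcarrier HK" and F: "finite F"
  shows "(\<Sum>l\<in>F. \<Sum>\<alpha> | deg K \<alpha> = l. Re (hip H (slice K f z \<alpha>) (slice K f z \<alpha>)))
    \<le> Re (hip HK z z)"
proof -
  let ?s = "slice K f z" and ?b = "\<lambda>k l. HK.sq_norm (k, l) z"
  have sm: "(\<lambda>k. H.sq_norm k (?s \<alpha>)) summable_on UNIV" for \<alpha>
    using slice_in_hcarrier[OF f z] by (simp add: hcarrier_def)
  have "((\<lambda>k. \<Sum>l\<in>F. \<Sum>\<alpha> | deg K \<alpha> = l. H.sq_norm k (?s \<alpha>)) has_sum
      (\<Sum>l\<in>F. \<Sum>\<alpha> | deg K \<alpha> = l. Re (hip H (?s \<alpha>) (?s \<alpha>)))) UNIV"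
    using sm by (intro has_sum_sum) (simp add: H.hip_self slice_in_hcarrier[OF f z])
  then have hs: "((\<lambda>k. \<Sum>l\<in>F. ?b k l) has_sum
      (\<Sum>l\<in>F. \<Sum>\<alpha> | deg K \<alpha> = l. Re (hip H (?s \<alpha>) (?s \<alpha>)))) UNIV"
    by (simp add: block_ip_slices[OF f])
  show ?thesis
  proof (rule has_sum_le_finite_sums[OF hs])
    fix E :: "'d set" assume E: "finite E"
    have "(\<Sum>k\<in>E. \<Sum>l\<in>F. ?b k l) = (\<Sum>m\<in>E \<times> F. HK.sq_norm m z)"
      by (simp add: sum.cartesian_product case_prod_beta)
    also have "\<dots> \<le> Re (hip HK z z)"
      using E F by (intro HK.sum_block_le_hip z) simp
    finally show "(\<Sum>k\<in>E. \<Sum>l\<in>F. ?b k l) \<le> Re (hip HK z z)" .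
  qed
qed

lemma sum_le_rectangle:
  fixes z :: "'w \<times> 'v \<Rightarrow> complex"
  assumes "finite F"
  obtains E G where "finite E" "finite G"
    "(\<Sum>m\<in>F. HK.sq_norm m z) \<le>
     (\<Sum>l\<in>G. \<Sum>k\<in>E. HK.sq_norm (k, l) z)"
proof
  show fin: "finite (fst ` F)" "finite (snd ` F)" using assms by auto
  have "(\<Sum>m\<in>F. HK.sq_norm m z) \<le>
      (\<Sum>m\<in>fst ` F \<times> snd ` F. HK.sq_norm m z)"
    by (rule sum_mono2) (use fin HK.block_nonneg in \<open>auto intro: rev_image_eqI\<close>)
  also have "\<dots> = (\<Sum>k\<in>fst ` F. \<Sum>l\<in>snd ` F. HK.sq_norm (k, l) z)"
    by (simp add: sum.cartesian_product case_prod_beta)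
  also have "\<dots> = (\<Sum>l\<in>snd ` F. \<Sum>k\<in>fst ` F. HK.sq_norm (k, l) z)"
    by (rule sum.swap)
  finally show "(\<Sum>m\<in>F. HK.sq_norm m z) \<le>
     (\<Sum>l\<in>snd ` F. \<Sum>k\<in>fst ` F. HK.sq_norm (k, l) z)" .
qed

lemma tensor_vec_in_hcarrier:
  assumes x: "x \<in> hcarrier H" and y: "y \<in> hcarrier K"
  shows "tensor_vec x y \<in> hcarrier HK"
proof (rule HK.hcarrierI_bound)
  fix F :: "('d \<times> 'e) set" assume "finite F"
  then obtain E G where EG: "finite E" "finite G" and le:
    "(\<Sum>m\<in>F. HK.sq_norm m (tensor_vec x y)) \<le>
     (\<Sum>l\<in>G. \<Sum>k\<in>E. HK.sq_norm (k, l) (tensor_vec x y))"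
    by (rule sum_le_rectangle)
  have "HK.sq_norm (k, l) (tensor_vec x y) =
      H.sq_norm k x * K.sq_norm l y" for k l
    unfolding block_ip_tensor_vec
    by (subst H.block_self_real, subst K.block_self_real) (simp flip: of_real_mult)
  then have "(\<Sum>l\<in>G. \<Sum>k\<in>E. HK.sq_norm (k, l) (tensor_vec x y))
      = (\<Sum>k\<in>E. H.sq_norm k x) * (\<Sum>l\<in>G. K.sq_norm l y)"
    by (simp add: sum_product) (rule sum.swap)
  also have "\<dots> \<le> Re (hip H x x) * Re (hip K y y)"
    using EG x y by (intro mult_mono H.sum_block_le_hip K.sum_block_le_hip
        H.hip_self_nonneg sum_nonneg K.block_nonneg)
  finally show "(\<Sum>m\<in>F. HK.sq_norm m (tensor_vec x y)) \<le>
      Re (hip H x x) * Re (hip K y y)"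
    using le by simp
qed

text \<open>The operator \<open>T \<otimes> 1\<close> acts on the columns of a coefficient function.\<close>

definition amplify :: "'w oper \<Rightarrow> ('w \<times> 'v) oper" where
  "amplify T = restrict_op HK (\<lambda>z (u, v). T (\<lambda>u'. z (u', v)) u)"

lemma column_in_hcarrier:
  assumes "z \<in> hcarrier HK"
  shows "(\<lambda>u. z (u, v)) \<in> hcarrier H"
proof -
  obtain f where f: "orthonormal_basis K f" using K.orthonormal_basis_exists by blast
  show ?thesis
    by (subst slice_reconstruct[OF f]) (intro H.hcarrier_sum slice_in_hcarrier[OF f assms])
qed

lemma amplify_bounded:
  assumes T: "T \<in> bounded_ops H"
  shows "amplify T \<in> bounded_ops HK"
proof -
  obtain f where f: "orthonormal_basis K f" using K.orthonormal_basis_exists by blast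
  obtain B where B: "0 \<le> B" "\<And>x. x \<in> hcarrier H \<Longrightarrow> hnorm H (T x) \<le> B * hnorm H x"
    using H.bounded_ops_bound[OF T] by blast
  have sl: "slice K f (amplify T z) \<alpha> = T (slice K f z \<alpha>)"
    if "z \<in> hcarrier HK" for z \<alpha>
    unfolding slice_def
    by (subst H.bounded_ops_sum[OF T])
      (simp_all add: column_in_hcarrier that amplify_def restrict_op_def)
  have bound: "amplify T z \<in> hcarrier HK"
    "Re (hip HK (amplify T z) (amplify T z)) \<le> B\<^sup>2 * Re (hip HK z z)"
    if z: "z \<in> hcarrier HK" for z
  proof -
    let ?s = "slice K f z"
    have "(\<Sum>m\<in>F. HK.sq_norm m (amplify T z)) \<le>
        B\<^sup>2 * Re (hip HK z z)" if "finite F" for F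
    proof -
      obtain E G where EG: "finite E" "finite G" and le:
        "(\<Sum>m\<in>F. HK.sq_norm m (amplify T z)) \<le>
         (\<Sum>l\<in>G. \<Sum>k\<in>E. HK.sq_norm (k, l) (amplify T z))"
        using sum_le_rectangle[OF \<open>finite F\<close>] .
      have "(\<Sum>l\<in>G. \<Sum>k\<in>E. HK.sq_norm (k, l) (amplify T z)) =
          (\<Sum>l\<in>G. \<Sum>\<alpha> | deg K \<alpha> = l. \<Sum>k\<in>E. H.sq_norm k (T (?s \<alpha>)))"
        by (intro sum.cong refl) (simp add: block_ip_slices[OF f] sl[OF z], rule sum.swap)
      also have "\<dots> \<le> (\<Sum>l\<in>G. \<Sum>\<alpha> | deg K \<alpha> = l. Re (hip H (T (?s \<alpha>)) (T (?s \<alpha>))))"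
        using EG by (intro sum_mono H.sum_block_le_hip H.bounded_opsD(1)[OF T]
            slice_in_hcarrier[OF f z])
      also have "\<dots> \<le> (\<Sum>l\<in>G. \<Sum>\<alpha> | deg K \<alpha> = l. B\<^sup>2 * Re (hip H (?s \<alpha>) (?s \<alpha>)))"
      proof (intro sum_mono)
        fix \<alpha>
        have "(hnorm H (T (?s \<alpha>)))\<^sup>2 \<le> (B * hnorm H (?s \<alpha>))\<^sup>2"
          by (intro power_mono B slice_in_hcarrier[OF f z]) simp
        then show "Re (hip H (T (?s \<alpha>)) (T (?s \<alpha>))) \<le> B\<^sup>2 * Re (hip H (?s \<alpha>) (?s \<alpha>))"
          by (simp add: power_mult_distrib H.hnorm_square)
      qed
      also have "\<dots> = B\<^sup>2 * (\<Sum>l\<in>G. \<Sum>\<alpha> | deg K \<alpha> = l. Re (hip H (?s \<alpha>) (?s \<alpha>)))"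
        by (simp add: sum_distrib_left)
      also have "\<dots> \<le> B\<^sup>2 * Re (hip HK z z)"
        by (intro mult_left_mono sum_slices_le_hip[OF f z EG(2)]) simp
      finally show ?thesis using le by simp
    qed
    note partial = this
    show "amplify T z \<in> hcarrier HK"
      by (rule HK.hcarrierI_bound(1)[OF partial])
    show "Re (hip HK (amplify T z) (amplify T z)) \<le> B\<^sup>2 * Re (hip HK z z)"
      by (rule HK.hcarrierI_bound(2)[OF partial])
  qed
  show ?thesis
  proof (rule HK.bounded_opsI[where B = B])
    fix z assume z: "z \<in> hcarrier HK"
    show "amplify T z \<in> hcarrier HK" by (rule bound(1)[OF z])
    have "(hnorm HK (amplify T z))\<^sup>2 \<le> (B * hnorm HK z)\<^sup>2"
      using bound(2)[OF z] by (simp add: power_mult_distrib HK.hnorm_square)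
    then show "hnorm HK (amplify T z) \<le> B * hnorm HK z"
      by (rule power2_le_imp_le) (simp add: B)
  next
    fix z \<theta> c assume "z \<in> hcarrier HK" "\<theta> \<in> hcarrier HK"
    then show "amplify T (\<lambda>w. c * z w + \<theta> w) = (\<lambda>w. c * amplify T z w + amplify T \<theta> w)"
      by (auto simp: amplify_def restrict_op_def HK.hcarrier_lincomb H.bounded_opsD(3)[OF T]
          column_in_hcarrier)
  qed (simp add: amplify_def restrict_op_def)
qed

lemma amplify_tensor_vec:
  assumes T: "T \<in> bounded_ops H" and "x \<in> hcarrier H" "y \<in> hcarrier K"
  shows "amplify T (tensor_vec x y) = tensor_vec (T x) y"
proof -
  have "T (\<lambda>u. x u * y v) = (\<lambda>u. T x u * y v)" for v
    using H.bounded_opsD(3)[OF T assms(2) zero_in_hcarrier, of "y v"]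
    by (simp add: H.bounded_opsD(4)[OF T] mult.commute)
  then have "amplify T (tensor_vec x y) (u, v) = tensor_vec (T x) y (u, v)" for u v
    using assms tensor_vec_in_hcarrier by (simp add: amplify_def restrict_op_def tensor_vec_def)
  then show ?thesis by (simp add: fun_eq_iff)
qed

end

lemma block_ip_htensor_flip:
  "block_ip (htensor K H) (l, k) (z \<circ> prod.swap) (\<theta> \<circ> prod.swap) = block_ip (htensor H K) (k, l) z \<theta>"
proof -
  let ?S = "{w. deg (htensor H K) w = (k, l)}"
  have im: "{w. deg (htensor K H) w = (l, k)} = prod.swap ` ?S"
    unfolding htensor_fibre by auto
  have inj: "inj_on prod.swap ?S" by (simp add: inj_on_def)
  have "gram (htensor K H) (prod.swap u) (prod.swap v) = gram (htensor H K) u v" for u v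
    by (cases u, cases v) (simp add: gram_htensor mult.commute)
  then show ?thesis
    unfolding block_ip_def im sum.reindex[OF inj] by (simp add: o_def)
qed

lemma hcarrier_flip: "z \<circ> prod.swap \<in> hcarrier (htensor K H) \<longleftrightarrow> z \<in> hcarrier (htensor H K)"
proof -
  have "(\<lambda>m. Re (block_ip (htensor K H) m (z \<circ> prod.swap) (z \<circ> prod.swap))) =
      (\<lambda>m. Re (block_ip (htensor H K) m z z)) \<circ> prod.swap"
    by (auto simp: block_ip_htensor_flip)
  moreover have "(\<lambda>m. Re (block_ip (htensor H K) m z z)) \<circ> prod.swap summable_on UNIV \<longleftrightarrow>
      (\<lambda>m. Re (block_ip (htensor H K) m z z)) summable_on UNIV"
    using summable_on_reindex[of prod.swap UNIV "\<lambda>m. Re (block_ip (htensor H K) m z z)"] by simp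
  ultimately show ?thesis by (simp add: hcarrier_def)
qed

lemma hip_flip: "hip (htensor K H) (z \<circ> prod.swap) (\<theta> \<circ> prod.swap) = hip (htensor H K) z \<theta>"
proof -
  have "(\<lambda>m. block_ip (htensor K H) m (z \<circ> prod.swap) (\<theta> \<circ> prod.swap)) =
      (\<lambda>m. block_ip (htensor H K) m z \<theta>) \<circ> prod.swap"
    by (auto simp: block_ip_htensor_flip)
  then show ?thesis
    using infsum_reindex[of prod.swap UNIV "\<lambda>m. block_ip (htensor H K) m z \<theta>"] by (simp add: hip_def)
qed

context graded_hilbert_pair
begin

text \<open>
  The operator with the required action is \<open>(a \<otimes> 1) (1 \<otimes> b)\<close>, the second factor being the amplification
  of \<open>b\<close> after interchanging the tensor factors; it is the only one because the basis vectors of the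
  tensor product are elementary tensors.
\<close>

lemma
  assumes a: "a \<in> bounded_ops H" and b: "b \<in> bounded_ops K"
  shows tensor_op_bounded: "tensor_op H K a b \<in> bounded_ops HK"
    and tensor_op_tensor_vec: "\<And>x y. x \<in> hcarrier H \<Longrightarrow> y \<in> hcarrier K \<Longrightarrow>
      tensor_op H K a b (tensor_vec x y) = tensor_vec (a x) (b y)"
proof -
  interpret KH: graded_hilbert_pair K H ..
  let ?R = "\<lambda>z. KH.amplify b (z \<circ> prod.swap) \<circ> prod.swap"
  have flip: "z \<circ> prod.swap \<circ> prod.swap = z" for z :: "'x \<times> 'y \<Rightarrow> complex" by auto
  have flip_tensor: "tensor_vec x y \<circ> prod.swap = tensor_vec y x" for x :: "'x \<Rightarrow> _" and y :: "'y \<Rightarrow> _"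
    by (auto simp: tensor_vec_def)
  have hn: "hnorm HK (z \<circ> prod.swap) = hnorm KH.HK z" for z
    by (simp add: hnorm_def hip_flip)
  have Kb: "KH.amplify b \<in> bounded_ops KH.HK" by (rule KH.amplify_bounded[OF b])
  obtain B where B: "\<And>z. z \<in> hcarrier KH.HK \<Longrightarrow>
      hnorm KH.HK (KH.amplify b z) \<le> B * hnorm KH.HK z"
    using KH.HK.bounded_ops_bound[OF Kb] by blast
  have R: "?R \<in> bounded_ops HK"
  proof (rule HK.bounded_opsI[where B = B])
    fix z assume "z \<notin> hcarrier HK"
    then show "?R z = (\<lambda>_. 0)"
      using KH.HK.bounded_opsD(2)[OF Kb, of "z \<circ> prod.swap"] by (simp add: hcarrier_flip fun_eq_iff)
  next
    fix z assume z: "z \<in> hcarrier HK"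
    then show "?R z \<in> hcarrier HK"
      using KH.HK.bounded_opsD(1)[OF Kb] by (simp add: hcarrier_flip)
    show "hnorm HK (?R z) \<le> B * hnorm HK z"
      using B[of "z \<circ> prod.swap"] z hn[of "z \<circ> prod.swap"] by (simp add: hcarrier_flip hn flip)
  next
    fix z \<theta> c assume "z \<in> hcarrier HK" "\<theta> \<in> hcarrier HK"
    then have "z \<circ> prod.swap \<in> hcarrier KH.HK" "\<theta> \<circ> prod.swap \<in> hcarrier KH.HK"
      by (simp_all add: hcarrier_flip)
    from KH.HK.bounded_opsD(3)[OF Kb this, of c]
    show "?R (\<lambda>w. c * z w + \<theta> w) = (\<lambda>w. c * ?R z w + ?R \<theta> w)"
      by (simp add: o_def)
  qed
  have Rt: "?R (tensor_vec x y) = tensor_vec x (b y)" if "x \<in> hcarrier H" "y \<in> hcarrier K" for x y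
    using that by (simp add: flip_tensor KH.amplify_tensor_vec[OF b])
  let ?T = "amplify a \<circ> ?R"
  have T: "?T \<in> bounded_ops HK"
    by (rule HK.bounded_ops_comp[OF amplify_bounded[OF a] R])
  have Tt: "?T (tensor_vec x y) = tensor_vec (a x) (b y)"
    if "x \<in> hcarrier H" "y \<in> hcarrier K" for x y
    using that by (simp add: Rt amplify_tensor_vec[OF a] K.bounded_opsD(1)[OF b])
  have pt: "point (u, v) = tensor_vec (point u) (point v)" for u :: 'w and v :: 'v
    by (auto simp: point_def tensor_vec_def)
  have "tensor_op H K a b = ?T"
    unfolding tensor_op_def
  proof (rule the_equality)
    fix S assume S: "S \<in> bounded_ops HK \<and>
      (\<forall>x\<in>hcarrier H. \<forall>y\<in>hcarrier K. S (tensor_vec x y) = tensor_vec (a x) (b y))"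
    show "S = ?T"
    proof (rule HK.bounded_ops_eqI[OF _ T])
      show "S (point u) = ?T (point u)" for u
        by (cases u) (use S Tt in \<open>simp add: pt\<close>)
    qed (use S in blast)
  qed (use T Tt in blast)
  then show "tensor_op H K a b \<in> bounded_ops HK"
    "\<And>x y. x \<in> hcarrier H \<Longrightarrow> y \<in> hcarrier K \<Longrightarrow>
      tensor_op H K a b (tensor_vec x y) = tensor_vec (a x) (b y)"
    using T Tt by metis+
qed

end


subsection \<open>The conjugate space\<close>

lemma conj_vec_conj_vec [simp]: "conj_vec (conj_vec x) = x"
  by (simp add: conj_vec_def)

lemma block_ip_hconj: "block_ip (hconj H) k x y = cnj (block_ip H k (conj_vec x) (conj_vec y))"
  by (simp add: block_ip_def hconj_def conj_vec_def)

lemma hcarrier_hconj: "x \<in> hcarrier (hconj H) \<longleftrightarrow> conj_vec x \<in> hcarrier H"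
  by (simp add: hcarrier_def block_ip_hconj)

lemma hnorm_hconj: "hnorm (hconj H) x = hnorm H (conj_vec x)"
  by (simp add: hnorm_def hip_def block_ip_hconj)

context graded_hilbert
begin

lemma graded_hilbert_hconj: "graded_hilbert (hconj H)"
proof
  show "finite {w. deg (hconj H) w = k}" for k
    using finite_fibre by (simp add: hconj_def)
  show "gram (hconj H) v u = cnj (gram (hconj H) u v)" for u v
    by (simp add: hconj_def gram_hermitian[symmetric])
  show "0 < Re (block_ip (hconj H) k x x)" if "deg (hconj H) w = k" "x w \<noteq> 0" for w k x
    using block_pos[of w k "conj_vec x"] that by (simp add: block_ip_hconj) (simp add: hconj_def conj_vec_def)
qed

lemma op_of_bounded:
  assumes S: "adj_op H b \<in> bounded_ops H"
  shows "op_of H b \<in> bounded_ops (hconj H)"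
proof -
  interpret C: graded_hilbert "hconj H" by (rule graded_hilbert_hconj)
  obtain B where B: "\<And>x. x \<in> hcarrier H \<Longrightarrow> hnorm H (adj_op H b x) \<le> B * hnorm H x"
    using bounded_ops_bound[OF S] by blast
  show ?thesis
  proof (rule C.bounded_opsI[where B = B])
    fix x y :: "'w \<Rightarrow> complex" and c
    assume "x \<in> hcarrier (hconj H)" "y \<in> hcarrier (hconj H)"
    moreover have "conj_vec (\<lambda>w. c * x w + y w) = (\<lambda>w. cnj c * conj_vec x w + conj_vec y w)"
      by (simp add: conj_vec_def)
    ultimately show "op_of H b (\<lambda>w. c * x w + y w) = (\<lambda>w. c * op_of H b x w + op_of H b y w)"
      by (simp add: op_of_def hcarrier_hconj bounded_opsD(3)[OF S]) (simp add: conj_vec_def)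
  next
    fix x assume "x \<notin> hcarrier (hconj H)"
    then show "op_of H b x = (\<lambda>_. 0)"
      using bounded_opsD(2)[OF S] by (simp add: hcarrier_hconj op_of_def) (simp add: conj_vec_def)
  qed (simp_all add: op_of_def hcarrier_hconj hnorm_hconj B bounded_opsD(1)[OF S])
qed

end


section \<open>Positivity of the q-inner product\<close>

lemma sum_Pow_insert:
  assumes "finite E" "e \<notin> E"
  shows "sum g (Pow (insert e E)) = (\<Sum>A\<in>Pow E. g A + g (insert e A))"
proof -
  have inj: "inj_on (insert e) (Pow E)"
    using assms(2) by (auto simp: inj_on_def)
  have "sum g (Pow (insert e E)) = sum g (Pow E) + sum g (insert e ` Pow E)"
    unfolding Pow_insert using assms by (intro sum.union_disjoint) auto
  then show ?thesis
    by (simp add: sum.reindex[OF inj] sum.distrib)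
qed

definition hamming_form ::
  "real \<Rightarrow> 'a set \<Rightarrow> ('a set \<Rightarrow> complex) \<Rightarrow> ('a set \<Rightarrow> complex) \<Rightarrow> complex" where
  "hamming_form q E f g =
     (\<Sum>A\<in>Pow E. \<Sum>B\<in>Pow E. of_real (q ^ card (sym_diff A B)) * f A * cnj (g B))"

lemma hamming_form_insert:
  assumes "finite E" "e \<notin> E"
  shows "hamming_form q (insert e E) f g =
    hamming_form q E f g + hamming_form q E (\<lambda>A. f (insert e A)) (\<lambda>A. g (insert e A)) +
    of_real q * (hamming_form q E f (\<lambda>A. g (insert e A)) + hamming_form q E (\<lambda>A. f (insert e A)) g)"
proof -
  have 1: "sym_diff (insert e A) (insert e B) = sym_diff A B"
    and 2: "sym_diff A (insert e B) = insert e (sym_diff A B)"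
    and 3: "sym_diff (insert e A) B = insert e (sym_diff A B)"
    and 4: "card (insert e (sym_diff A B)) = Suc (card (sym_diff A B))"
    if "A \<in> Pow E" "B \<in> Pow E" for A B
  proof -
    have "e \<notin> A" "e \<notin> B" "finite (sym_diff A B)"
      using that assms by (auto intro: finite_subset[of _ E])
    then show "sym_diff (insert e A) (insert e B) = sym_diff A B"
      "sym_diff A (insert e B) = insert e (sym_diff A B)"
      "sym_diff (insert e A) B = insert e (sym_diff A B)"
      "card (insert e (sym_diff A B)) = Suc (card (sym_diff A B))"
      by auto
  qed
  have "hamming_form q (insert e E) f g =
    (\<Sum>A\<in>Pow E. \<Sum>B\<in>Pow E.
      of_real (q ^ card (sym_diff A B)) * f A * cnj (g B) +
      of_real q * (of_real (q ^ card (sym_diff A B)) * f A * cnj (g (insert e B))) +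
      (of_real q * (of_real (q ^ card (sym_diff A B)) * f (insert e A) * cnj (g B)) +
      of_real (q ^ card (sym_diff A B)) * f (insert e A) * cnj (g (insert e B))))"
    unfolding hamming_form_def sum_Pow_insert[OF assms] sum.distrib[symmetric]
    by (intro sum.cong refl) (simp only: 1 2 3 4 power_Suc of_real_mult mult.assoc)
  then show ?thesis
    unfolding hamming_form_def by (simp add: sum.distrib sum_distrib_left algebra_simps)
qed

text \<open>
  The kernel \<open>q ^ card (sym_diff A B)\<close> on the subsets of \<open>E\<close> is the tensor product, over the
  elements of \<open>E\<close>, of the matrix with rows \<open>(1, q)\<close> and \<open>(q, 1)\<close>, whose least eigenvalue is
  \<open>1 - \<bar>q\<bar>\<close>.
\<close>

lemma hamming_form_bound:
  assumes "finite E" and q: "\<bar>q\<bar> \<le> 1"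
  shows "(1 - \<bar>q\<bar>) ^ card E * (\<Sum>A\<in>Pow E. (cmod (f A))\<^sup>2) \<le> Re (hamming_form q E f f)"
  using assms(1)
proof (induction E arbitrary: f rule: finite_induct)
  case empty
  show ?case by (simp add: hamming_form_def complex_norm_square[symmetric] del: of_real_power)
next
  case (insert e E)
  let ?Q = "hamming_form q E" and ?f = "\<lambda>A. f (insert e A)"
  have lower: "(1 - \<bar>q\<bar>) ^ card E * (\<Sum>A\<in>Pow E. (cmod (g A))\<^sup>2) \<le> Re (?Q g g)" for g
    by (rule insert.IH)
  have nn: "0 \<le> Re (?Q g g)" for g
    using q by (intro order_trans[OF _ lower] mult_nonneg_nonneg zero_le_power sum_nonneg) auto
  have lin: "?Q (\<lambda>A. f A + of_real c * g A) (\<lambda>A. f A + of_real c * g A) =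
      ?Q f f + of_real (c * c) * ?Q g g + of_real c * (?Q f g + ?Q g f)" for c g
    unfolding hamming_form_def by (simp add: sum.distrib sum_distrib_left algebra_simps)
  let ?x = "Re (?Q f ?f + ?Q ?f f)" and ?y = "Re (?Q f f) + Re (?Q ?f ?f)"
  have "0 \<le> ?y + ?x" "0 \<le> ?y - ?x"
    using nn[of "\<lambda>A. f A + of_real 1 * ?f A"] nn[of "\<lambda>A. f A + of_real (-1) * ?f A"]
    unfolding lin by simp_all
  then have "\<bar>?x\<bar> \<le> ?y" by linarith
  then have "\<bar>q * ?x\<bar> \<le> \<bar>q\<bar> * ?y" unfolding abs_mult by (rule mult_left_mono) simp
  then have "- (\<bar>q\<bar> * ?y) \<le> q * ?x" by linarith
  then have main: "(1 - \<bar>q\<bar>) * ?y \<le> Re (hamming_form q (insert e E) f f)"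
    unfolding hamming_form_insert[OF insert.hyps] by (simp add: algebra_simps)
  have "(1 - \<bar>q\<bar>) ^ card (insert e E) * (\<Sum>A\<in>Pow (insert e E). (cmod (f A))\<^sup>2) =
      (1 - \<bar>q\<bar>) * ((1 - \<bar>q\<bar>) ^ card E * (\<Sum>A\<in>Pow E. (cmod (f A))\<^sup>2) +
        (1 - \<bar>q\<bar>) ^ card E * (\<Sum>A\<in>Pow E. (cmod (?f A))\<^sup>2))"
    using insert.hyps by (simp add: sum_Pow_insert sum.distrib algebra_simps)
  also have "\<dots> \<le> (1 - \<bar>q\<bar>) * ?y"
    using q by (intro mult_left_mono add_mono lower) simp
  finally show ?case using main by simp
qed

definition inversion_set :: "nat \<Rightarrow> (nat \<Rightarrow> nat) \<Rightarrow> (nat \<times> nat) set" where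
  "inversion_set k \<rho> = {(a, b). a < b \<and> b < k \<and> inv \<rho> a > inv \<rho> b}"

text \<open>
  A pair of values is inverted by \<open>inv \<tau> \<circ> \<rho>\<close> exactly if \<open>\<rho>\<close> and \<open>\<tau>\<close> put it in opposite
  orders. So \<open>q ^ inversions k (inv \<tau> \<circ> \<rho>)\<close> is the kernel above on the sets of inversions.
\<close>

lemma inversions_eq_card_sym_diff:
  assumes \<rho>: "\<rho> permutes {..<k}" and \<tau>: "\<tau> permutes {..<k}"
  shows "inversions k (inv \<tau> \<circ> \<rho>) = card (sym_diff (inversion_set k \<rho>) (inversion_set k \<tau>))"
proof -
  let ?p = "inv \<rho>" and ?t = "inv \<tau>"
  have p: "?p (\<rho> i) = i" "\<rho> (?p i) = i" for i
    using permutes_inverses[OF \<rho>] by auto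
  have lt: "\<rho> i < k \<longleftrightarrow> i < k" "?p i < k \<longleftrightarrow> i < k" for i
    using permutes_in_image[OF \<rho>, of i] permutes_in_image[OF permutes_inv[OF \<rho>], of i] by auto
  have inj: "\<rho> i = \<rho> j \<longleftrightarrow> i = j" "?p i = ?p j \<longleftrightarrow> i = j" "?t i = ?t j \<longleftrightarrow> i = j" for i j
    using permutes_inj[OF \<rho>] permutes_inj[OF permutes_inv[OF \<rho>]]
      permutes_inj[OF permutes_inv[OF \<tau>]] by (auto simp: inj_eq)
  let ?S = "{(i, j). i < j \<and> j < k \<and> (?t \<circ> \<rho>) i > (?t \<circ> \<rho>) j}"
    and ?D = "sym_diff (inversion_set k \<rho>) (inversion_set k \<tau>)"
  let ?F = "\<lambda>(i, j). (min (\<rho> i) (\<rho> j), max (\<rho> i) (\<rho> j))"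
    and ?G = "\<lambda>(a, b). (min (?p a) (?p b), max (?p a) (?p b))"
  have "bij_betw ?F ?S ?D"
  proof (rule bij_betw_byWitness[where f' = "?G"])
    show "\<forall>x\<in>?S. ?G (?F x) = x"
      by (auto simp: min_def max_def p)
    show "\<forall>x\<in>?D. ?F (?G x) = x"
    proof
      fix x assume x: "x \<in> ?D"
      obtain a b where ab: "x = (a, b)" by (cases x)
      have "a < b" using x ab by (auto simp: inversion_set_def)
      then show "?F (?G x) = x"
        unfolding ab by (cases "?p a \<le> ?p b") (simp_all add: min_def max_def p)
    qed
    show "?F ` ?S \<subseteq> ?D"
    proof (rule image_subsetI)
      fix x assume "x \<in> ?S"
      then obtain i j where x: "x = (i, j)" and ij: "i < j" "j < k" "?t (\<rho> j) < ?t (\<rho> i)"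
        by auto
      then have "\<rho> i < k" "\<rho> j < k" "\<rho> i \<noteq> \<rho> j" using lt inj by auto
      then consider "\<rho> i < \<rho> j" | "\<rho> j < \<rho> i" by linarith
      then show "?F x \<in> ?D"
        unfolding x by cases (use ij \<open>\<rho> i < k\<close> \<open>\<rho> j < k\<close> in \<open>auto simp: inversion_set_def p min_def max_def\<close>)
    qed
    show "?G ` ?D \<subseteq> ?S"
    proof (rule image_subsetI)
      fix x assume x: "x \<in> ?D"
      obtain a b where xab: "x = (a, b)" by (cases x)
      note ab = x[unfolded xab]
      then have "a < b" "b < k" by (auto simp: inversion_set_def)
      then have "?p a < k" "?p b < k" "?p a \<noteq> ?p b" "?t a \<noteq> ?t b" using lt inj by auto
      then consider "?p a < ?p b" | "?p b < ?p a" by linarith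
      then show "?G x \<in> ?S"
        unfolding xab by cases (use ab \<open>?p a < k\<close> \<open>?p b < k\<close> \<open>?t a \<noteq> ?t b\<close> in
          \<open>auto simp: inversion_set_def p min_def max_def\<close>)
    qed
  qed
  then show ?thesis
    unfolding inversions_def by (rule bij_betw_same_card)
qed

lemma inversions_inv:
  assumes "\<sigma> permutes {..<k}"
  shows "inversions k (inv \<sigma>) = inversions k \<sigma>"
proof -
  have "id permutes {..<k}" by (rule permutes_id)
  then show ?thesis
    using inversions_eq_card_sym_diff[OF assms, of id] inversions_eq_card_sym_diff[OF _ assms, of id]
    by (simp add: Un_commute)
qed

lemma permutes_no_inversions:
  assumes \<sigma>: "\<sigma> permutes {..<k}" and 0: "inversions k \<sigma> = 0"
  shows "\<sigma> = id"
proof (rule permutes_natset_ge[OF \<sigma>], rule ballI)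
  have "finite {(i, j). i < j \<and> j < k \<and> \<sigma> i > \<sigma> j}"
    by (rule finite_subset[of _ "{..<k} \<times> {..<k}"]) auto
  then have mono: "\<sigma> i < \<sigma> j" if "i < j" "j < k" for i j
    using 0 that permutes_inj[OF \<sigma>]
    by (auto simp: inversions_def) (metis inj_eq less_irrefl linorder_neqE_nat)
  fix i assume "i \<in> {..<k}"
  then show "i \<le> \<sigma> i"
  proof (induction i)
    case (Suc i)
    then show ?case using mono[of i "Suc i"] by simp
  qed simp
qed

lemma inversion_set_inj: "inj_on (inversion_set k) {\<sigma>. \<sigma> permutes {..<k}}"
proof (rule inj_onI, clarify)
  fix \<rho> \<tau> assume \<rho>: "\<rho> permutes {..<k}" and \<tau>: "\<tau> permutes {..<k}"
    and eq: "inversion_set k \<rho> = inversion_set k \<tau>"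
  have "inversions k (inv \<tau> \<circ> \<rho>) = 0"
    by (simp add: inversions_eq_card_sym_diff[OF \<rho> \<tau>] eq)
  then have "inv \<tau> \<circ> \<rho> = id"
    by (rule permutes_no_inversions[OF permutes_compose[OF \<rho> permutes_inv[OF \<tau>]]])
  then have "\<tau> \<circ> (inv \<tau> \<circ> \<rho>) = \<tau>" by simp
  then show "\<rho> = \<tau>" by (simp add: o_assoc permutes_inv_o[OF \<tau>])
qed

abbreviation perms :: "nat \<Rightarrow> (nat \<Rightarrow> nat) set" where
  "perms k \<equiv> {\<sigma>. \<sigma> permutes {..<k}}"

abbreviation words :: "nat \<Rightarrow> 'n list set" where
  "words k \<equiv> {w. length w = k}"

lemma finite_perms [simp]: "finite (perms k)"
  by (simp add: finite_permutations)

lemma finite_words [simp]: "finite (words k :: 'n::finite list set)"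
  using finite_lists_length_eq[of "UNIV :: 'n set" k] by simp

definition permute_word :: "(nat \<Rightarrow> nat) \<Rightarrow> 'n list \<Rightarrow> 'n list" where
  "permute_word \<sigma> w = map (\<lambda>i. w ! \<sigma> i) [0..<length w]"

lemma length_permute_word [simp]: "length (permute_word \<sigma> w) = length w"
  by (simp add: permute_word_def)

lemma permute_word_compose:
  assumes "\<sigma> permutes {..<length w}"
  shows "permute_word \<sigma> (permute_word \<tau> w) = permute_word (\<tau> \<circ> \<sigma>) w"
  using permutes_in_image[OF assms] by (auto simp: permute_word_def)

lemma permute_word_id [simp]: "permute_word id w = w"
  by (simp add: permute_word_def map_nth)

lemma bij_permute_word:
  assumes "\<tau> permutes {..<k}"
  shows "bij_betw (permute_word \<tau>) (words k) (words k)"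
  by (rule bij_betw_byWitness[where f' = "permute_word (inv \<tau>)"])
    (auto simp: permute_word_compose assms permutes_inv permutes_inv_o[OF assms])

abbreviation q_gram :: "real \<Rightarrow> 'n::finite list \<Rightarrow> 'n list \<Rightarrow> complex" where
  "q_gram q \<equiv> gram (q_fock q)"

lemma deg_q_fock [simp]: "deg (q_fock q) = length"
  by (simp add: q_fock_def)

lemma q_gram_neq: "length u \<noteq> length v \<Longrightarrow> q_gram q u v = 0"
  by (simp add: q_fock_def)

lemma q_gram_eq:
  assumes "length u = k" "length v = k"
  shows "q_gram q u v = (\<Sum>\<sigma>\<in>perms k. of_real (q ^ inversions k \<sigma>) *
    (\<Prod>i<k. if u ! i = v ! \<sigma> i then 1 else 0))"
  using assms by (simp add: q_fock_def)

lemma q_gram_permute_word: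
  assumes "length u = k" "length v = k"
  shows "q_gram q u v =
    (\<Sum>\<sigma>\<in>perms k. of_real (q ^ inversions k \<sigma>) * (if u = permute_word \<sigma> v then 1 else 0))"
proof -
  have "(\<Prod>i<k. if u ! i = v ! \<sigma> i then 1 else 0 :: complex) = (if u = permute_word \<sigma> v then 1 else 0)" for \<sigma>
  proof -
    have "u = permute_word \<sigma> v \<longleftrightarrow> (\<forall>i<k. u ! i = v ! \<sigma> i)"
      using assms by (auto simp: list_eq_iff_nth_eq permute_word_def)
    then show ?thesis by auto
  qed
  then show ?thesis using assms by (simp add: q_gram_eq)
qed

lemma q_gram_sym: "q_gram q v u = q_gram q u v"
proof (cases "length u = length v")
  case True
  let ?k = "length v"
  have "q_gram q v u = (\<Sum>\<sigma>\<in>perms ?k. of_real (q ^ inversions ?k (inv \<sigma>)) *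
    (\<Prod>i<?k. if v ! i = u ! inv \<sigma> i then 1 else 0))"
    unfolding q_gram_eq[OF refl True] by (rule sum_permutations_inverse)
  also have "\<dots> = q_gram q u v"
    unfolding q_gram_eq[OF True refl]
  proof (rule sum.cong[OF refl])
    fix \<sigma> assume "\<sigma> \<in> perms ?k"
    then have \<sigma>: "\<sigma> permutes {..<?k}" by simp
    have "(\<Prod>i<?k. if v ! i = u ! inv \<sigma> i then 1 else 0 :: complex) =
        (\<Prod>i<?k. if v ! \<sigma> i = u ! i then 1 else 0)"
      by (subst prod.permute[OF \<sigma>]) (simp add: o_def permutes_inverses(2)[OF \<sigma>])
    then show "complex_of_real (q ^ inversions ?k (inv \<sigma>)) *
        (\<Prod>i<?k. if v ! i = u ! inv \<sigma> i then 1 else 0) =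
        complex_of_real (q ^ inversions ?k \<sigma>) * (\<Prod>i<?k. if u ! i = v ! \<sigma> i then 1 else 0)"
      by (simp add: inversions_inv[OF \<sigma>] eq_commute)
  qed
  finally show ?thesis .
qed (simp add: q_gram_neq)

lemma q_gram_real: "cnj (q_gram q u v) = q_gram q u v"
proof (cases "length u = length v")
  case True
  have "cnj (if b then 1 else 0) = (if b then 1 else 0)" for b by simp
  with True show ?thesis by (simp add: q_gram_permute_word[OF True refl])
qed (simp add: q_gram_neq)

text \<open>
  Averaging the defining sum over all simultaneous rearrangements of the two words turns it
  into a value of the positive definite kernel on sets of inversions.
\<close>

lemma q_block_average:
  fixes x y :: "'n::finite list \<Rightarrow> complex"
  shows
  "fact k * block_ip (q_fock q) k x y =
    (\<Sum>v\<in>words k. \<Sum>\<rho>\<in>perms k. \<Sum>\<tau>\<in>perms k.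
      of_real (q ^ card (sym_diff (inversion_set k \<rho>) (inversion_set k \<tau>))) *
      x (permute_word \<rho> v) * cnj (y (permute_word \<tau> v)))"
proof -
  let ?b = "block_ip (q_fock q) k x y"
  let ?t = "\<lambda>v \<rho> \<tau>. complex_of_real (q ^ card (sym_diff (inversion_set k \<rho>) (inversion_set k \<tau>))) *
      x (permute_word \<rho> v) * cnj (y (permute_word \<tau> v))"
  let ?i = "\<lambda>u v \<sigma>. if u = permute_word \<sigma> v
        then complex_of_real (q ^ inversions k \<sigma>) * x (permute_word \<sigma> v) * cnj (y v) else 0"
  let ?r = "\<lambda>\<tau> \<rho> v. complex_of_real (q ^ inversions k (inv \<tau> \<circ> \<rho>)) * x (permute_word \<rho> v) * cnj (y (permute_word \<tau> v))"
  have b: "?b = (\<Sum>\<sigma>\<in>perms k. \<Sum>v\<in>words k.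
      of_real (q ^ inversions k \<sigma>) * x (permute_word \<sigma> v) * cnj (y v))"
  proof -
    have "?b = (\<Sum>u\<in>words k. \<Sum>v\<in>words k. \<Sum>\<sigma>\<in>perms k. ?i u v \<sigma>)"
      unfolding block_ip_def deg_q_fock
    proof (intro sum.cong refl)
      fix u v :: "'n list" assume "u \<in> words k" "v \<in> words k"
      then have "length u = k" "length v = k" by simp_all
      then show "x u * cnj (y v) * q_gram q u v = (\<Sum>\<sigma>\<in>perms k. ?i u v \<sigma>)"
        by (simp only: q_gram_permute_word sum_distrib_left) (rule sum.cong, simp_all)
    qed
    also have "\<dots> = (\<Sum>v\<in>words k. \<Sum>u\<in>words k. \<Sum>\<sigma>\<in>perms k. ?i u v \<sigma>)"
      by (rule sum.swap)
    also have "\<dots> = (\<Sum>v\<in>words k. \<Sum>\<sigma>\<in>perms k. \<Sum>u\<in>words k. ?i u v \<sigma>)"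
      by (rule sum.cong[OF refl], rule sum.swap)
    also have "\<dots> = (\<Sum>v\<in>words k. \<Sum>\<sigma>\<in>perms k.
        of_real (q ^ inversions k \<sigma>) * x (permute_word \<sigma> v) * cnj (y v))"
      by (intro sum.cong refl) simp
    also have "\<dots> = (\<Sum>\<sigma>\<in>perms k. \<Sum>v\<in>words k.
        of_real (q ^ inversions k \<sigma>) * x (permute_word \<sigma> v) * cnj (y v))"
      by (rule sum.swap)
    finally show ?thesis .
  qed
  have rearranged: "?b = (\<Sum>\<rho>\<in>perms k. \<Sum>v\<in>words k. ?r \<tau> \<rho> v)"
    if \<tau>: "\<tau> permutes {..<k}" for \<tau>
  proof -
    have "?b = (\<Sum>\<sigma>\<in>perms k. \<Sum>v\<in>words k. of_real (q ^ inversions k \<sigma>) *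
        x (permute_word \<sigma> (permute_word \<tau> v)) * cnj (y (permute_word \<tau> v)))"
      unfolding b by (intro sum.cong refl sum.reindex_bij_betw[OF bij_permute_word[OF \<tau>], symmetric])
    also have "\<dots> = (\<Sum>\<sigma>\<in>perms k. \<Sum>v\<in>words k. of_real (q ^ inversions k (inv \<tau> \<circ> (\<tau> \<circ> \<sigma>))) *
        x (permute_word (\<tau> \<circ> \<sigma>) v) * cnj (y (permute_word \<tau> v)))"
      by (intro sum.cong refl) (auto simp: permute_word_compose o_assoc permutes_inv_o[OF \<tau>])
    also have "\<dots> = (\<Sum>\<rho>\<in>perms k. \<Sum>v\<in>words k. ?r \<tau> \<rho> v)"
      by (rule setum_permutations_compose_left[OF \<tau>, symmetric])
    finally show ?thesis .
  qed
  have "fact k * ?b = (\<Sum>\<tau>\<in>perms k. ?b)"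
    by (simp add: card_permutations)
  also have "\<dots> = (\<Sum>\<tau>\<in>perms k. \<Sum>\<rho>\<in>perms k. \<Sum>v\<in>words k. ?t v \<rho> \<tau>)"
  proof (rule sum.cong[OF refl])
    fix \<tau> assume "\<tau> \<in> perms k"
    then have \<tau>: "\<tau> permutes {..<k}" by simp
    show "?b = (\<Sum>\<rho>\<in>perms k. \<Sum>v\<in>words k. ?t v \<rho> \<tau>)"
      unfolding rearranged[OF \<tau>]
      by (intro sum.cong refl) (auto simp: inversions_eq_card_sym_diff \<tau>)
  qed
  also have "\<dots> = (\<Sum>\<rho>\<in>perms k. \<Sum>\<tau>\<in>perms k. \<Sum>v\<in>words k. ?t v \<rho> \<tau>)"
    by (rule sum.swap)
  also have "\<dots> = (\<Sum>\<rho>\<in>perms k. \<Sum>v\<in>words k. \<Sum>\<tau>\<in>perms k. ?t v \<rho> \<tau>)"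
    by (rule sum.cong[OF refl], rule sum.swap)
  also have "\<dots> = (\<Sum>v\<in>words k. \<Sum>\<rho>\<in>perms k. \<Sum>\<tau>\<in>perms k. ?t v \<rho> \<tau>)"
    by (rule sum.swap)
  finally show ?thesis .
qed

text \<open>
  Distinct permutations have distinct sets of inversions, so the averaged form bounds a positive multiple
  of \<open>\<Sum>v. \<Sum>\<rho>. (cmod (x (permute_word \<rho> v)))\<^sup>2\<close> from above.
\<close>

lemma q_fock_graded_hilbert:
  assumes q: "\<bar>q\<bar> < 1"
  shows "graded_hilbert (q_fock q :: ('n::finite list, nat) gbasis)"
proof
  show "finite {w :: 'n list. deg (q_fock q) w = k}" for k by simp
  show "gram (q_fock q) v u = cnj (gram (q_fock q) u v)" for u v :: "'n list"
    by (simp add: q_gram_real q_gram_sym)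
next
  fix w :: "'n list" and k and x :: "'n list \<Rightarrow> complex"
  assume w: "deg (q_fock q) w = k" "x w \<noteq> 0"
  let ?I = "inversion_set k" and ?P = "perms k"
  let ?E = "{..<k} \<times> {..<k}"
  \<comment> \<open>the values of \<open>x\<close> on the rearrangements of \<open>v\<close>, indexed by sets of inversions and extended by zero\<close>
  define f where "f v A = (if A \<in> ?I ` ?P then x (permute_word (the_inv_into ?P ?I A) v) else 0)" for v A
  have fI: "f v (?I \<rho>) = x (permute_word \<rho> v)" if "\<rho> \<in> ?P" for v \<rho>
    unfolding f_def using that the_inv_into_f_f[OF inversion_set_inj that] by simp
  have sub: "?I ` ?P \<subseteq> Pow ?E" by (auto simp: inversion_set_def)
  have form: "(\<Sum>\<rho>\<in>?P. \<Sum>\<tau>\<in>?P. of_real (q ^ card (sym_diff (?I \<rho>) (?I \<tau>))) *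
      x (permute_word \<rho> v) * cnj (x (permute_word \<tau> v))) = hamming_form q ?E (f v) (f v)" for v
  proof -
    have "hamming_form q ?E (f v) (f v) = (\<Sum>A\<in>?I ` ?P. \<Sum>B\<in>?I ` ?P.
        of_real (q ^ card (sym_diff A B)) * f v A * cnj (f v B))"
      unfolding hamming_form_def
      by (intro sum.mono_neutral_cong_right sub sum.neutral) (auto simp: f_def)
    also have "\<dots> = (\<Sum>\<rho>\<in>?P. \<Sum>\<tau>\<in>?P. of_real (q ^ card (sym_diff (?I \<rho>) (?I \<tau>))) *
        f v (?I \<rho>) * cnj (f v (?I \<tau>)))"
      by (simp add: sum.reindex[OF inversion_set_inj])
    finally show ?thesis by (simp add: fI)
  qed
  have lower: "(1 - \<bar>q\<bar>) ^ card ?E * (\<Sum>A\<in>Pow ?E. (cmod (f v A))\<^sup>2) \<le> Re (hamming_form q ?E (f v) (f v))" for v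
    using q by (intro hamming_form_bound) auto
  have nn: "0 \<le> Re (hamming_form q ?E (f v) (f v))" for v
    using q by (intro order_trans[OF _ lower] mult_nonneg_nonneg sum_nonneg zero_le_power) auto
  have "0 < (\<Sum>A\<in>Pow ?E. (cmod (f w A))\<^sup>2)"
  proof (rule sum_pos2)
    show "?I id \<in> Pow ?E" using sub permutes_id by blast
    show "0 < (cmod (f w (?I id)))\<^sup>2" using fI[of id w] w by (simp add: permutes_id)
  qed auto
  then have "0 < Re (hamming_form q ?E (f w) (f w))"
    using q by (intro less_le_trans[OF _ lower] mult_pos_pos) auto
  also have "\<dots> \<le> (\<Sum>v\<in>words k. Re (hamming_form q ?E (f v) (f v)))"
    using w nn by (intro member_le_sum) auto
  also have "\<dots> = Re (fact k * block_ip (q_fock q) k x x)"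
    unfolding q_block_average form by simp
  also have "\<dots> = fact k * Re (block_ip (q_fock q) k x x)"
  proof -
    have "Re (of_real r * z) = r * Re z" for r z by simp
    from this[of "fact k"] show ?thesis by simp
  qed
  finally show "0 < Re (block_ip (q_fock q) k x x)"
    by (simp add: zero_less_mult_iff)
qed


section \<open>Creation and annihilation operators\<close>

subsection \<open>Recursion for the Gram matrix\<close>

definition skip :: "nat \<Rightarrow> nat \<Rightarrow> nat" where
  "skip s x = (if x < s then x else Suc x)"

lemma skip_less_iff [simp]: "skip s x < skip s y \<longleftrightarrow> x < y"
  by (auto simp: skip_def)

lemma skip_eq_iff [simp]: "skip s x = skip s y \<longleftrightarrow> x = y"
  by (auto simp: skip_def)

lemma skip_neq [simp]: "skip s x \<noteq> s" "s \<noteq> skip s x"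
  by (auto simp: skip_def)

lemma skip_less_self_iff [simp]: "skip s x < s \<longleftrightarrow> x < s"
  by (auto simp: skip_def)

text \<open>
  The permutation of \<open>{..k}\<close> that sends \<open>0\<close> to \<open>s\<close> and orders the remaining points like \<open>\<sigma>\<close>. It
  has \<open>s\<close> more inversions than \<open>\<sigma>\<close>, all of them involving \<open>0\<close>.
\<close>

definition cons_perm :: "nat \<Rightarrow> (nat \<Rightarrow> nat) \<Rightarrow> nat \<Rightarrow> nat" where
  "cons_perm s \<sigma> = (\<lambda>i. case i of 0 \<Rightarrow> s | Suc j \<Rightarrow> skip s (\<sigma> j))"

lemma cons_perm_simps [simp]: "cons_perm s \<sigma> 0 = s" "cons_perm s \<sigma> (Suc j) = skip s (\<sigma> j)"
  by (simp_all add: cons_perm_def)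

lemma cons_perm_permutes:
  assumes \<sigma>: "\<sigma> permutes {..<k}" and s: "s \<le> k"
  shows "cons_perm s \<sigma> permutes {..<Suc k}"
proof (rule bij_imp_permutes)
  have lt: "\<sigma> j < k \<longleftrightarrow> j < k" for j using permutes_in_image[OF \<sigma>, of j] by simp
  have "inj_on (cons_perm s \<sigma>) {..<Suc k}"
  proof (rule inj_onI)
    fix x y assume "cons_perm s \<sigma> x = cons_perm s \<sigma> y"
    then show "x = y"
      using permutes_inj[OF \<sigma>] by (cases x; cases y) (auto simp: inj_eq)
  qed
  moreover have "cons_perm s \<sigma> ` {..<Suc k} \<subseteq> {..<Suc k}"
  proof (rule image_subsetI)
    fix x assume "x \<in> {..<Suc k}"
    show "cons_perm s \<sigma> x \<in> {..<Suc k}"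
    proof (cases x)
      case (Suc j)
      then have "\<sigma> j < k" using \<open>x \<in> {..<Suc k}\<close> lt[of j] by simp
      then show ?thesis by (simp add: Suc skip_def)
    qed (use s in simp)
  qed
  ultimately show "bij_betw (cons_perm s \<sigma>) {..<Suc k} {..<Suc k}"
    unfolding bij_betw_def using endo_inj_surj[OF finite_lessThan] by blast
next
  fix x assume "x \<notin> {..<Suc k}"
  then obtain j where "x = Suc j" "\<not> j < k" by (cases x) auto
  then show "cons_perm s \<sigma> x = x"
    using permutes_not_in[OF \<sigma>, of j] s by (simp add: skip_def)
qed

lemma bij_cons_perm:
  "bij_betw (\<lambda>(s, \<sigma>). cons_perm s \<sigma>) ({..<Suc k} \<times> perms k) (perms (Suc k))"
proof -
  have inj: "inj_on (\<lambda>(s, \<sigma>). cons_perm s \<sigma>) ({..<Suc k} \<times> perms k)"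
  proof (rule inj_onI, clarify)
    fix s \<sigma> t \<tau> assume eq: "cons_perm s \<sigma> = cons_perm t \<tau>"
    then have "s = t" by (metis cons_perm_simps(1))
    moreover have "\<sigma> j = \<tau> j" for j
      using fun_cong[OF eq, of "Suc j"] \<open>s = t\<close> by simp
    ultimately show "s = t \<and> \<sigma> = \<tau>" by auto
  qed
  have "(\<lambda>(s, \<sigma>). cons_perm s \<sigma>) ` ({..<Suc k} \<times> perms k) = perms (Suc k)"
  proof (rule card_subset_eq)
    show "(\<lambda>(s, \<sigma>). cons_perm s \<sigma>) ` ({..<Suc k} \<times> perms k) \<subseteq> perms (Suc k)"
      by (auto intro!: cons_perm_permutes)
    show "card ((\<lambda>(s, \<sigma>). cons_perm s \<sigma>) ` ({..<Suc k} \<times> perms k)) = card (perms (Suc k))"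
      by (simp add: card_image[OF inj] card_cartesian_product card_permutations del: lessThan_Suc)
  qed simp
  with inj show ?thesis by (simp add: bij_betw_def)
qed

lemma inversions_cons_perm:
  assumes \<sigma>: "\<sigma> permutes {..<k}" and s: "s \<le> k"
  shows "inversions (Suc k) (cons_perm s \<sigma>) = s + inversions k \<sigma>"
proof -
  let ?A = "(\<lambda>x. (0 :: nat, Suc (inv \<sigma> x))) ` {..<s}"
  let ?I = "{(i, j). i < j \<and> j < k \<and> \<sigma> i > \<sigma> j}"
  let ?B = "(\<lambda>(i, j). (Suc i, Suc j)) ` ?I"
  have inv_lt: "inv \<sigma> x < k" if "x < s" for x
    using permutes_in_image[OF permutes_inv[OF \<sigma>], of x] that s by simp
  have "{(i, j). i < j \<and> j < Suc k \<and> cons_perm s \<sigma> i > cons_perm s \<sigma> j} = ?A \<union> ?B"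
  proof (intro equalityI subsetI)
    fix x assume "x \<in> {(i, j). i < j \<and> j < Suc k \<and> cons_perm s \<sigma> i > cons_perm s \<sigma> j}"
    then obtain i j where x: "x = (i, Suc j)" "i < Suc j" "j < k"
      "cons_perm s \<sigma> i > cons_perm s \<sigma> (Suc j)"
      by (auto simp: less_Suc_eq_0_disj gr0_conv_Suc)
    show "x \<in> ?A \<union> ?B"
    proof (cases i)
      case 0
      then have "\<sigma> j \<in> {..<s}" "x = (0, Suc (inv \<sigma> (\<sigma> j)))"
        using x by (auto simp: permutes_inverses[OF \<sigma>])
      then show ?thesis by blast
    next
      case (Suc i')
      then show ?thesis using x by force
    qed
  next
    fix x assume "x \<in> ?A \<union> ?B"
    then show "x \<in> {(i, j). i < j \<and> j < Suc k \<and> cons_perm s \<sigma> i > cons_perm s \<sigma> j}"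
      using inv_lt by (auto simp: permutes_inverses[OF \<sigma>])
  qed
  moreover have "card (?A \<union> ?B) = card ?A + card ?B"
  proof (rule card_Un_disjoint)
    have "finite ?I" by (rule finite_subset[of _ "{..<k} \<times> {..<k}"]) auto
    then show "finite ?B" by simp
  qed auto
  moreover have "card ?A = s"
    using permutes_inj[OF permutes_inv[OF \<sigma>]] by (subst card_image) (auto simp: inj_on_def)
  moreover have "card ?B = card ?I"
    by (rule card_image) (auto simp: inj_on_def)
  ultimately show ?thesis by (simp add: inversions_def)
qed

definition insert_at :: "nat \<Rightarrow> 'n \<Rightarrow> 'n list \<Rightarrow> 'n list" where
  "insert_at s i w = take s w @ i # drop s w"

definition delete_at :: "nat \<Rightarrow> 'n list \<Rightarrow> 'n list" where
  "delete_at s w = take s w @ drop (Suc s) w"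

lemma length_insert_at [simp]: "length (insert_at s i w) = Suc (length w)"
  by (simp add: insert_at_def)

lemma length_delete_at [simp]: "s < length w \<Longrightarrow> length (delete_at s w) = length w - 1"
  by (simp add: delete_at_def)

lemma insert_at_delete_at: "s < length w \<Longrightarrow> insert_at s (w ! s) (delete_at s w) = w"
  by (simp add: insert_at_def delete_at_def id_take_nth_drop[symmetric] min_def)

lemma delete_at_insert_at: "s \<le> length w \<Longrightarrow> delete_at s (insert_at s i w) = w"
  by (simp add: insert_at_def delete_at_def min_def)

lemma nth_insert_at: "s \<le> length w \<Longrightarrow> insert_at s i w ! s = i"
  by (simp add: insert_at_def nth_append min_def)

lemma nth_delete_at: "s < length w \<Longrightarrow> x < length w - 1 \<Longrightarrow> delete_at s w ! x = w ! skip s x"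
  by (auto simp: delete_at_def skip_def nth_append min_def)

text \<open>
  Permutations are sorted by the position in \<open>u\<close> that is matched with the first letter; this is where the
  formula for the annihilation operator comes from.
\<close>

lemma q_gram_Cons:
  assumes "length u = Suc (length v)"
  shows "q_gram q (i # v) u = (\<Sum>s<length u. of_real (q ^ s) *
    (if u ! s = i then q_gram q v (delete_at s u) else 0))"
proof -
  let ?k = "length v"
  let ?t = "\<lambda>s \<sigma>. complex_of_real (q ^ (s + inversions ?k \<sigma>)) *
      ((if i = u ! s then 1 else 0) * (\<Prod>j<?k. if v ! j = u ! skip s (\<sigma> j) then 1 else 0))"
  have "q_gram q (i # v) u = (\<Sum>\<rho>\<in>perms (Suc ?k). of_real (q ^ inversions (Suc ?k) \<rho>) *
      (\<Prod>j<Suc ?k. if (i # v) ! j = u ! \<rho> j then 1 else 0))"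
    using assms by (intro q_gram_eq) auto
  also have "\<dots> = (\<Sum>(s, \<sigma>)\<in>{..<Suc ?k} \<times> perms ?k.
      of_real (q ^ inversions (Suc ?k) (cons_perm s \<sigma>)) *
      (\<Prod>j<Suc ?k. if (i # v) ! j = u ! cons_perm s \<sigma> j then 1 else 0))"
    by (subst sum.reindex_bij_betw[OF bij_cons_perm, symmetric]) (simp add: case_prod_beta)
  also have "\<dots> = (\<Sum>(s, \<sigma>)\<in>{..<Suc ?k} \<times> perms ?k. ?t s \<sigma>)"
    unfolding prod.lessThan_Suc_shift
    by (intro sum.cong refl) (auto simp: inversions_cons_perm less_Suc_eq_le)
  also have "\<dots> = (\<Sum>s<Suc ?k. \<Sum>\<sigma>\<in>perms ?k. ?t s \<sigma>)"
    by (rule sum.cartesian_product[symmetric])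
  also have "\<dots> = (\<Sum>s<length u. of_real (q ^ s) *
      (if u ! s = i then q_gram q v (delete_at s u) else 0))"
    unfolding assms
  proof (rule sum.cong[OF refl])
    fix s assume "s \<in> {..<Suc ?k}"
    then have s: "s < length u" using assms by simp
    have "(\<Prod>j<?k. if v ! j = u ! skip s (\<sigma> j) then 1 else 0 :: complex) =
        (\<Prod>j<?k. if v ! j = delete_at s u ! \<sigma> j then 1 else 0)" if "\<sigma> \<in> perms ?k" for \<sigma>
    proof (intro prod.cong refl)
      fix j assume "j \<in> {..<?k}"
      then have "\<sigma> j < ?k" using permutes_in_image[of \<sigma> "{..<?k}" j] that by simp
      then show "(if v ! j = u ! skip s (\<sigma> j) then 1 else 0 :: complex) =
          (if v ! j = delete_at s u ! \<sigma> j then 1 else 0)"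
        using s assms by (simp add: nth_delete_at)
    qed
    then have "(\<Sum>\<sigma>\<in>perms ?k. ?t s \<sigma>) = (\<Sum>\<sigma>\<in>perms ?k. of_real (q ^ s) *
        (if u ! s = i then of_real (q ^ inversions ?k \<sigma>) *
          (\<Prod>j<?k. if v ! j = delete_at s u ! \<sigma> j then 1 else 0) else 0))"
      by (intro sum.cong refl) (simp add: power_add mult.assoc)
    then show "(\<Sum>\<sigma>\<in>perms ?k. ?t s \<sigma>) =
        of_real (q ^ s) * (if u ! s = i then q_gram q v (delete_at s u) else 0)"
      using s assms by (simp add: q_gram_eq sum_distrib_left)
  qed
  finally show ?thesis .
qed


subsection \<open>Left and right operators on coefficient functions\<close>

text \<open>
  All coefficient functions of degree \<open>k\<close> form a finite-dimensional space, so these operators make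
  sense on every coefficient function, whether or not it belongs to the completion. The
  annihilation operators are defined by peeling off the first letter; their explicit
  form as a sum over the positions of an inserted letter is \<open>annih_eq_sum\<close> below. The letter
  inserted at position \<open>s\<close> of a word of length \<open>k\<close> carries the weight \<open>q ^ s\<close> for the left and
  \<open>q ^ (k - s)\<close> for the right annihilation operator.
\<close>

definition contract :: "real^'n \<Rightarrow> ('n::finite list \<Rightarrow> complex) \<Rightarrow> 'n list \<Rightarrow> complex" where
  "contract h x w = (\<Sum>i\<in>UNIV. of_real (h $ i) * x (i # w))"

definition create :: "real^'n \<Rightarrow> ('n::finite list \<Rightarrow> complex) \<Rightarrow> 'n list \<Rightarrow> complex" where
  "create h x w = (case w of [] \<Rightarrow> 0 | j # w' \<Rightarrow> of_real (h $ j) * x w')"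

fun annih :: "real \<Rightarrow> real^'n \<Rightarrow> ('n::finite list \<Rightarrow> complex) \<Rightarrow> 'n list \<Rightarrow> complex" where
  "annih q h x [] = contract h x []"
| "annih q h x (j # w) = contract h x (j # w) + of_real q * annih q h (\<lambda>v. x (j # v)) w"

fun rcreate :: "real^'n \<Rightarrow> ('n::finite list \<Rightarrow> complex) \<Rightarrow> 'n list \<Rightarrow> complex" where
  "rcreate h x [] = 0"
| "rcreate h x [j] = of_real (h $ j) * x []"
| "rcreate h x (j # i # w) = rcreate h (\<lambda>v. x (j # v)) (i # w)"

fun rannih :: "real \<Rightarrow> real^'n \<Rightarrow> ('n::finite list \<Rightarrow> complex) \<Rightarrow> 'n list \<Rightarrow> complex" where
  "rannih q h x [] = contract h x []"
| "rannih q h x (j # w) =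
     of_real (q ^ Suc (length w)) * contract h x (j # w) + rannih q h (\<lambda>v. x (j # v)) w"

definition qpow :: "real \<Rightarrow> ('n list \<Rightarrow> complex) \<Rightarrow> 'n list \<Rightarrow> complex" where
  "qpow q x w = of_real (q ^ length w) * x w"

lemma contract_lincomb:
  "contract h (\<lambda>w. c * x w + y w) = (\<lambda>w. c * contract h x w + contract h y w)"
  by (simp add: contract_def fun_eq_iff algebra_simps sum.distrib sum_distrib_left)

lemma create_lincomb:
  "create h (\<lambda>w. c * x w + y w) = (\<lambda>w. c * create h x w + create h y w)"
  by (auto simp: create_def fun_eq_iff algebra_simps split: list.split)

lemma annih_lincomb:
  "annih q h (\<lambda>w. c * x w + y w) = (\<lambda>w. c * annih q h x w + annih q h y w)"
proof
  fix w
  show "annih q h (\<lambda>w. c * x w + y w) w = c * annih q h x w + annih q h y w"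
    by (induction w arbitrary: x y)
      (simp_all add: contract_lincomb distrib_left mult.left_commute add.assoc add.left_commute)
qed

lemma rcreate_lincomb:
  "rcreate h (\<lambda>w. c * x w + y w) = (\<lambda>w. c * rcreate h x w + rcreate h y w)"
proof
  fix w
  show "rcreate h (\<lambda>w. c * x w + y w) w = c * rcreate h x w + rcreate h y w"
    by (induction h x w arbitrary: y rule: rcreate.induct) (simp_all add: algebra_simps)
qed

lemma rannih_lincomb:
  "rannih q h (\<lambda>w. c * x w + y w) = (\<lambda>w. c * rannih q h x w + rannih q h y w)"
proof
  fix w
  show "rannih q h (\<lambda>w. c * x w + y w) w = c * rannih q h x w + rannih q h y w"
    by (induction w arbitrary: x y)
      (simp_all add: contract_lincomb distrib_left mult.left_commute add.assoc add.left_commute)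
qed

lemma contract_zero [simp]: "contract h (\<lambda>_. 0) = (\<lambda>_. 0)"
  by (simp add: contract_def fun_eq_iff)

lemma create_zero [simp]: "create h (\<lambda>_. 0) = (\<lambda>_. 0)"
  using create_lincomb[of h 0 "\<lambda>_. 0" "\<lambda>_. 0"] by (auto simp: create_def split: list.split)

lemma annih_zero [simp]: "annih q h (\<lambda>_. 0) = (\<lambda>_. 0)"
  using annih_lincomb[of q h "-1" "\<lambda>_. 0" "\<lambda>_. 0"] by simp

lemma rcreate_zero [simp]: "rcreate h (\<lambda>_. 0) = (\<lambda>_. 0)"
  using rcreate_lincomb[of h "-1" "\<lambda>_. 0" "\<lambda>_. 0"] by simp

lemma rannih_zero [simp]: "rannih q h (\<lambda>_. 0) = (\<lambda>_. 0)"
  using rannih_lincomb[of q h "-1" "\<lambda>_. 0" "\<lambda>_. 0"] by simp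

lemma annih_sum:
  "annih q h (\<lambda>w. \<Sum>a\<in>A. c a * f a w) = (\<lambda>w. \<Sum>a\<in>A. c a * annih q h (f a) w)"
  by (induction A rule: infinite_finite_induct) (simp_all add: annih_lincomb)

lemma rcreate_sum:
  "rcreate h (\<lambda>w. \<Sum>a\<in>A. c a * f a w) = (\<lambda>w. \<Sum>a\<in>A. c a * rcreate h (f a) w)"
  by (induction A rule: infinite_finite_induct) (simp_all add: rcreate_lincomb)

lemma rannih_sum:
  "rannih q h (\<lambda>w. \<Sum>a\<in>A. c a * f a w) = (\<lambda>w. \<Sum>a\<in>A. c a * rannih q h (f a) w)"
  by (induction A rule: infinite_finite_induct) (simp_all add: rannih_lincomb)

lemma annih_contract: "annih q h (contract g x) w = (\<Sum>a\<in>UNIV. of_real (g $ a) * annih q h (\<lambda>v. x (a # v)) w)"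
  using annih_sum[of q h "\<lambda>a. of_real (g $ a)" "\<lambda>a v. x (a # v)" UNIV]
  by (simp add: contract_def[abs_def])

lemma rannih_contract: "rannih q h (contract g x) w = (\<Sum>a\<in>UNIV. of_real (g $ a) * rannih q h (\<lambda>v. x (a # v)) w)"
  using rannih_sum[of q h "\<lambda>a. of_real (g $ a)" "\<lambda>a v. x (a # v)" UNIV]
  by (simp add: contract_def[abs_def])

lemma annih_cong:
  "(\<And>v. length v = Suc (length w) \<Longrightarrow> x v = y v) \<Longrightarrow> annih q h x w = annih q h y w"
proof (induction w arbitrary: x y)
  case Nil
  then show ?case by (simp add: contract_def)
next
  case (Cons j w)
  have "annih q h (\<lambda>v. x (j # v)) w = annih q h (\<lambda>v. y (j # v)) w"
    by (rule Cons.IH) (simp add: Cons.prems)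
  then show ?case by (simp add: contract_def Cons.prems)
qed

lemma rannih_cong:
  "(\<And>v. length v = Suc (length w) \<Longrightarrow> x v = y v) \<Longrightarrow> rannih q h x w = rannih q h y w"
proof (induction w arbitrary: x y)
  case Nil
  then show ?case by (simp add: contract_def)
next
  case (Cons j w)
  have "rannih q h (\<lambda>v. x (j # v)) w = rannih q h (\<lambda>v. y (j # v)) w"
    by (rule Cons.IH) (simp add: Cons.prems)
  then show ?case by (simp add: contract_def Cons.prems)
qed

lemma annih_qpow: "annih q h (qpow r x) w = of_real (r ^ Suc (length w)) * annih q h x w"
proof -
  have "annih q h (qpow r x) w = annih q h (\<lambda>v. of_real (r ^ Suc (length w)) * x v + 0) w"
    by (rule annih_cong) (simp add: qpow_def)
  then show ?thesis by (subst (asm) annih_lincomb) simp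
qed

subsection \<open>Commutation relations\<close>

lemma inner_sum: "(\<Sum>i\<in>UNIV. complex_of_real (g $ i) * (of_real (h $ i) * z)) = of_real (g \<bullet> h) * z"
  by (simp add: inner_vec_def sum_distrib_right mult.assoc)

text \<open>
  The q-commutation relation. Inserting a letter in front contributes the inner product, and inserting
  it anywhere else moves it past the first letter, at the cost of a factor \<open>q\<close>.
\<close>

lemma annih_create:
  "annih q g (create h x) w = of_real q * create h (annih q g x) w + of_real (g \<bullet> h) * x w"
proof (cases w)
  case Nil
  then show ?thesis by (simp add: contract_def create_def inner_sum)
next
  case (Cons j w')
  have "annih q g (\<lambda>v. of_real (h $ j) * x v) w' = of_real (h $ j) * annih q g x w'"
    using annih_lincomb[of q g "of_real (h $ j)" x "\<lambda>_. 0"] by simp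
  with Cons show ?thesis by (simp add: contract_def create_def inner_sum)
qed

text \<open>
  Mixed left and right operators commute up to the one term in which the inserted letter meets the
  added one at the opposite end of the word; it has to pass the whole word, which gives \<open>q ^ length\<close>.
\<close>

lemma rannih_create:
  "rannih q g (create h x) w = create h (rannih q g x) w + of_real (g \<bullet> h) * qpow q x w"
proof (cases w)
  case Nil
  then show ?thesis by (simp add: contract_def create_def inner_sum qpow_def)
next
  case (Cons j w')
  have "rannih q g (\<lambda>v. of_real (h $ j) * x v) w' = of_real (h $ j) * rannih q g x w'"
    using rannih_lincomb[of q g "of_real (h $ j)" x "\<lambda>_. 0"] by simp
  with Cons show ?thesis by (simp add: contract_def create_def inner_sum qpow_def)
qed

lemma create_rcreate: "create h (rcreate g x) w = rcreate g (create h x) w"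
proof (cases w)
  case (Cons j w')
  have "rcreate g (\<lambda>v. of_real (h $ j) * x v) v = of_real (h $ j) * rcreate g x v" for v
    using rcreate_lincomb[of g "of_real (h $ j)" x "\<lambda>_. 0"] by simp
  with Cons show ?thesis by (cases w') (simp_all add: create_def)
qed (simp add: create_def)

lemma annih_rcreate:
  "annih q g (rcreate h x) w = rcreate h (annih q g x) w + of_real (g \<bullet> h) * qpow q x w"
proof (induction w arbitrary: x)
  case Nil
  show ?case by (simp add: contract_def inner_sum qpow_def)
next
  case (Cons j w)
  show ?case
  proof (cases w)
    case Nil
    have "(\<Sum>a\<in>UNIV. complex_of_real (g $ a) * (of_real (h $ j) * x [a])) =
        of_real (h $ j) * (\<Sum>a\<in>UNIV. of_real (g $ a) * x [a])"
      by (simp add: sum_distrib_left mult.left_commute)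
    then show ?thesis
      using Nil by (simp add: contract_def qpow_def inner_sum)
  next
    case (Cons i w')
    let ?x = "\<lambda>v. x (j # v)"
    have 1: "annih q g (\<lambda>v. rcreate h x (j # v)) w = annih q g (rcreate h ?x) w"
      by (rule annih_cong) (auto simp: length_Suc_conv)
    have 2: "contract g (rcreate h x) (j # w) = rcreate h (\<lambda>v. contract g x (j # v)) w"
    proof -
      have "rcreate h (\<lambda>v. contract g x (j # v)) w =
          (\<Sum>a\<in>UNIV. of_real (g $ a) * rcreate h (\<lambda>v. x (a # j # v)) w)"
        unfolding contract_def rcreate_sum by simp
      then show ?thesis using Cons by (simp add: contract_def)
    qed
    have 3: "rcreate h (annih q g x) (j # w) =
        of_real q * rcreate h (annih q g ?x) w + rcreate h (\<lambda>v. contract g x (j # v)) w"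
    proof -
      have "rcreate h (annih q g x) (j # w) = rcreate h (\<lambda>v. annih q g x (j # v)) w"
        using Cons by simp
      also have "(\<lambda>v. annih q g x (j # v)) =
          (\<lambda>v. of_real q * annih q g ?x v + contract g x (j # v))"
        by (simp add: fun_eq_iff)
      finally show ?thesis by (simp only: rcreate_lincomb)
    qed
    have "annih q g (rcreate h x) (j # w) =
        contract g (rcreate h x) (j # w) + of_real q * annih q g (\<lambda>v. rcreate h x (j # v)) w"
      by simp
    also have "\<dots> = rcreate h (annih q g x) (j # w) + of_real (g \<bullet> h) * qpow q x (j # w)"
      unfolding 1 2 3 Cons.IH by (simp add: qpow_def algebra_simps)
    finally show ?thesis .
  qed
qed

text \<open>
  The left and the right annihilation operators commute because the order in which two letters
  are inserted into a word does not matter.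
\<close>

lemma annih_rannih: "annih q h (rannih q g x) w = rannih q g (annih q h x) w"
proof (induction w arbitrary: x)
  case Nil
  have swap: "(\<Sum>i\<in>UNIV. \<Sum>j\<in>UNIV. c i j) = (\<Sum>j\<in>UNIV. \<Sum>i\<in>UNIV. c i j)" for c :: "'n \<Rightarrow> 'n \<Rightarrow> complex"
    by (rule sum.swap)
  show ?case
    using swap[of "\<lambda>i j. of_real q * (of_real (g $ j) * (of_real (h $ i) * x [j, i]))"]
      swap[of "\<lambda>i j. of_real (g $ j) * (of_real (h $ i) * x [i, j])"]
    by (simp add: contract_def sum_distrib_left sum.distrib distrib_left mult_ac)
next
  case (Cons j w)
  let ?x = "\<lambda>v. x (j # v)"
  let ?m = "Suc (length w)"
  have l1: "annih q h (\<lambda>v. rannih q g x (j # v)) w =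
      of_real (q ^ ?m) * of_real q * annih q h (\<lambda>v. contract g x (j # v)) w
      + annih q h (rannih q g ?x) w"
  proof -
    have "(\<lambda>v. rannih q g x (j # v)) =
        (\<lambda>v. of_real q * qpow q (\<lambda>v. contract g x (j # v)) v + rannih q g ?x v)"
      by (simp add: fun_eq_iff qpow_def)
    then show ?thesis by (simp add: annih_lincomb annih_qpow)
  qed
  have l2: "rannih q g (\<lambda>v. annih q h x (j # v)) w =
      rannih q g (\<lambda>v. contract h x (j # v)) w + of_real q * rannih q g (annih q h ?x) w"
  proof -
    have "(\<lambda>v. annih q h x (j # v)) = (\<lambda>v. of_real q * annih q h ?x v + contract h x (j # v))"
      by (simp add: fun_eq_iff)
    then show ?thesis by (simp add: rannih_lincomb)
  qed
  have c1: "contract h (rannih q g x) (j # w) =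
      of_real (q ^ ?m) * of_real q * contract h (contract g x) (j # w)
      + rannih q g (contract h x) (j # w)"
    unfolding rannih_contract
    by (simp add: contract_def sum.distrib sum_distrib_left algebra_simps)
  have c2: "contract g (annih q h x) (j # w) =
      contract g (contract h x) (j # w) + of_real q * annih q h (contract g x) (j # w)"
    unfolding annih_contract
    by (simp add: contract_def sum.distrib sum_distrib_left algebra_simps)
  have "annih q h (rannih q g x) (j # w) =
      contract h (rannih q g x) (j # w) + of_real q * annih q h (\<lambda>v. rannih q g x (j # v)) w"
    by simp
  also have "\<dots> = of_real (q ^ ?m) * contract g (annih q h x) (j # w)
      + rannih q g (\<lambda>v. annih q h x (j # v)) w"
    unfolding l1 l2 c1 c2 Cons.IH by (simp add: algebra_simps)
  also have "\<dots> = rannih q g (annih q h x) (j # w)" by simp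
  finally show ?case .
qed


subsection \<open>Adjoints\<close>

definition q_pairing :: "real \<Rightarrow> 'n::finite list \<Rightarrow> ('n list \<Rightarrow> complex) \<Rightarrow> complex" where
  "q_pairing q v y = (\<Sum>u\<in>words (length v). q_gram q v u * y u)"

lemma q_pairing_Nil: "q_pairing q [] y = y []"
proof -
  have "{(i, j). i < j \<and> j < (0::nat) \<and> i > j} = {}" by auto
  then show ?thesis by (simp add: q_pairing_def q_gram_eq[where k = 0] inversions_def)
qed

lemma q_pairing_sum: "q_pairing q v (\<lambda>w. \<Sum>a\<in>A. c a * f a w) = (\<Sum>a\<in>A. c a * q_pairing q v (f a))"
  unfolding q_pairing_def by (simp add: sum_distrib_left mult.left_commute) (rule sum.swap)

lemma block_eq_q_pairing:
  "block_ip (q_fock q) k x y = (\<Sum>v\<in>words k. x v * cnj (q_pairing q v y))"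
  by (simp add: block_ip_def q_pairing_def q_gram_real sum_distrib_left mult_ac)

lemma insert_at_0 [simp]: "insert_at 0 i w = i # w"
  by (simp add: insert_at_def)

lemma insert_at_Suc [simp]: "insert_at (Suc s) i (j # w) = j # insert_at s i w"
  by (simp add: insert_at_def)

lemma annih_eq_sum:
  "annih q h x w = (\<Sum>s\<le>length w. of_real (q ^ s) * (\<Sum>i\<in>UNIV. of_real (h $ i) * x (insert_at s i w)))"
proof (induction w arbitrary: x)
  case (Cons j w)
  show ?case
    by (simp add: Cons.IH contract_def sum.atMost_Suc_shift sum_distrib_left mult.assoc
        del: sum.atMost_Suc)
qed (simp add: contract_def)

lemma contract_axis: "contract (axis i 1) x w = x (i # w)"
proof -
  have "contract (axis i 1) x w = (\<Sum>a\<in>UNIV. if a = i then x (i # w) else 0)"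
    unfolding contract_def by (rule sum.cong) (auto simp: axis_def)
  then show ?thesis by simp
qed

lemma annih_axis: "annih q (axis i 1) x w = (\<Sum>s\<le>length w. of_real (q ^ s) * x (insert_at s i w))"
proof -
  have "(\<Sum>a\<in>UNIV. complex_of_real (axis i 1 $ a) * f a) = f i" for f
  proof -
    have "(\<Sum>a\<in>UNIV. complex_of_real (axis i 1 $ a) * f a) = (\<Sum>a\<in>UNIV. if a = i then f i else 0)"
      by (rule sum.cong) (auto simp: axis_def)
    then show ?thesis by simp
  qed
  then show ?thesis by (simp add: annih_eq_sum)
qed

lemma annih_eq_sum_axis: "annih q h x = (\<lambda>w. \<Sum>i\<in>UNIV. of_real (h $ i) * annih q (axis i 1) x w)"
proof
  fix w
  show "annih q h x w = (\<Sum>i\<in>UNIV. of_real (h $ i) * annih q (axis i 1) x w)"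
  proof (induction w arbitrary: x)
    case (Cons j w)
    show ?case
      by (simp add: Cons.IH contract_axis distrib_left sum.distrib sum_distrib_left mult.left_commute)
        (simp add: contract_def)
  qed (simp add: contract_axis, simp add: contract_def)
qed

lemma rannih_eq_sum_axis: "rannih q h x = (\<lambda>w. \<Sum>i\<in>UNIV. of_real (h $ i) * rannih q (axis i 1) x w)"
proof
  fix w
  show "rannih q h x w = (\<Sum>i\<in>UNIV. of_real (h $ i) * rannih q (axis i 1) x w)"
  proof (induction w arbitrary: x)
    case (Cons j w)
    show ?case
      by (simp add: Cons.IH contract_axis distrib_left sum.distrib mult.left_commute)
        (simp add: contract_def sum_distrib_left mult.left_commute)
  qed (simp add: contract_axis, simp add: contract_def)
qed

lemma q_pairing_Cons: "q_pairing q (i # v) y = q_pairing q v (annih q (axis i 1) y)"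
proof -
  let ?k = "length v"
  let ?d = "\<lambda>s u. complex_of_real (q ^ s) * (if u ! s = i then q_gram q v (delete_at s u) * y u else 0)"
  let ?e = "\<lambda>s u. complex_of_real (q ^ s) * (q_gram q v u * y (insert_at s i u))"
  have "q_pairing q (i # v) y = (\<Sum>u\<in>words (Suc ?k). \<Sum>s<Suc ?k. ?d s u)"
    unfolding q_pairing_def length_Cons
  proof (rule sum.cong[OF refl])
    fix u :: "'a list" assume "u \<in> words (Suc ?k)"
    then have u: "length u = Suc ?k" by simp
    show "q_gram q (i # v) u * y u = (\<Sum>s<Suc ?k. ?d s u)"
      unfolding q_gram_Cons[OF u] sum_distrib_right u by (intro sum.cong refl) simp
  qed
  also have "\<dots> = (\<Sum>s<Suc ?k. \<Sum>u\<in>words (Suc ?k). ?d s u)"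
    by (rule sum.swap)
  also have "\<dots> = (\<Sum>s<Suc ?k. \<Sum>u\<in>words ?k. ?e s u)"
  proof (rule sum.cong[OF refl])
    fix s assume "s \<in> {..<Suc ?k}"
    then have s: "s < Suc ?k" by simp
    have "(\<Sum>u\<in>words (Suc ?k). ?d s u) = (\<Sum>u\<in>{u \<in> words (Suc ?k). u ! s = i}. of_real (q ^ s) * (q_gram q v (delete_at s u) * y u))"
      by (rule sum.mono_neutral_cong_right) auto
    also have "\<dots> = (\<Sum>u\<in>words ?k. ?e s u)"
      by (rule sum.reindex_bij_witness[of _ "insert_at s i" "delete_at s"])
        (use s in \<open>auto simp: insert_at_delete_at delete_at_insert_at nth_insert_at\<close>)
    finally show "(\<Sum>u\<in>words (Suc ?k). ?d s u) = (\<Sum>u\<in>words ?k. ?e s u)" .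
  qed
  also have "\<dots> = (\<Sum>u\<in>words ?k. \<Sum>s<Suc ?k. ?e s u)"
    by (rule sum.swap)
  also have "\<dots> = q_pairing q v (annih q (axis i 1) y)"
    unfolding q_pairing_def
    by (intro sum.cong) (auto simp: annih_axis sum_distrib_left mult.left_commute lessThan_Suc_atMost)
  finally show ?thesis .
qed

text \<open>
  The reflected recursion follows from the one at the first letter, since the two kinds of annihilation
  commute.
\<close>

lemma q_pairing_snoc: "q_pairing q (v @ [i]) y = q_pairing q v (rannih q (axis i 1) y)"
proof (induction v arbitrary: y)
  case Nil
  show ?case by (simp add: q_pairing_Cons q_pairing_Nil)
next
  case (Cons j v)
  have "annih q (axis j 1) (rannih q (axis i 1) y) = rannih q (axis i 1) (annih q (axis j 1) y)"
    by (rule ext) (rule annih_rannih)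
  then show ?case by (simp add: q_pairing_Cons Cons.IH)
qed

lemma rcreate_snoc: "rcreate h x (w @ [i]) = of_real (h $ i) * x w"
proof (induction w arbitrary: x)
  case (Cons j w)
  then show ?case by (cases w) simp_all
qed simp

lemma block_create:
  "block_ip (q_fock q) (Suc k) (create h x) y = block_ip (q_fock q) k x (annih q h y)"
proof -
  let ?t = "\<lambda>i v. x v * cnj (of_real (h $ i) * q_pairing q v (annih q (axis i 1) y))"
  have inj: "inj_on (\<lambda>(i, w). i # w) (UNIV \<times> words k)" by (auto simp: inj_on_def)
  have im: "words (Suc k) = (\<lambda>(i, w). i # w) ` (UNIV \<times> words k)"
    by (auto simp: length_Suc_conv)
  have "block_ip (q_fock q) (Suc k) (create h x) y = (\<Sum>(i, v)\<in>UNIV \<times> words k. ?t i v)"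
    unfolding block_eq_q_pairing im sum.reindex[OF inj]
    by (intro sum.cong) (auto simp: create_def q_pairing_Cons)
  also have "\<dots> = (\<Sum>i\<in>UNIV. \<Sum>v\<in>words k. ?t i v)"
    by (rule sum.cartesian_product[symmetric])
  also have "\<dots> = (\<Sum>v\<in>words k. \<Sum>i\<in>UNIV. ?t i v)"
    by (rule sum.swap)
  also have "\<dots> = block_ip (q_fock q) k x (annih q h y)"
    unfolding block_eq_q_pairing annih_eq_sum_axis[of q h] q_pairing_sum
    by (simp add: sum_distrib_left)
  finally show ?thesis .
qed

lemma block_rcreate:
  "block_ip (q_fock q) (Suc k) (rcreate h x) y = block_ip (q_fock q) k x (rannih q h y)"
proof -
  let ?t = "\<lambda>i v. x v * cnj (of_real (h $ i) * q_pairing q v (rannih q (axis i 1) y))"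
  have inj: "inj_on (\<lambda>(i, w). w @ [i]) (UNIV \<times> words k)" by (auto simp: inj_on_def)
  have im: "words (Suc k) = (\<lambda>(i, w). w @ [i]) ` (UNIV \<times> words k)"
    by (auto simp: length_Suc_conv_rev)
  have "block_ip (q_fock q) (Suc k) (rcreate h x) y = (\<Sum>(i, v)\<in>UNIV \<times> words k. ?t i v)"
    unfolding block_eq_q_pairing im sum.reindex[OF inj]
    by (intro sum.cong) (auto simp: rcreate_snoc q_pairing_snoc)
  also have "\<dots> = (\<Sum>i\<in>UNIV. \<Sum>v\<in>words k. ?t i v)"
    by (rule sum.cartesian_product[symmetric])
  also have "\<dots> = (\<Sum>v\<in>words k. \<Sum>i\<in>UNIV. ?t i v)"
    by (rule sum.swap)
  also have "\<dots> = block_ip (q_fock q) k x (rannih q h y)"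
    unfolding block_eq_q_pairing rannih_eq_sum_axis[of q h] q_pairing_sum
    by (simp add: sum_distrib_left)
  finally show ?thesis .
qed

lemma block_0: "block_ip (q_fock q) 0 x y = x [] * cnj (y [])"
  by (simp add: block_eq_q_pairing q_pairing_Nil)

lemma infsum_nat_shift:
  fixes f g :: "nat \<Rightarrow> complex"
  assumes "f 0 = 0" "\<And>k. f (Suc k) = g k"
  shows "(\<Sum>\<^sub>\<infinity>k. f k) = (\<Sum>\<^sub>\<infinity>k. g k)"
proof -
  have "(\<Sum>\<^sub>\<infinity>k. f k) = infsum f (range Suc)"
  proof -
    have "f x = 0" if "x \<notin> range Suc" for x
      using that assms(1) by (cases x) auto
    then show ?thesis by (intro infsum_cong_neutral) auto
  qed
  also have "\<dots> = (\<Sum>\<^sub>\<infinity>k. g k)"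
    by (subst infsum_reindex) (auto simp: assms(2) o_def)
  finally show ?thesis .
qed

text \<open>
  Both sides are sums of the same numbers with degrees shifted by one, so the identities hold for all
  coefficient functions, convergent or not.
\<close>

lemma hip_create: "hip (q_fock q) (create h x) y = hip (q_fock q) x (annih q h y)"
  unfolding hip_def by (rule infsum_nat_shift) (auto simp: block_0 block_create create_def)

lemma hip_rcreate: "hip (q_fock q) (rcreate h x) y = hip (q_fock q) x (rannih q h y)"
  unfolding hip_def by (rule infsum_nat_shift) (auto simp: block_0 block_rcreate)


subsection \<open>The q-semicircular operators\<close>

definition semicircular :: "real \<Rightarrow> real^'n \<Rightarrow> ('n::finite list \<Rightarrow> complex) \<Rightarrow> 'n list \<Rightarrow> complex" where
  "semicircular q h x w = create h x w + annih q h x w"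

locale q_fock_space =
  fixes q :: real and e :: "'n::finite \<Rightarrow> real^'n"
  assumes abs_q: "\<bar>q\<bar> < 1"
begin

abbreviation Fq :: "('n list, nat) gbasis" where
  "Fq \<equiv> q_fock q"

sublocale graded_hilbert Fq
  by (rule q_fock_graded_hilbert[OF abs_q])

abbreviation bound :: "real^'n \<Rightarrow> real" where
  "bound h \<equiv> (h \<bullet> h) / (1 - \<bar>q\<bar>)"

lemma bound_nonneg: "0 \<le> bound h"
  using abs_q by simp

text \<open>
  The norms of creation and annihilation are bounded degree by degree. The estimate for
  annihilation into degree \<open>k\<close> is the adjoint of the one for creation from degree \<open>k\<close>, and the
  q-commutation relation passes from it to creation from degree \<open>k + 1\<close>; the constant
  \<open>c = (h \<bullet> h) / (1 - \<bar>q\<bar>)\<close> reproduces itself because \<open>h \<bullet> h + \<bar>q\<bar> * c = c\<close>.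
\<close>

lemma block_annih_le_aux:
  assumes "\<And>x. sq_norm (Suc k) (create h x) \<le> bound h * sq_norm k x"
  shows "sq_norm k (annih q h x) \<le> bound h * sq_norm (Suc k) x"
proof -
  let ?a = "annih q h x"
  let ?x = "sq_norm k ?a" and ?b = "sq_norm (Suc k) x"
  have "?x\<^sup>2 \<le> (cmod (block_ip Fq (Suc k) (create h ?a) x))\<^sup>2"
    unfolding block_create cmod_power2 by simp
  also have "\<dots> \<le> sq_norm (Suc k) (create h ?a) * ?b"
    by (rule block_cauchy_schwarz)
  also have "\<dots> \<le> bound h * ?x * ?b"
    by (intro mult_right_mono assms block_nonneg)
  finally have *: "?x * ?x \<le> ?x * (bound h * ?b)" by (simp add: power2_eq_square mult_ac)
  show ?thesis
  proof (cases "?x = 0")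
    case True
    then show ?thesis
      using mult_nonneg_nonneg[OF bound_nonneg[of h] block_nonneg[of "Suc k" x]] by simp
  next
    case False
    then have "0 < ?x" using block_nonneg[of k ?a] by linarith
    then show ?thesis using * mult_le_cancel_left_pos by blast
  qed
qed

lemma block_create_le:
  "sq_norm (Suc k) (create h x) \<le> bound h * sq_norm k x"
proof (induction k arbitrary: x)
  have expand: "sq_norm (Suc k) (create h x) =
      q * Re (block_ip Fq k x (create h (annih q h x))) + (h \<bullet> h) * sq_norm k x" for k x
  proof -
    have "annih q h (create h x) =
        (\<lambda>w. of_real q * create h (annih q h x) w + (of_real (h \<bullet> h) * x w))"
      by (rule ext) (rule annih_create)
    then show ?thesis
      by (simp add: block_create block_ip_add_right block_ip_scale_right)
  qed
  have c: "h \<bullet> h + \<bar>q\<bar> * bound h = bound h"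
    using abs_q by (simp add: field_simps)
  {
    case 0
    have "h \<bullet> h \<le> bound h" using c bound_nonneg[of h] by (smt (verit) abs_ge_zero mult_nonneg_nonneg)
    then have "(h \<bullet> h) * sq_norm 0 x \<le> bound h * sq_norm 0 x"
      by (rule mult_right_mono[OF _ block_nonneg])
    then show ?case unfolding expand by (simp add: block_0 create_def)
  next
    case (Suc k)
    have "block_ip Fq (Suc k) x (create h (annih q h x)) =
        cnj (block_ip Fq k (annih q h x) (annih q h x))"
      by (subst block_hermitian) (simp add: block_create)
    then have "sq_norm (Suc (Suc k)) (create h x) =
        q * sq_norm k (annih q h x) + (h \<bullet> h) * sq_norm (Suc k) x"
      unfolding expand by simp
    also have "q * sq_norm k (annih q h x) \<le>
        \<bar>q\<bar> * sq_norm k (annih q h x)"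
      by (rule mult_right_mono[OF _ block_nonneg]) simp
    also have "\<dots> \<le> \<bar>q\<bar> * (bound h * sq_norm (Suc k) x)"
      by (intro mult_left_mono block_annih_le_aux Suc.IH) simp
    also have "\<bar>q\<bar> * (bound h * sq_norm (Suc k) x) + (h \<bullet> h) * sq_norm (Suc k) x
        = (h \<bullet> h + \<bar>q\<bar> * bound h) * sq_norm (Suc k) x"
      by (simp only: distrib_right mult.assoc add.commute)
    finally show ?case unfolding c by simp
  }
qed

lemma block_annih_le:
  "sq_norm k (annih q h x) \<le> bound h * sq_norm (Suc k) x"
  by (rule block_annih_le_aux[OF block_create_le])

lemma bounded_op_from_blocks:
  assumes lin: "\<And>c x y. T (\<lambda>w. c * x w + y w) = (\<lambda>w. c * T x w + T y w)"
    and b: "0 \<le> b"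
    and le: "\<And>x F. x \<in> hcarrier Fq \<Longrightarrow> finite F \<Longrightarrow>
      (\<Sum>k\<in>F. sq_norm k (T x)) \<le> b * Re (hip Fq x x)"
  shows "restrict_op Fq T \<in> bounded_ops Fq" "\<And>x. x \<in> hcarrier Fq \<Longrightarrow> T x \<in> hcarrier Fq"
proof -
  show car: "T x \<in> hcarrier Fq" if "x \<in> hcarrier Fq" for x
    by (rule hcarrierI_bound(1)[OF le[OF that]])
  show "restrict_op Fq T \<in> bounded_ops Fq"
  proof (rule bounded_opsI[where B = "sqrt b"])
    fix x assume x: "x \<in> hcarrier Fq"
    have "Re (hip Fq (T x) (T x)) \<le> b * Re (hip Fq x x)"
      by (rule hcarrierI_bound(2)[OF le[OF x]])
    then show "hnorm Fq (restrict_op Fq T x) \<le> sqrt b * hnorm Fq x"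
      using x by (simp add: restrict_op_def hnorm_def flip: real_sqrt_mult)
  qed (simp_all add: restrict_op_def car lin hcarrier_lincomb)
qed

lemma create_bounded:
  "restrict_op Fq (create h) \<in> bounded_ops Fq" "\<And>x. x \<in> hcarrier Fq \<Longrightarrow> create h x \<in> hcarrier Fq"
proof -
  have "(\<Sum>k\<in>F. sq_norm k (create h x)) \<le> bound h * Re (hip Fq x x)"
    if x: "x \<in> hcarrier Fq" and F: "finite F" for x F
  proof -
    let ?b = "\<lambda>k. sq_norm k (create h x)"
    have "(\<Sum>k\<in>F. ?b k) =
        (\<Sum>k\<in>F - {0}. ?b k)"
      using F by (intro sum.mono_neutral_right) (auto simp: block_0 create_def)
    also have "\<dots> \<le> (\<Sum>k\<in>F - {0}. bound h * sq_norm (k - 1) x)"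
    proof (rule sum_mono)
      fix k assume "k \<in> F - {0}"
      then obtain k' where "k = Suc k'" by (cases k) auto
      then show "?b k \<le> bound h * sq_norm (k - 1) x"
        using block_create_le by simp
    qed
    also have "\<dots> = bound h * (\<Sum>k\<in>(\<lambda>k. k - 1) ` (F - {0}). sq_norm k x)"
      by (subst sum.reindex) (auto simp: inj_on_def sum_distrib_left)
    also have "\<dots> \<le> bound h * Re (hip Fq x x)"
      using F x by (intro mult_left_mono sum_block_le_hip bound_nonneg) auto
    finally show ?thesis .
  qed
  from bounded_op_from_blocks[OF create_lincomb bound_nonneg this]
  show "restrict_op Fq (create h) \<in> bounded_ops Fq" "\<And>x. x \<in> hcarrier Fq \<Longrightarrow> create h x \<in> hcarrier Fq"
    by blast+
qed

lemma annih_bounded: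
  "restrict_op Fq (annih q h) \<in> bounded_ops Fq" "\<And>x. x \<in> hcarrier Fq \<Longrightarrow> annih q h x \<in> hcarrier Fq"
proof -
  have "(\<Sum>k\<in>F. sq_norm k (annih q h x)) \<le> bound h * Re (hip Fq x x)"
    if x: "x \<in> hcarrier Fq" and F: "finite F" for x F
  proof -
    let ?b = "\<lambda>k. sq_norm k (annih q h x)"
    have "(\<Sum>k\<in>F. ?b k) \<le>
        (\<Sum>k\<in>F. bound h * sq_norm (Suc k) x)"
      by (intro sum_mono block_annih_le)
    also have "\<dots> = bound h * (\<Sum>k\<in>Suc ` F. sq_norm k x)"
      by (subst sum.reindex) (auto simp: sum_distrib_left)
    also have "\<dots> \<le> bound h * Re (hip Fq x x)"
      using F x by (intro mult_left_mono sum_block_le_hip bound_nonneg) auto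
    finally show ?thesis .
  qed
  from bounded_op_from_blocks[OF annih_lincomb bound_nonneg this]
  show "restrict_op Fq (annih q h) \<in> bounded_ops Fq" "\<And>x. x \<in> hcarrier Fq \<Longrightarrow> annih q h x \<in> hcarrier Fq"
    by blast+
qed

lemma creation_eq: "creation q (complexify h) = restrict_op Fq (create h)"
  by (auto simp: creation_def complexify_def create_def restrict_op_def fun_eq_iff split: list.split)

lemma adj_creation: "adj_op Fq (creation q (complexify h)) = restrict_op Fq (annih q h)"
  by (rule adj_opI[OF annih_bounded(1)])
    (simp add: creation_eq restrict_op_def hip_create)

lemma q_semicircular_eq: "q_semicircular q h = restrict_op Fq (semicircular q h)"
  unfolding q_semicircular_def adj_creation
  by (auto simp: creation_eq restrict_op_def semicircular_def fun_eq_iff)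

lemma q_semicircular_bounded: "q_semicircular q h \<in> bounded_ops Fq"
  using bounded_ops_lincomb[OF create_bounded(1) annih_bounded(1), of 1]
  unfolding q_semicircular_def adj_creation unfolding creation_eq by simp

lemma semicircular_symmetric:
  assumes "x \<in> hcarrier Fq" "y \<in> hcarrier Fq"
  shows "hip Fq (semicircular q h x) y = hip Fq x (semicircular q h y)"
proof -
  have l: "semicircular q h x = (\<lambda>w. 1 * create h x w + annih q h x w)" for x
    by (simp add: semicircular_def fun_eq_iff)
  have "hip Fq (annih q h x) y = hip Fq x (create h y)"
    by (subst (1 2) hip_hermitian) (simp add: hip_create)
  then show ?thesis
    using assms unfolding l
    by (subst hip_lincomb_left, simp_all add: create_bounded annih_bounded)
      (subst hip_lincomb_right[of _ _ _ 1, simplified], simp_all add: create_bounded annih_bounded hip_create)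
qed

end


subsection \<open>Words in the q-semicircular operators\<close>

definition rsemicircular :: "real \<Rightarrow> real^'n \<Rightarrow> ('n::finite list \<Rightarrow> complex) \<Rightarrow> 'n list \<Rightarrow> complex" where
  "rsemicircular q h x w = rcreate h x w + rannih q h x w"

lemma semicircular_lincomb:
  "semicircular q h (\<lambda>w. c * x w + y w) = (\<lambda>w. c * semicircular q h x w + semicircular q h y w)"
  unfolding semicircular_def create_lincomb annih_lincomb by (simp add: fun_eq_iff algebra_simps)

lemma rsemicircular_lincomb:
  "rsemicircular q h (\<lambda>w. c * x w + y w) = (\<lambda>w. c * rsemicircular q h x w + rsemicircular q h y w)"
  unfolding rsemicircular_def rcreate_lincomb rannih_lincomb by (simp add: fun_eq_iff algebra_simps)

lemma semicircular_zero [simp]: "semicircular q h (\<lambda>_. 0) = (\<lambda>_. 0)"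
  by (simp add: semicircular_def fun_eq_iff)

lemma rsemicircular_zero [simp]: "rsemicircular q h (\<lambda>_. 0) = (\<lambda>_. 0)"
  by (simp add: rsemicircular_def fun_eq_iff)

lemma rsemicircular_sum:
  "rsemicircular q h (\<lambda>w. \<Sum>a\<in>A. c a * f a w) = (\<lambda>w. \<Sum>a\<in>A. c a * rsemicircular q h (f a) w)"
  by (induction A rule: infinite_finite_induct) (simp_all add: rsemicircular_lincomb)

text \<open>
  The two mixed commutators each contribute \<open>q ^ length\<close>, with opposite signs.
\<close>

lemma semicircular_rsemicircular:
  "semicircular q g (rsemicircular q h x) = rsemicircular q h (semicircular q g x)"
proof
  fix w
  have r: "rsemicircular q h x = (\<lambda>w. 1 * rcreate h x w + rannih q h x w)"
    and s: "semicircular q g x = (\<lambda>w. 1 * create g x w + annih q g x w)"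
    by (simp_all add: rsemicircular_def semicircular_def fun_eq_iff)
  have "create g (rsemicircular q h x) w + annih q g (rsemicircular q h x) w =
      rcreate h (semicircular q g x) w + rannih q h (semicircular q g x) w"
    unfolding r s create_lincomb annih_lincomb rcreate_lincomb rannih_lincomb
    by (simp add: create_rcreate annih_rcreate rannih_create annih_rannih inner_commute)
  then show "semicircular q g (rsemicircular q h x) w = rsemicircular q h (semicircular q g x) w"
    by (simp add: semicircular_def[of q g "rsemicircular q h x"] rsemicircular_def[of q h "semicircular q g x"])
qed

lemma annih_vacuum:
  fixes h :: "real^('n::finite)"
  shows "annih q h vacuum = (\<lambda>_. 0)"
proof
  fix w :: "'n list"
  have "annih q h vacuum w = annih q h (\<lambda>_. 0) w"
    by (rule annih_cong) (auto simp: vacuum_def)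
  then show "annih q h vacuum w = 0" by simp
qed

lemma rannih_vacuum:
  fixes h :: "real^('n::finite)"
  shows "rannih q h vacuum = (\<lambda>_. 0)"
proof
  fix w :: "'n list"
  have "rannih q h vacuum w = rannih q h (\<lambda>_. 0) w"
    by (rule rannih_cong) (auto simp: vacuum_def)
  then show "rannih q h vacuum w = 0" by simp
qed

lemma semicircular_vacuum: "semicircular q h vacuum = create h vacuum"
  by (simp add: semicircular_def annih_vacuum fun_eq_iff)

lemma rcreate_vacuum:
  fixes h :: "real^('n::finite)"
  shows "rcreate h vacuum = create h vacuum"
proof
  fix w :: "'n list"
  show "rcreate h vacuum w = create h vacuum w"
  proof (cases w)
    case (Cons j w')
    have "(\<lambda>v. vacuum (j # v)) = (\<lambda>_. 0)" by (simp add: vacuum_def)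
    then show ?thesis using Cons by (cases w') (simp_all add: create_def vacuum_def)
  qed (simp add: create_def)
qed

lemma rsemicircular_vacuum: "rsemicircular q h vacuum = semicircular q h vacuum"
  by (simp add: semicircular_vacuum rsemicircular_def rannih_vacuum rcreate_vacuum fun_eq_iff)

definition finite_degree :: "('n list \<Rightarrow> complex) \<Rightarrow> bool" where
  "finite_degree x \<longleftrightarrow> (\<exists>K. \<forall>w. K < length w \<longrightarrow> x w = 0)"

lemma finite_degree_vacuum: "finite_degree vacuum"
  unfolding finite_degree_def by (intro exI[of _ 0]) (simp add: vacuum_def)

lemma finite_degree_add:
  assumes "finite_degree x" "finite_degree y"
  shows "finite_degree (\<lambda>w. x w + y w)"
proof -
  obtain K L where "\<And>w. K < length w \<Longrightarrow> x w = 0" "\<And>w. L < length w \<Longrightarrow> y w = 0"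
    using assms unfolding finite_degree_def by blast
  then show ?thesis unfolding finite_degree_def by (intro exI[of _ "max K L"]) simp
qed

lemma finite_degree_rcreate:
  assumes "finite_degree x"
  shows "finite_degree (rcreate h x)"
proof -
  obtain K where K: "\<And>w. K < length w \<Longrightarrow> x w = 0"
    using assms unfolding finite_degree_def by blast
  have "rcreate h x w = 0" if "Suc K < length w" for w
    using that K by (cases w rule: rev_cases) (simp_all add: rcreate_snoc)
  then show ?thesis unfolding finite_degree_def by blast
qed

lemma finite_degree_rannih:
  assumes "finite_degree x"
  shows "finite_degree (rannih q h x)"
proof -
  obtain K where K: "\<And>w. K < length w \<Longrightarrow> x w = 0"
    using assms unfolding finite_degree_def by blast
  have "rannih q h x w = rannih q h (\<lambda>_. 0) w" if "K < length w" for w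
    using that K by (intro rannih_cong) simp
  then show ?thesis unfolding finite_degree_def by auto
qed

lemma finite_degree_rsemicircular: "finite_degree x \<Longrightarrow> finite_degree (rsemicircular q h x)"
  unfolding rsemicircular_def[abs_def]
  by (intro finite_degree_add finite_degree_rcreate finite_degree_rannih)

lemma finite_degree_qpow: "finite_degree x \<Longrightarrow> finite_degree (qpow q x)"
  unfolding finite_degree_def qpow_def by auto

lemma block_qpow_left: "block_ip (q_fock q) k (qpow r x) y = of_real (r ^ k) * block_ip (q_fock q) k x y"
proof -
  have "block_ip (q_fock q) k (qpow r x) y = block_ip (q_fock q) k (\<lambda>w. of_real (r ^ k) * x w) y"
    by (rule block_ip_cong) (simp_all add: qpow_def)
  then show ?thesis by (simp only: block_ip_scale_left)
qed

lemma hip_vacuum: "hip (q_fock q) x vacuum = x []"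
proof -
  have "block_ip (q_fock q) k x vacuum = 0" if "k \<noteq> 0" for k
  proof -
    have "block_ip (q_fock q) k x vacuum = block_ip (q_fock q) k x (\<lambda>_. 0)"
      by (rule block_ip_cong) (use that in \<open>auto simp: vacuum_def\<close>)
    then show ?thesis by simp
  qed
  then have "hip (q_fock q) x vacuum = (\<Sum>\<^sub>\<infinity>k\<in>{0}. block_ip (q_fock q) k x vacuum)"
    unfolding hip_def by (intro infsum_cong_neutral) auto
  then show ?thesis by (simp add: block_0 vacuum_def)
qed

context q_fock_space
begin

definition word_vec :: "'n list \<Rightarrow> 'n list \<Rightarrow> complex" where
  "word_vec m = foldr (\<lambda>i. semicircular q (e i)) m vacuum"

abbreviation rword :: "'n list \<Rightarrow> ('n list \<Rightarrow> complex) \<Rightarrow> 'n list \<Rightarrow> complex" where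
  "rword m \<equiv> foldr (\<lambda>i. rsemicircular q (e i)) m"

lemma finite_degree_hcarrier: "finite_degree x \<Longrightarrow> x \<in> hcarrier Fq"
  unfolding finite_degree_def
  by (rule finite_support_hcarrier, elim exE, rule_tac B = "{..K}" in finite_subset)
    (auto simp: not_less[symmetric])

lemma rsemicircular_symmetric:
  assumes x: "finite_degree x" and y: "finite_degree y"
  shows "hip Fq (rsemicircular q h x) y = hip Fq x (rsemicircular q h y)"
proof -
  have l: "rsemicircular q h x = (\<lambda>w. 1 * rcreate h x w + rannih q h x w)" for x
    by (simp add: rsemicircular_def fun_eq_iff)
  note c = finite_degree_hcarrier finite_degree_rcreate finite_degree_rannih
  have "hip Fq (rsemicircular q h x) y = hip Fq (rcreate h x) y + hip Fq (rannih q h x) y"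
    unfolding l using x y by (subst hip_lincomb_left) (simp_all add: c)
  also have "hip Fq (rannih q h x) y = cnj (hip Fq (rcreate h y) x)"
    by (subst hip_hermitian) (simp add: hip_rcreate)
  also have "\<dots> = hip Fq x (rcreate h y)"
    by (rule hip_hermitian[symmetric])
  also have "hip Fq (rcreate h x) y + hip Fq x (rcreate h y) = hip Fq x (rsemicircular q h y)"
    unfolding l using x y by (subst hip_lincomb_right) (simp_all add: c hip_rcreate)
  finally show ?thesis .
qed

lemma finite_degree_rword: "finite_degree x \<Longrightarrow> finite_degree (rword m x)"
  by (induction m) (simp_all add: finite_degree_rsemicircular)

lemma rword_symmetric:
  assumes "finite_degree x" "finite_degree y"
  shows "hip Fq (rword m x) y = hip Fq x (rword (rev m) y)"
  using assms(2)
  by (induction m arbitrary: y)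
    (simp_all add: rsemicircular_symmetric finite_degree_rword finite_degree_rsemicircular assms(1))

lemma semicircular_rword: "semicircular q h (rword m x) = rword m (semicircular q h x)"
  by (induction m) (simp_all add: semicircular_rsemicircular)

text \<open>
  The left operators commute with the right ones and agree with them on the vacuum, so a
  word in the left operators is the reversed word in the right operators, as far as its value
  at the vacuum is concerned.
\<close>

lemma word_vec_eq_rword: "word_vec m = rword (rev m) vacuum"
  by (induction m)
    (simp_all add: word_vec_def semicircular_rword rsemicircular_vacuum)

lemma word_vec_Nil: "word_vec [] = vacuum"
  by (simp add: word_vec_def)

lemma word_vec_Cons: "word_vec (i # m) = semicircular q (e i) (word_vec m)"
  by (simp add: word_vec_def)

lemma finite_degree_word_vec: "finite_degree (word_vec m)"
  unfolding word_vec_eq_rword by (intro finite_degree_rword finite_degree_vacuum)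

lemma word_vec_hcarrier [simp]: "word_vec m \<in> hcarrier Fq"
  by (rule finite_degree_hcarrier[OF finite_degree_word_vec])

text \<open>
  Moving a left annihilation operator through a word in the right operators leaves, at each
  letter, a factor \<open>q ^ degree\<close> acting on what stands to the right of that letter.
\<close>

lemma annih_rword:
  "annih q g (rword m vacuum) w = (\<Sum>s<length m. of_real (g \<bullet> e (m ! s)) *
    rword (take s m) (qpow q (rword (drop (Suc s) m) vacuum)) w)"
proof (induction m arbitrary: w)
  case Nil
  show ?case by (simp add: annih_vacuum)
next
  case (Cons j m)
  let ?x = "rword m vacuum" and ?h = "e j"
  have l: "rsemicircular q ?h ?x = (\<lambda>w. 1 * rcreate ?h ?x w + rannih q ?h ?x w)"
    by (simp add: rsemicircular_def fun_eq_iff)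
  have "annih q g (rsemicircular q ?h ?x) w =
      of_real (g \<bullet> ?h) * qpow q ?x w + rsemicircular q ?h (annih q g ?x) w"
    unfolding l annih_lincomb by (simp add: annih_rcreate annih_rannih rsemicircular_def)
  also have "annih q g ?x = (\<lambda>w. \<Sum>s<length m. of_real (g \<bullet> e (m ! s)) *
      rword (take s m) (qpow q (rword (drop (Suc s) m) vacuum)) w)"
    by (rule ext) (rule Cons.IH)
  finally show ?case
    by (simp add: rsemicircular_sum sum.lessThan_Suc_shift del: sum.lessThan_Suc)
qed

text \<open>
  Pairing a word with a vector of degree one thus splits the word at each of its letters. This
  is integration by parts for the partial free difference quotients, the operator \<open>q ^ degree\<close>
  taking the place of the projection to the vacuum.
\<close>

lemma hip_word_vec_degree_one:
  "hip Fq (word_vec m) (create g vacuum) = (\<Sum>t<length m. of_real (e (m ! t) \<bullet> g) *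
    hip Fq (qpow q (word_vec (take t m))) (word_vec (rev (drop (Suc t) m))))"
proof -
  let ?f = "\<lambda>t. of_real (e (m ! t) \<bullet> g) *
    hip Fq (qpow q (word_vec (take t m))) (word_vec (rev (drop (Suc t) m)))"
  have "hip Fq (word_vec m) (create g vacuum) = cnj (hip Fq vacuum (annih q g (word_vec m)))"
    by (subst hip_hermitian) (simp add: hip_create)
  also have "\<dots> = annih q g (rword (rev m) vacuum) []"
    by (simp add: hip_hermitian[of _ vacuum, symmetric] hip_vacuum word_vec_eq_rword)
  also have "\<dots> = (\<Sum>s<length m. ?f (length m - Suc s))"
    unfolding annih_rword length_rev
  proof (rule sum.cong[OF refl])
    fix s assume "s \<in> {..<length m}"
    then have s: "s < length m" by simp
    let ?t = "length m - Suc s"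
    have 1: "rword (drop (Suc s) (rev m)) vacuum = word_vec (take ?t m)"
      by (simp add: word_vec_eq_rword drop_rev)
    have 2: "rword (rev (take s (rev m))) vacuum = word_vec (rev (drop (Suc ?t) m))"
      using s by (simp add: word_vec_eq_rword take_rev Suc_diff_Suc)
    have "rword (take s (rev m)) (qpow q (word_vec (take ?t m))) [] =
        hip Fq (rword (take s (rev m)) (qpow q (word_vec (take ?t m)))) vacuum"
      by (rule hip_vacuum[symmetric])
    also have "\<dots> = hip Fq (qpow q (word_vec (take ?t m))) (rword (rev (take s (rev m))) vacuum)"
      by (intro rword_symmetric finite_degree_qpow finite_degree_word_vec finite_degree_vacuum)
    finally show "of_real (g \<bullet> e (rev m ! s)) *
        rword (take s (rev m)) (qpow q (rword (drop (Suc s) (rev m)) vacuum)) [] = ?f ?t"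
      unfolding 1 2 using s by (simp add: rev_nth inner_commute)
  qed
  also have "\<dots> = sum ?f {..<length m}"
    by (rule sum.nat_diff_reindex)
  finally show ?thesis .
qed


abbreviation X :: "'n \<Rightarrow> ('n list) oper" where
  "X \<equiv> \<lambda>i. q_semicircular q (e i)"

lemma eval_word_Nil: "eval_word Fq X [] = one_op Fq"
  and eval_word_Cons: "eval_word Fq X (i # m) = X i \<circ> eval_word Fq X m"
  by (simp_all add: eval_word_def)

lemma eval_word_bounded: "eval_word Fq X m \<in> bounded_ops Fq"
proof (induction m)
  case (Cons i m)
  then show ?case
    unfolding eval_word_Cons by (intro bounded_ops_comp q_semicircular_bounded)
qed (simp add: eval_word_Nil bounded_ops_one)

lemma one_op_absorb: "T \<in> bounded_ops Fq \<Longrightarrow> one_op Fq \<circ> T = T" "T \<in> bounded_ops Fq \<Longrightarrow> T \<circ> one_op Fq = T"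
  using bounded_opsD by (fastforce simp: one_op_def restrict_op_def fun_eq_iff)+

lemma eval_word_append: "eval_word Fq X (a @ b) = eval_word Fq X a \<circ> eval_word Fq X b"
  by (induction a) (simp_all add: eval_word_Nil eval_word_Cons one_op_absorb eval_word_bounded comp_assoc)

lemma eval_word_single: "eval_word Fq X [i] = X i"
  by (simp add: eval_word_Nil eval_word_Cons one_op_absorb q_semicircular_bounded)

lemma vacuum_hcarrier [simp]: "vacuum \<in> hcarrier Fq"
  by (rule finite_degree_hcarrier[OF finite_degree_vacuum])

lemma X_apply: "x \<in> hcarrier Fq \<Longrightarrow> X i x = semicircular q (e i) x"
  by (simp add: q_semicircular_eq restrict_op_def)

lemma eval_word_vacuum: "eval_word Fq X m vacuum = word_vec m"
  by (induction m)
    (simp_all add: eval_word_Nil eval_word_Cons word_vec_Nil word_vec_Cons one_op_def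
      restrict_op_def X_apply)

lemma X_symmetric:
  "x \<in> hcarrier Fq \<Longrightarrow> y \<in> hcarrier Fq \<Longrightarrow> hip Fq (X i x) y = hip Fq x (X i y)"
  by (simp add: X_apply semicircular_symmetric)

lemma adj_eval_word: "adj_op Fq (eval_word Fq X m) = eval_word Fq X (rev m)"
proof (rule adj_opI[OF eval_word_bounded])
  show "hip Fq (eval_word Fq X m x) y = hip Fq x (eval_word Fq X (rev m) y)"
    if "x \<in> hcarrier Fq" "y \<in> hcarrier Fq" for x y
    using that
  proof (induction m arbitrary: y)
    case Nil
    then show ?case by (simp add: eval_word_Nil one_op_def restrict_op_def)
  next
    case (Cons i m)
    then have "X i y \<in> hcarrier Fq" "eval_word Fq X m x \<in> hcarrier Fq"
      using bounded_opsD(1)[OF q_semicircular_bounded] bounded_opsD(1)[OF eval_word_bounded] by auto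
    then show ?case
      using Cons unfolding rev.simps eval_word_append eval_word_single
      by (simp add: eval_word_Cons X_symmetric)
  qed
qed


subsection \<open>Density of the polynomials\<close>

sublocale C: graded_hilbert "hconj Fq"
  by (rule graded_hilbert_hconj)

sublocale B: graded_hilbert_pair Fq "hconj Fq" ..

lemma conj_vec_hcarrier: "x \<in> hcarrier Fq \<Longrightarrow> conj_vec x \<in> hcarrier (hconj Fq)"
  by (simp add: hcarrier_hconj)

lemma op_of_eval_word_bounded: "op_of Fq (eval_word Fq X m) \<in> bounded_ops (hconj Fq)"
  by (rule op_of_bounded) (simp add: adj_eval_word eval_word_bounded)

lemma tensor_eval_word:
  "tensor_op Fq (hconj Fq) (eval_word Fq X a) (op_of Fq (eval_word Fq X b)) (bip_vec vacuum) =
    tensor_vec (word_vec a) (conj_vec (word_vec (rev b)))"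
  unfolding bip_vec_def B.tensor_op_tensor_vec[OF eval_word_bounded op_of_eval_word_bounded
      vacuum_hcarrier conj_vec_hcarrier[OF vacuum_hcarrier]]
  by (simp add: op_of_def adj_eval_word eval_word_vacuum)

lemma eval_word_in_vN: "eval_word Fq X m \<in> vN_generated Fq (range X)"
proof (induction m)
  case Nil
  show ?case
    unfolding eval_word_Nil vN_generated_def by (rule commutant_one[OF commutant_bounded])
next
  case (Cons i m)
  have "X i \<in> vN_generated Fq (range X)"
    by (rule generator_in_vN) (auto simp: q_semicircular_bounded)
  then show ?case
    using Cons unfolding eval_word_Cons vN_generated_def by (rule commutant_comp)
qed

inductive_set word_span :: "('n list \<Rightarrow> complex) set" where
  zero: "(\<lambda>_. 0) \<in> word_span"
| step: "x \<in> word_span \<Longrightarrow> (\<lambda>w. c * word_vec m w + x w) \<in> word_span"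

lemma word_span_lincomb:
  assumes "x \<in> word_span" "y \<in> word_span"
  shows "(\<lambda>w. c * x w + y w) \<in> word_span"
  using assms(1)
proof induction
  case (step x c' m)
  then show ?case
    using word_span.step[of "\<lambda>w. c * x w + y w" "c * c'" m] by (simp add: algebra_simps)
qed (simp add: assms(2))

lemma word_span_sum:
  "(\<And>a. a \<in> A \<Longrightarrow> f a \<in> word_span) \<Longrightarrow> (\<lambda>w. \<Sum>a\<in>A. c a * f a w) \<in> word_span"
  by (induction A rule: infinite_finite_induct) (simp_all add: word_span.zero word_span_lincomb)

lemma word_span_semicircular:
  assumes "x \<in> word_span"
  shows "semicircular q (e i) x \<in> word_span"
  using assms
proof induction
  case (step x c m)
  then show ?case
    by (simp add: semicircular_lincomb word_vec_Cons[symmetric] word_span.step)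
qed (simp add: word_span.zero)

lemma word_span_minimal:
  assumes zero: "(\<lambda>_. 0) \<in> W"
    and lin: "\<And>c x y. x \<in> W \<Longrightarrow> y \<in> W \<Longrightarrow> (\<lambda>w. c * x w + y w) \<in> W"
    and words: "\<And>m. word_vec m \<in> W"
    and x: "x \<in> word_span"
  shows "x \<in> W"
  using x by induction (simp_all add: zero lin words)

text \<open>
  Since the vectors \<open>e\<close> span the space, every word of degree \<open>k + 1\<close> is a combination of
  vectors \<open>create (e j) x\<close> with \<open>x\<close> of degree \<open>k\<close>, which differ from \<open>semicircular q (e j) x\<close> in a
  lower degree only.
\<close>

lemma in_word_span:
  assumes F: "\<And>i. axis i 1 = (\<Sum>j\<in>UNIV. F i j *\<^sub>R e j)"
    and "\<And>w. k \<le> length w \<Longrightarrow> x w = 0"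
  shows "x \<in> word_span"
  using assms(2)
proof (induction k arbitrary: x)
  case 0
  then have "x = (\<lambda>_. 0)" by auto
  then show ?case by (simp add: word_span.zero)
next
  case (Suc k)
  have point: "point u \<in> word_span" if u: "u \<in> words k" for u
  proof (cases u)
    case Nil
    have "point [] = word_vec []" by (auto simp: point_def vacuum_def word_vec_Nil)
    then show ?thesis
      using word_span.step[OF word_span.zero, of 1 "[]"] by (simp add: Nil)
  next
    case (Cons i u')
    have "create (e j) (point u') \<in> word_span" for j
    proof -
      have p: "point u' \<in> word_span" by (rule Suc.IH) (use u Cons in \<open>auto simp: point_def\<close>)
      have a: "annih q (e j) (point u') \<in> word_span"
      proof (rule Suc.IH)
        fix w :: "'n list" assume "k \<le> length w"
        then have "annih q (e j) (point u') w = annih q (e j) (\<lambda>_. 0) w"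
          using u Cons by (intro annih_cong) (auto simp: point_def)
        then show "annih q (e j) (point u') w = 0" by simp
      qed
      from word_span_lincomb[OF a word_span_semicircular[OF p], of "-1" j]
      show ?thesis by (simp add: semicircular_def[abs_def])
    qed
    then have "(\<lambda>w. \<Sum>j\<in>UNIV. of_real (F i j) * create (e j) (point u') w) \<in> word_span"
      by (intro word_span_sum)
    also have "(\<lambda>w. \<Sum>j\<in>UNIV. of_real (F i j) * create (e j) (point u') w) = point u"
    proof
      fix w
      show "(\<Sum>j\<in>UNIV. of_real (F i j) * create (e j) (point u') w) = point u w"
      proof (cases w)
        case Nil
        then show ?thesis using Cons by (simp add: create_def point_def)
      next
        case w: (Cons a w')
        have "(\<Sum>j\<in>UNIV. F i j * e j $ a) = axis i 1 $ a"
          by (subst F) (simp add: sum_component)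
        then have "(\<Sum>j\<in>UNIV. complex_of_real (F i j) * of_real (e j $ a)) = of_real (axis i 1 $ a)"
          by (simp flip: of_real_mult of_real_sum)
        then have "(\<Sum>j\<in>UNIV. of_real (F i j) * create (e j) (point u') w) =
            of_real (axis i 1 $ a) * point u' w'"
          unfolding w create_def list.case mult.assoc[symmetric] sum_distrib_right[symmetric] by simp
        then show ?thesis by (auto simp: w Cons point_def axis_def)
      qed
    qed
    finally show ?thesis .
  qed
  let ?low = "\<lambda>w. if length w = k then 0 else x w"
  have low: "?low \<in> word_span"
    by (rule Suc.IH) (use Suc.prems in \<open>auto simp: Suc_le_eq\<close>)
  have "(\<lambda>w. \<Sum>u\<in>words k. x u * point u w) \<in> word_span"
    by (rule word_span_sum) (rule point)
  from word_span_lincomb[OF this low, of 1]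
  have "(\<lambda>w. (\<Sum>u\<in>words k. x u * point u w) + ?low w) \<in> word_span" by simp
  also have "(\<lambda>w. (\<Sum>u\<in>words k. x u * point u w) + ?low w) = x"
  proof
    fix w
    have "(\<Sum>u\<in>words k. x u * point u w) = (\<Sum>u\<in>words k. if u = w then x u else 0)"
      by (rule sum.cong) (auto simp: point_def)
    then show "(\<Sum>u\<in>words k. x u * point u w) + ?low w = x w" by simp
  qed
  finally show ?case .
qed

text \<open>
  The vectors reached from \<open>\<Omega> \<otimes> conj \<Omega>\<close> by the algebra form a subspace. It contains the elementary
  tensors of word vectors, hence all basis vectors, and these span a dense subspace.
\<close>

lemma L2_bip_eq_hcarrier:
  assumes F: "\<And>i. axis i 1 = (\<Sum>j\<in>UNIV. F i j *\<^sub>R e j)"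
  shows "L2_bip Fq vacuum (vN_generated Fq (range X)) = hcarrier (bip_space Fq)"
proof
  show "L2_bip Fq vacuum (vN_generated Fq (range X)) \<subseteq> hcarrier (bip_space Fq)"
    by (auto simp: L2_bip_def L2_space_def)
  show "hcarrier (bip_space Fq) \<subseteq> L2_bip Fq vacuum (vN_generated Fq (range X))"
  proof
    fix \<zeta> assume \<zeta>: "\<zeta> \<in> hcarrier (bip_space Fq)"
    let ?M = "vN_generated Fq (range X)"
    let ?N = "vN_tensor Fq (hconj Fq) ?M (op_of Fq ` ?M)"
    define W where "W = (\<lambda>T. T (bip_vec vacuum)) ` ?N"
    let ?S = "{tensor_op Fq (hconj Fq) a b |a b. a \<in> ?M \<and> b \<in> op_of Fq ` ?M}"
    let ?HK = "htensor Fq (hconj Fq)"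
    have N: "?N = commutant ?HK (commutant ?HK (?S \<union> adj_op ?HK ` ?S))"
      by (simp add: vN_tensor_def vN_generated_def)
    have zero: "(\<lambda>_. 0) \<in> W"
      unfolding W_def N using B.HK.commutant_zero[OF B.HK.commutant_bounded] by (rule rev_image_eqI) simp
    have lin: "(\<lambda>w. c * x w + y w) \<in> W" if "x \<in> W" "y \<in> W" for c x y
    proof -
      obtain T where T: "x = T (bip_vec vacuum)" "T \<in> ?N"
        using \<open>x \<in> W\<close> unfolding W_def by (elim imageE)
      obtain T' where T': "y = T' (bip_vec vacuum)" "T' \<in> ?N"
        using \<open>y \<in> W\<close> unfolding W_def by (elim imageE)
      have "(\<lambda>x w. c * T x w + T' x w) \<in> ?N"
        using T(2) T'(2) unfolding N by (intro B.HK.commutant_lincomb B.HK.commutant_bounded)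
      then show ?thesis unfolding W_def by (rule rev_image_eqI) (simp add: T(1) T'(1))
    qed
    have tensor: "tensor_vec (word_vec a) (conj_vec (word_vec b)) \<in> W" for a b
    proof -
      let ?T = "tensor_op Fq (hconj Fq) (eval_word Fq X a) (op_of Fq (eval_word Fq X (rev b)))"
      have "?T \<in> ?N"
        unfolding vN_tensor_def
      proof (rule B.HK.generator_in_vN)
        show "?T \<in> ?S" using eval_word_in_vN by blast
        show "?T \<in> bounded_ops ?HK"
          by (rule B.tensor_op_bounded[OF eval_word_bounded op_of_eval_word_bounded])
      qed
      then show ?thesis unfolding W_def by (rule rev_image_eqI) (simp add: tensor_eval_word)
    qed
    have left: "tensor_vec x (conj_vec (word_vec b)) \<in> W" if "x \<in> word_span" for x b
    proof -
      let ?U = "{x. tensor_vec x (conj_vec (word_vec b)) \<in> W}"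
      have "x \<in> ?U"
      proof (rule word_span_minimal[OF _ _ _ that])
        show "(\<lambda>_. 0) \<in> ?U"
          using zero by (simp add: tensor_vec_def case_prod_unfold)
        show "(\<lambda>w. c * x w + y w) \<in> ?U"
          if "x \<in> ?U"
            "y \<in> ?U" for c x y
          using lin[of "tensor_vec x (conj_vec (word_vec b))" "tensor_vec y (conj_vec (word_vec b))" c] that
          by (simp add: tensor_vec_def case_prod_unfold distrib_right mult.assoc)
      qed (simp add: tensor)
      then show ?thesis by simp
    qed
    have both: "tensor_vec x (conj_vec y) \<in> W" if x: "x \<in> word_span" and y: "y \<in> word_span" for x y
    proof -
      let ?U = "{y. tensor_vec x (conj_vec y) \<in> W}"
      have "y \<in> ?U"
      proof (rule word_span_minimal[OF _ _ _ y])
        show "(\<lambda>_. 0) \<in> ?U"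
          using zero by (simp add: tensor_vec_def conj_vec_def case_prod_unfold)
        show "(\<lambda>w. c * y w + \<theta> w) \<in> ?U"
          if "y \<in> ?U" "\<theta> \<in> ?U" for c y \<theta>
          using lin[of "tensor_vec x (conj_vec y)" "tensor_vec x (conj_vec \<theta>)" "cnj c"] that
          by (simp add: tensor_vec_def conj_vec_def case_prod_unfold distrib_left mult.left_commute)
      qed (simp add: left[OF x])
      then show ?thesis by simp
    qed
    have pt: "point u \<in> word_span" for u
      by (rule in_word_span[OF F, of "Suc (length u)"]) (auto simp: point_def)
    have points: "point p \<in> W" for p
    proof (cases p)
      case (Pair u v)
      have "point p = tensor_vec (point u) (conj_vec (point v))"
        by (auto simp: Pair point_def tensor_vec_def conj_vec_def)
      then show ?thesis using both[OF pt pt] by simp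
    qed
    have "\<exists>T\<in>?N. hnorm ?HK (\<lambda>w. \<zeta> w - T (bip_vec vacuum) w) < \<epsilon>" if "0 < \<epsilon>" for \<epsilon>
    proof -
      have "\<exists>y\<in>W. y \<in> hcarrier ?HK \<and> hnorm ?HK (\<lambda>w. \<zeta> w - y w) < \<epsilon>"
        using \<zeta> that by (intro B.HK.subspace_dense zero lin points) (simp_all add: bip_space_def)
      then show ?thesis unfolding W_def by blast
    qed
    then show "\<zeta> \<in> L2_bip Fq vacuum ?M"
      using \<zeta> by (simp add: L2_bip_def L2_space_def bip_space_def)
  qed
qed

end


section \<open>The Stein kernel\<close>

lemma infsum_diagonal:
  fixes g :: "'a \<Rightarrow> 'b::{comm_monoid_add, t2_space}"
  shows "(\<Sum>\<^sub>\<infinity>m. if fst m = snd m then g (fst m) else 0) = (\<Sum>\<^sub>\<infinity>k. g k)"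
proof -
  have "(\<Sum>\<^sub>\<infinity>m. if fst m = snd m then g (fst m) else 0) =
      infsum (\<lambda>m. if fst m = snd m then g (fst m) else 0) (range (\<lambda>k. (k, k)))"
    by (rule infsum_cong_neutral) (auto simp: image_iff)
  also have "\<dots> = (\<Sum>\<^sub>\<infinity>k. g k)"
    by (subst infsum_reindex) (auto simp: inj_on_def o_def)
  finally show ?thesis .
qed

lemma geometric_has_sum:
  fixes r :: real
  assumes "0 \<le> r" "r < 1"
  shows "((\<lambda>k::nat. if k = 0 then 0 else r ^ k) has_sum r / (1 - r)) UNIV"
proof (rule sums_nonneg_imp_has_sum)
  have "(\<lambda>k. r * r ^ k) sums (r * (1 / (1 - r)))"
    using assms by (intro sums_mult geometric_sums) simp
  then have "(\<lambda>k. if Suc k = 0 then 0 else r ^ Suc k) sums (r / (1 - r))" by simp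
  then show "(\<lambda>k. if k = 0 then 0 else r ^ k) sums (r / (1 - r))"
    by (subst (asm) sums_Suc_iff) simp
qed (use assms in simp)

context q_fock_space
begin

text \<open>
  For an orthonormal basis \<open>f\<close> of the q-Fock space, the vector below is
  \<open>\<Sum>\<alpha>. q ^ degree \<alpha> * (f \<alpha> \<otimes> conj (f \<alpha>))\<close>: as a Hilbert--Schmidt operator it is
  \<open>q ^ degree\<close>, the sum of \<open>q ^ k\<close> times the projection to degree \<open>k\<close>.
\<close>

definition q_kernel ::
  "('n list \<Rightarrow> 'n list \<Rightarrow> complex) \<Rightarrow> 'n list \<times> 'n list \<Rightarrow> complex" where
  "q_kernel f = (\<lambda>(u, v). if length u = length v
     then \<Sum>\<alpha>\<in>words (length u). of_real (q ^ length u) * tensor_vec (f \<alpha>) (conj_vec (f \<alpha>)) (u, v)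
     else 0)"

abbreviation FF :: "('n list \<times> 'n list, nat \<times> nat) gbasis" where
  "FF \<equiv> htensor Fq (hconj Fq)"

lemma deg_FF: "deg FF (u, v) = (length u, length v)"
  by (simp add: htensor_def hconj_def)

lemma block_tensor_conj:
  "block_ip FF (k, l) (tensor_vec x (conj_vec y)) (tensor_vec x' (conj_vec y')) =
    block_ip Fq k x x' * cnj (block_ip Fq l y y')"
  by (simp add: block_ip_tensor_vec block_ip_hconj)

lemma block_q_kernel:
  "block_ip FF (k, l) \<zeta> (q_kernel f) = (if k = l
    then of_real (q ^ k) * (\<Sum>\<alpha>\<in>words k. block_ip FF (k, k) \<zeta> (tensor_vec (f \<alpha>) (conj_vec (f \<alpha>))))
    else 0)"
proof (cases "k = l")
  case True
  have "block_ip FF (k, k) \<zeta> (q_kernel f) = block_ip FF (k, k) \<zeta>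
      (\<lambda>w. \<Sum>\<alpha>\<in>words k. of_real (q ^ k) * tensor_vec (f \<alpha>) (conj_vec (f \<alpha>)) w)"
    by (rule block_ip_cong) (auto simp: q_kernel_def deg_FF)
  also have "\<dots> = of_real (q ^ k) * (\<Sum>\<alpha>\<in>words k. block_ip FF (k, k) \<zeta> (tensor_vec (f \<alpha>) (conj_vec (f \<alpha>))))"
    unfolding block_ip_sum_right by (simp add: sum_distrib_left)
  finally show ?thesis using True by simp
next
  case False
  then have "block_ip FF (k, l) \<zeta> (q_kernel f) = block_ip FF (k, l) \<zeta> (\<lambda>_. 0)"
    by (intro block_ip_cong) (auto simp: q_kernel_def deg_FF)
  then show ?thesis using False by simp
qed

lemma hip_tensor_q_kernel:
  assumes f: "orthonormal_basis Fq f"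
  shows "hip FF (tensor_vec x (conj_vec y)) (q_kernel f) = hip Fq (qpow q x) y"
proof -
  have "block_ip FF m (tensor_vec x (conj_vec y)) (q_kernel f) =
      (if fst m = snd m then block_ip Fq (fst m) (qpow q x) y else 0)" for m
    using parseval[OF f, of "snd m" x y]
    by (cases m) (simp add: block_q_kernel block_tensor_conj block_qpow_left)
  then show ?thesis
    unfolding hip_def by (simp only: infsum_diagonal[of "\<lambda>k. block_ip Fq k (qpow q x) y"])
qed

lemma block_q_kernel_self:
  assumes f: "orthonormal_basis Fq f"
  shows "block_ip FF (k, k) (q_kernel f) (q_kernel f) = of_real ((q\<^sup>2 * real CARD('n)) ^ k)"
proof -
  have on: "block_ip Fq k (f \<alpha>) (f \<beta>) = (if \<alpha> = \<beta> then 1 else 0)"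
    if "\<alpha> \<in> words k" "\<beta> \<in> words k" for \<alpha> \<beta>
  proof -
    have "\<forall>\<alpha> \<beta>. length \<alpha> = length \<beta> \<longrightarrow>
        block_ip Fq (length \<alpha>) (f \<alpha>) (f \<beta>) = (if \<alpha> = \<beta> then 1 else 0)"
      using f unfolding orthonormal_basis_def deg_q_fock by (elim conjE)
    from this[rule_format, of \<alpha> \<beta>] show ?thesis using that by simp
  qed
  have "block_ip FF (k, k) (q_kernel f) (tensor_vec (f \<alpha>) (conj_vec (f \<alpha>))) = of_real (q ^ k)"
    if \<alpha>: "\<alpha> \<in> words k" for \<alpha>
  proof -
    let ?t = "tensor_vec (f \<alpha>) (conj_vec (f \<alpha>))"
    have "block_ip FF (k, k) ?t (q_kernel f) = of_real (q ^ k) * (\<Sum>\<beta>\<in>words k. if \<beta> = \<alpha> then 1 else 0)"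
    proof -
      have "block_ip FF (k, k) ?t (tensor_vec (f \<beta>) (conj_vec (f \<beta>))) = (if \<beta> = \<alpha> then 1 else 0)"
        if "\<beta> \<in> words k" for \<beta>
        using on[OF \<alpha> that] by (cases "\<beta> = \<alpha>") (simp_all add: block_tensor_conj)
      then show ?thesis by (subst block_q_kernel) simp
    qed
    also have "\<dots> = of_real (q ^ k)" using \<alpha> by simp
    finally show ?thesis by (subst B.HK.block_hermitian) simp
  qed
  then have "block_ip FF (k, k) (q_kernel f) (q_kernel f) =
      of_real (q ^ k) * (\<Sum>\<alpha>\<in>(words k :: 'n list set). of_real (q ^ k))"
    by (subst block_q_kernel) simp
  also have "\<dots> = of_real ((q\<^sup>2 * real CARD('n)) ^ k)"
    using card_lists_length_eq[of "UNIV :: 'n set" k]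
    by (simp add: power_mult_distrib power_mult[symmetric] power2_eq_square mult.commute
        mult_ac)
  finally show ?thesis .
qed

lemma bip_vec_vacuum: "bip_vec vacuum = point ([], [])"
  by (auto simp: bip_vec_def tensor_vec_def conj_vec_def vacuum_def point_def)

text \<open>
  In degree \<open>(0, 0)\<close> the kernel is \<open>\<Omega> \<otimes> conj \<Omega>\<close>, and it has squared norm \<open>(q\<^sup>2 * n) ^ k\<close> in degree
  \<open>(k, k)\<close>, because that component is \<open>q ^ k\<close> times a sum over an orthonormal basis with \<open>n ^ k\<close>
  elements. The distance to the identity is therefore a geometric series without its first term.
\<close>

lemma q_kernel_distance:
  assumes f: "orthonormal_basis Fq f" and qn: "q\<^sup>2 * real CARD('n) < 1"
  defines "r \<equiv> q\<^sup>2 * real CARD('n)"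
  shows "q_kernel f \<in> hcarrier FF"
    and "Re (hip FF (\<lambda>w. q_kernel f w - bip_vec vacuum w) (\<lambda>w. q_kernel f w - bip_vec vacuum w)) = r / (1 - r)"
proof -
  let ?D = "\<lambda>w. q_kernel f w - bip_vec vacuum w"
  have r: "0 \<le> r" "r < 1" using qn by (simp_all add: r_def)
  have f00: "f [] [] * cnj (f [] []) = 1"
  proof -
    have "\<forall>\<alpha> \<beta>. length \<alpha> = length \<beta> \<longrightarrow>
        block_ip Fq (length \<alpha>) (f \<alpha>) (f \<beta>) = (if \<alpha> = \<beta> then 1 else 0)"
      using f unfolding orthonormal_basis_def by simp
    from this[rule_format, of "[]" "[]"] show ?thesis by (simp add: block_0)
  qed
  have D0: "?D ([], []) = 0"
    using f00 by (simp add: q_kernel_def bip_vec_vacuum point_def tensor_vec_def conj_vec_def)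
  have block: "block_ip FF m ?D ?D =
      of_real (if fst m = snd m then (if fst m = 0 then 0 else r ^ fst m) else 0)" for m
  proof (cases m)
    case (Pair k l)
    consider "k \<noteq> l" | "k = l" "k = 0" | "k = l" "k \<noteq> 0" by blast
    then show ?thesis
    proof cases
      case 1
      then have "block_ip FF (k, l) ?D ?D = block_ip FF (k, l) (\<lambda>_. 0) (\<lambda>_. 0)"
        by (intro block_ip_cong) (auto simp: deg_FF q_kernel_def bip_vec_vacuum point_def)
      with 1 Pair show ?thesis by simp
    next
      case 2
      then have "block_ip FF (k, l) ?D ?D = block_ip FF (k, l) (\<lambda>_. 0) (\<lambda>_. 0)"
        using D0 by (intro block_ip_cong) (auto simp: deg_FF)
      with 2 Pair show ?thesis by simp
    next
      case 3
      then have "block_ip FF (k, l) ?D ?D = block_ip FF (k, l) (q_kernel f) (q_kernel f)"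
        by (intro block_ip_cong) (auto simp: deg_FF bip_vec_vacuum point_def)
      with 3 Pair show ?thesis by (simp add: block_q_kernel_self[OF f] r_def)
    qed
  qed
  let ?g = "\<lambda>m. if fst m = snd m then (if fst m = 0 then 0 else r ^ fst m) else (0::real)"
  have "(?g \<circ> (\<lambda>k. (k, k)) has_sum r / (1 - r)) UNIV"
    using geometric_has_sum[OF r] by (simp add: o_def cong: if_cong)
  then have "(?g has_sum r / (1 - r)) (range (\<lambda>k. (k, k)))"
    by (subst has_sum_reindex) (auto simp: inj_on_def)
  then have hs: "(?g has_sum r / (1 - r)) UNIV"
    by (rule has_sum_cong_neutral[THEN iffD1, rotated 3]) (auto simp: image_iff)
  have D: "?D \<in> hcarrier FF"
    unfolding hcarrier_def mem_Collect_eq block Re_complex_of_real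
    using hs by (rule has_sum_imp_summable)
  show "Re (hip FF ?D ?D) = r / (1 - r)"
    unfolding B.HK.hip_self[OF D] block Re_complex_of_real by (rule infsumI[OF hs])
  show "q_kernel f \<in> hcarrier FF"
    using B.HK.hcarrier_lincomb[OF B.HK.point_hcarrier[of "([], [])"] D, of 1]
    by (simp add: bip_vec_vacuum)
qed

end


subsection \<open>Linear functionals of polynomials\<close>

text \<open>
  All the operations on polynomials that occur are of the form of a linear functional determined
  by its values on monomials.
\<close>

definition poly_sum :: "('m \<Rightarrow> complex) \<Rightarrow> ('m \<Rightarrow>\<^sub>0 complex) \<Rightarrow> complex" where
  "poly_sum \<phi> P = (\<Sum>m\<in>Poly_Mapping.keys P. Poly_Mapping.lookup P m * \<phi> m)"

lemma poly_sum_add: "poly_sum \<phi> (P + Q) = poly_sum \<phi> P + poly_sum \<phi> Q"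
  unfolding poly_sum_def by (rule setsum_keys_plus_distrib) (simp_all add: distrib_right)

lemma poly_sum_single: "poly_sum \<phi> (Poly_Mapping.single m c) = c * \<phi> m"
  by (cases "c = 0") (simp_all add: poly_sum_def)

lemma poly_sum_sum: "poly_sum \<phi> (\<Sum>a\<in>A. P a) = (\<Sum>a\<in>A. poly_sum \<phi> (P a))"
  by (induction A rule: infinite_finite_induct) (simp_all add: poly_sum_add, simp_all add: poly_sum_def)

lemma poly_sum_free_diff:
  "poly_sum \<phi> (free_diff j P) =
    poly_sum (\<lambda>m. \<Sum>s | s < length m \<and> m ! s = j. \<phi> (take s m, drop (Suc s) m)) P"
  unfolding free_diff_def poly_sum_sum poly_sum_single
  by (simp add: poly_sum_def sum_distrib_left)

lemma poly_sum_cyc_grad: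
  "poly_sum \<phi> (cyc_grad j P) =
    poly_sum (\<lambda>m. \<Sum>s | s < length m \<and> m ! s = j. \<phi> (drop (Suc s) m @ take s m)) P"
  unfolding cyc_grad_def poly_sum_sum poly_sum_single
  by (simp add: poly_sum_def sum_distrib_left)

lemma eval_poly_eq: "eval_poly H X P x w = poly_sum (\<lambda>m. eval_word H X m x w) P"
  by (simp add: eval_poly_def poly_sum_def)

lemma sum_occurrences_pair:
  "(\<Sum>s | s < length [a, b] \<and> [a, b] ! s = i. F s) =
    (if a = i then F 0 else 0) + (if b = i then F 1 else (0::complex))"
proof -
  have "(\<Sum>s | s < length [a, b] \<and> [a, b] ! s = i. F s) =
      (\<Sum>s\<in>{..<2}. if [a, b] ! s = i then F s else 0)"
    by (rule sum.mono_neutral_cong_left) auto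
  then show ?thesis by (simp add: numeral_2_eq_2)
qed

lemma poly_sum_cyc_grad_quad_potential:
  assumes sym: "\<And>i j. matrix_inv C $ i $ j = matrix_inv C $ j $ i"
  shows "poly_sum \<phi> (cyc_grad i (quad_potential C)) =
    (\<Sum>b\<in>UNIV. of_real (matrix_inv C $ i $ b) * \<phi> [b])"
proof -
  let ?c = "\<lambda>a b. complex_of_real (1 / 2 * matrix_inv C $ a $ b)"
  have "poly_sum \<phi> (cyc_grad i (quad_potential C)) =
      (\<Sum>a\<in>UNIV. \<Sum>b\<in>UNIV. (if a = i then ?c a b * \<phi> [b] else 0) + (if b = i then ?c a b * \<phi> [a] else 0))"
    unfolding poly_sum_cyc_grad quad_potential_def poly_sum_sum poly_sum_single sum_occurrences_pair
    by (intro sum.cong refl) (simp add: distrib_left)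
  also have "\<dots> = (\<Sum>a\<in>UNIV. \<Sum>b\<in>UNIV. if a = i then ?c a b * \<phi> [b] else 0) +
      (\<Sum>a\<in>UNIV. \<Sum>b\<in>UNIV. if b = i then ?c a b * \<phi> [a] else 0)"
    by (simp only: sum.distrib)
  also have "(\<Sum>a\<in>UNIV. \<Sum>b\<in>UNIV. if a = i then ?c a b * \<phi> [b] else 0) = (\<Sum>b\<in>UNIV. ?c i b * \<phi> [b])"
    by (subst sum.swap) simp
  also have "(\<Sum>a\<in>UNIV. \<Sum>b\<in>UNIV. if b = i then ?c a b * \<phi> [a] else 0) = (\<Sum>a\<in>UNIV. ?c i a * \<phi> [a])"
    by (simp add: sym[of _ i])
  also have "(\<Sum>b\<in>UNIV. ?c i b * \<phi> [b]) + (\<Sum>a\<in>UNIV. ?c i a * \<phi> [a]) =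
      (\<Sum>b\<in>UNIV. of_real (matrix_inv C $ i $ b) * \<phi> [b])"
    unfolding sum.distrib[symmetric] by (intro sum.cong refl) (simp add: distrib_right[symmetric])
  finally show ?thesis .
qed

subsection \<open>The Stein identity\<close>

context q_fock_space
begin

lemma eval_poly_vacuum: "eval_poly Fq X P vacuum w = poly_sum (\<lambda>m. word_vec m w) P"
  by (simp add: eval_poly_eq eval_word_vacuum)

lemma eval_poly_vacuum_hcarrier: "eval_poly Fq X P vacuum \<in> hcarrier Fq"
  unfolding eval_poly_vacuum[abs_def] poly_sum_def by (intro hcarrier_sum word_vec_hcarrier)

lemma eval_poly2_q_kernel:
  assumes f: "orthonormal_basis Fq f" and c: "q_kernel f \<in> hcarrier FF"
  shows "hip FF (eval_poly2 Fq X Q (bip_vec vacuum)) (q_kernel f) =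
    poly_sum (\<lambda>(a, b). hip Fq (qpow q (word_vec a)) (word_vec (rev b))) Q"
proof -
  let ?t = "\<lambda>p. tensor_vec (word_vec (fst p)) (conj_vec (word_vec (rev (snd p))))"
  have "eval_poly2 Fq X Q (bip_vec vacuum) =
      (\<lambda>w. \<Sum>p\<in>Poly_Mapping.keys Q. Poly_Mapping.lookup Q p * ?t p w)"
    by (simp add: eval_poly2_def tensor_eval_word case_prod_unfold)
  moreover have "hip FF (\<lambda>w. \<Sum>p\<in>Poly_Mapping.keys Q. Poly_Mapping.lookup Q p * ?t p w) (q_kernel f) =
      (\<Sum>p\<in>Poly_Mapping.keys Q. Poly_Mapping.lookup Q p * hip FF (?t p) (q_kernel f))"
    by (intro B.HK.hip_sum_left c B.tensor_vec_in_hcarrier word_vec_hcarrier conj_vec_hcarrier)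
  ultimately show ?thesis
    by (simp add: hip_tensor_q_kernel[OF f] poly_sum_def case_prod_unfold)
qed

text \<open>
  Since \<open>g\<close> is orthogonal to every \<open>e j\<close> with \<open>j \<noteq> i\<close>, only the occurrences of the letter \<open>i\<close> contribute when
  a word is split, and these are the terms of the free difference quotient at \<open>i\<close>.
\<close>

lemma stein_identity_component:
  assumes f: "orthonormal_basis Fq f" and c: "q_kernel f \<in> hcarrier FF"
    and dual: "\<And>j. e j \<bullet> g = (if j = i then 1 else 0)"
  shows "hip Fq (eval_poly Fq X P vacuum) (create g vacuum) =
    hip FF (eval_poly2 Fq X (free_diff i P) (bip_vec vacuum)) (q_kernel f)"
proof -
  have word: "hip Fq (word_vec m) (create g vacuum) = (\<Sum>s | s < length m \<and> m ! s = i.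
      hip Fq (qpow q (word_vec (take s m))) (word_vec (rev (drop (Suc s) m))))" for m
    unfolding hip_word_vec_degree_one dual
    by (rule sum.mono_neutral_cong_right) auto
  have "hip Fq (eval_poly Fq X P vacuum) (create g vacuum) =
      poly_sum (\<lambda>m. hip Fq (word_vec m) (create g vacuum)) P"
    unfolding eval_poly_vacuum[abs_def] poly_sum_def
    by (intro hip_sum_left word_vec_hcarrier create_bounded vacuum_hcarrier)
  also have "\<dots> = hip FF (eval_poly2 Fq X (free_diff i P) (bip_vec vacuum)) (q_kernel f)"
    unfolding eval_poly2_q_kernel[OF f c] poly_sum_free_diff word by simp
  finally show ?thesis .
qed

lemma eval_cyc_grad_quad_potential:
  assumes sym: "\<And>i j. matrix_inv C $ i $ j = matrix_inv C $ j $ i"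
  shows "eval_poly Fq X (cyc_grad i (quad_potential C)) =
    (\<lambda>x w. \<Sum>b\<in>UNIV. of_real (matrix_inv C $ i $ b) * X b x w)"
  by (rule ext)+
    (simp add: eval_poly_eq poly_sum_cyc_grad_quad_potential[OF sym] eval_word_single)

lemma bounded_ops_sum_real:
  "(\<lambda>x w. \<Sum>b\<in>A. of_real (c b) * X b x w) \<in> bounded_ops Fq"
proof (induction A rule: infinite_finite_induct)
  case (insert b A)
  from bounded_ops_lincomb[OF q_semicircular_bounded insert.IH, of "of_real (c b)" "e b"]
  show ?case using insert.hyps by simp
qed (simp_all add: bounded_ops_zero)

lemma sum_real_symmetric:
  assumes c: "x \<in> hcarrier Fq" "y \<in> hcarrier Fq"
  shows "hip Fq (\<lambda>w. \<Sum>b\<in>A. of_real (a b) * X b x w) y =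
    hip Fq x (\<lambda>w. \<Sum>b\<in>A. of_real (a b) * X b y w)"
proof -
  let ?Y = "\<lambda>x w. \<Sum>b\<in>A. of_real (a b) * X b x w"
  have car: "X b \<theta> \<in> hcarrier Fq" if "\<theta> \<in> hcarrier Fq" for b \<theta>
    using bounded_opsD(1)[OF q_semicircular_bounded that] .
  have "hip Fq (?Y x) y = (\<Sum>b\<in>A. of_real (a b) * hip Fq (X b x) y)"
    by (rule hip_sum_left) (simp_all add: car c)
  also have "\<dots> = (\<Sum>b\<in>A. of_real (a b) * hip Fq x (X b y))"
    using c by (simp add: X_symmetric)
  also have "\<dots> = cnj (\<Sum>b\<in>A. of_real (a b) * hip Fq (X b y) x)"
    by (simp add: hip_hermitian[of x, symmetric])
  also have "\<dots> = cnj (hip Fq (?Y y) x)"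
    by (subst hip_sum_left) (simp_all add: car c)
  also have "\<dots> = hip Fq x (?Y y)"
    by (rule hip_hermitian[symmetric])
  finally show ?thesis .
qed

lemma adj_sum_real:
  "adj_op Fq (\<lambda>x w. \<Sum>b\<in>A. of_real (c b) * X b x w) = (\<lambda>x w. \<Sum>b\<in>A. of_real (c b) * X b x w)"
  by (rule adj_opI[OF bounded_ops_sum_real sum_real_symmetric])

lemma sum_X_vacuum:
  "(\<lambda>w. \<Sum>b\<in>A. of_real (c b) * X b vacuum w) = create (\<Sum>b\<in>A. c b *\<^sub>R e b) vacuum"
proof
  fix w
  show "(\<Sum>b\<in>A. of_real (c b) * X b vacuum w) = create (\<Sum>b\<in>A. c b *\<^sub>R e b) vacuum w"
    by (cases w) (simp_all add: X_apply semicircular_vacuum create_def sum_component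
        sum_distrib_right mult.assoc)
qed

lemma q_kernel_is_free_stein_kernel:
  fixes C :: "real^'n^'n"
  assumes f: "orthonormal_basis Fq f" and qn: "q\<^sup>2 * real CARD('n) < 1"
    and sym: "\<And>i j. matrix_inv C $ i $ j = matrix_inv C $ j $ i"
    and dual: "\<And>i j. e j \<bullet> (\<Sum>b\<in>UNIV. matrix_inv C $ i $ b *\<^sub>R e b) = (if j = i then 1 else 0)"
    and F: "\<And>i. axis i 1 = (\<Sum>j\<in>UNIV. F i j *\<^sub>R e j)"
  shows "is_free_stein_kernel Fq vacuum X (quad_potential C)
    (\<lambda>i j. if i = j then q_kernel f else (\<lambda>_. 0))"
  unfolding is_free_stein_kernel_def
proof (intro conjI allI)
  note c = q_kernel_distance(1)[OF f qn]
  show "(if i = j then q_kernel f else (\<lambda>_. 0)) \<in> L2_bip Fq vacuum (vN_generated Fq (range X))" for i j :: 'n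
    unfolding L2_bip_eq_hcarrier[OF F] using c by (simp add: bip_space_def)
  fix P :: "'n \<Rightarrow> 'n ncpoly"
  let ?A = "\<lambda>i j :: 'n. if i = j then q_kernel f else (\<lambda>_. 0)"
  have comp: "trace_state Fq vacuum (adj_op Fq (eval_poly Fq X (cyc_grad i (quad_potential C))) \<circ>
      eval_poly Fq X (P i)) = hip FF (jacobian_at Fq vacuum X P i i) (q_kernel f)" for i
  proof -
    let ?Y = "\<lambda>x w. \<Sum>b\<in>UNIV. of_real (matrix_inv C $ i $ b) * X b x w"
    let ?g = "\<Sum>b\<in>UNIV. matrix_inv C $ i $ b *\<^sub>R e b"
    let ?p = "eval_poly Fq X (P i) vacuum"
    have "adj_op Fq (eval_poly Fq X (cyc_grad i (quad_potential C))) = ?Y"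
      unfolding eval_cyc_grad_quad_potential[OF sym] by (rule adj_sum_real)
    then have "trace_state Fq vacuum (adj_op Fq (eval_poly Fq X (cyc_grad i (quad_potential C))) \<circ>
      eval_poly Fq X (P i)) = hip Fq (?Y ?p) vacuum"
      by (simp add: trace_state_def)
    also have "\<dots> = hip Fq ?p (?Y vacuum)"
      by (rule sum_real_symmetric[OF eval_poly_vacuum_hcarrier vacuum_hcarrier])
    also have "?Y vacuum = create ?g vacuum" by (rule sum_X_vacuum)
    also have "hip Fq ?p (create ?g vacuum) = hip FF (jacobian_at Fq vacuum X P i i) (q_kernel f)"
      unfolding jacobian_at_def by (rule stein_identity_component[OF f c dual])
    finally show ?thesis .
  qed
  have "hs_ip Fq ?A (jacobian_at Fq vacuum X P) =
      (\<Sum>i\<in>UNIV. \<Sum>j\<in>UNIV. if i = j then hip FF (jacobian_at Fq vacuum X P i j) (q_kernel f) else 0)"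
    unfolding hs_ip_def bip_space_def by (intro sum.cong refl) simp
  also have "\<dots> = (\<Sum>i\<in>UNIV. hip FF (jacobian_at Fq vacuum X P i i) (q_kernel f))"
    by simp
  finally show "(\<Sum>i\<in>UNIV. trace_state Fq vacuum
      (adj_op Fq (eval_poly Fq X (cyc_grad i (quad_potential C))) \<circ> eval_poly Fq X (P i))) =
    hs_ip Fq ?A (jacobian_at Fq vacuum X P)"
    by (simp add: comp)
qed

lemma identity_kernel_eq:
  "identity_kernel Fq vacuum i j = (if i = j then bip_vec vacuum else (\<lambda>_. 0))"
  using tensor_eval_word[of "[]" "[]"]
  by (simp add: identity_kernel_def eval_word_Nil word_vec_Nil bip_vec_def)

lemma hs_norm_q_kernel:
  assumes f: "orthonormal_basis Fq f" and qn: "q\<^sup>2 * real CARD('n) < 1"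
  shows "hs_norm Fq (\<lambda>i j w. (if i = j then q_kernel f else (\<lambda>_. 0)) w - identity_kernel Fq vacuum (i :: 'n) j w) =
    \<bar>q\<bar> * real CARD('n) / sqrt (1 - q\<^sup>2 * real CARD('n))"
proof -
  let ?n = "real CARD('n)" and ?D = "\<lambda>w. q_kernel f w - bip_vec vacuum w"
  let ?E = "\<lambda>(i :: 'n) j w. (if i = j then q_kernel f else (\<lambda>_. 0)) w - identity_kernel Fq vacuum i j w"
  have E: "?E i j = (if i = j then ?D else (\<lambda>_. 0))" for i j
    by (simp add: identity_kernel_eq)
  have "Re (hs_ip Fq ?E ?E) = (\<Sum>i\<in>UNIV. \<Sum>j\<in>UNIV. if (i :: 'n) = j then Re (hip FF ?D ?D) else 0)"
    unfolding hs_ip_def bip_space_def E Re_sum by (intro sum.cong refl) simp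
  also have "\<dots> = ?n * (q\<^sup>2 * ?n / (1 - q\<^sup>2 * ?n))"
    using q_kernel_distance(2)[OF f qn] by simp
  also have "\<dots> = (\<bar>q\<bar> * ?n)\<^sup>2 / (1 - q\<^sup>2 * ?n)"
    by (simp add: power2_eq_square)
  finally have "hs_norm Fq ?E = sqrt ((\<bar>q\<bar> * ?n)\<^sup>2 / (1 - q\<^sup>2 * ?n))"
    by (simp add: hs_norm_def)
  then show ?thesis by (simp add: real_sqrt_divide real_sqrt_mult abs_mult)
qed

end

theorem mainTheorem7:
  fixes q :: real and C :: "real^'n^'n" and e :: "'n \<Rightarrow> real^'n"
  assumes q: "-1 < q" "q < 1"
    and qn: "q\<^sup>2 * real CARD('n) < 1"
    and C_sym: "transpose C = C"
    and C_pos: "\<forall>v. v \<noteq> 0 \<longrightarrow> 0 < v \<bullet> (C *v v)"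
    and cov: "\<forall>i j. e i \<bullet> e j = C $ i $ j"
  shows "free_stein_discrepancy (q_fock q) vacuum (\<lambda>i. q_semicircular q (e i)) (quad_potential C)
    \<le> ereal (\<bar>q\<bar> * real CARD('n) / sqrt (1 - q\<^sup>2 * real CARD('n)))"
proof -
  interpret q_fock_space q e by unfold_locales (use q in simp)
  let ?D = "matrix_inv C"
  have "\<forall>v. C *v v = 0 \<longrightarrow> v = 0" using C_pos by (metis inner_zero_right less_irrefl)
  then have inv: "invertible C"
    unfolding matrix_left_invertible_ker[symmetric] invertible_left_inverse .
  have CD: "C ** ?D = mat 1" and DC: "?D ** C = mat 1"
    using someI_ex[OF inv[unfolded invertible_def]] by (simp_all add: matrix_inv_def)
  have "transpose ?D ** C = mat 1"
    using arg_cong[OF CD, of transpose] by (simp add: matrix_transpose_mul C_sym)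
  then have "transpose ?D = ?D"
    using CD by (metis matrix_mul_assoc matrix_mul_lid matrix_mul_rid)
  then have sym: "?D $ i $ j = ?D $ j $ i" for i j
  proof -
    have "transpose ?D $ j $ i = ?D $ i $ j" by (simp add: transpose_def)
    then show ?thesis by (simp add: \<open>transpose ?D = ?D\<close>)
  qed
  have dual: "e j \<bullet> (\<Sum>b\<in>UNIV. ?D $ i $ b *\<^sub>R e b) = (if j = i then 1 else 0)" for i j
  proof -
    have "e j \<bullet> (\<Sum>b\<in>UNIV. ?D $ i $ b *\<^sub>R e b) = (\<Sum>b\<in>UNIV. C $ j $ b * ?D $ b $ i)"
      by (simp add: inner_sum_right cov sym[of i] mult.commute)
    also have "\<dots> = (C ** ?D) $ j $ i" by (simp add: matrix_matrix_mult_def)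
    finally show ?thesis by (simp add: CD mat_def)
  qed
  \<comment> \<open>the matrix with rows \<open>e j\<close> satisfies \<open>E E\<^sup>T = C\<close>, so \<open>E\<^sup>T C\<^sup>-\<^sup>1\<close> expresses the standard basis in the \<open>e j\<close>\<close>
  define E :: "real^'n^'n" where "E = (\<chi> j. e j)"
  define F where "F = transpose E ** ?D"
  have "E ** transpose E = C"
    by (simp add: vec_eq_iff matrix_matrix_mult_def E_def transpose_def cov[rule_format, symmetric] inner_vec_def)
  then have "E ** F = mat 1" by (simp add: F_def matrix_mul_assoc CD)
  then have FE: "F ** E = mat 1" by (simp add: matrix_left_right_inverse)
  have axis: "axis i 1 = (\<Sum>j\<in>UNIV. F $ i $ j *\<^sub>R e j)" for i
  proof -
    have "(\<Sum>j\<in>UNIV. F $ i $ j *\<^sub>R e j) $ a = (F ** E) $ i $ a" for a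
      by (simp add: sum_component matrix_matrix_mult_def E_def)
    then show ?thesis by (simp add: FE vec_eq_iff mat_def axis_def)
  qed
  obtain f where f: "orthonormal_basis Fq f" using orthonormal_basis_exists by blast
  let ?A = "\<lambda>i j :: 'n. if i = j then q_kernel f else (\<lambda>_. 0)"
  have "?A \<in> {A. is_free_stein_kernel Fq vacuum X (quad_potential C) A}"
    using q_kernel_is_free_stein_kernel[OF f qn sym dual axis] by simp
  then have "free_stein_discrepancy Fq vacuum X (quad_potential C) \<le>
      ereal (hs_norm Fq (\<lambda>i j w. ?A i j w - identity_kernel Fq vacuum i j w))"
    unfolding free_stein_discrepancy_def by (rule INF_lower)
  then show ?thesis unfolding hs_norm_q_kernel[OF f qn] .
qed

end
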